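(* The functional $\mathcal Q_*$ attains its minimum on $\mathcal A$; that is, there exists $F_*\in\mathcal A$ such that $\mathcal Q_*(F_* )=\inf_{E\in\mathcal A}\mathcal Q_*(E)$.
   Context: A convex body in $\mathbb R^3$ is a compact convex set with nonempty interior. $\mathcal A$ denotes the class of all convex bodies $F\subset\mathbb R^3$ with Lebesgue measure $|F|=4\pi/3$. $B=B_1(0)$ is the unit ball of $\mathbb R^3$ centered at the origin, $P(F)$ is the perimeter (surface area) of $F$ (so $P(B)=4\pi$), and $d_H$ is the Hausdorff distance. For $F\in\mathcal A$ define the isoperimetric deficit $\delta(F)=\frac{P(F)-P(B)}{P(B)}$, the Hausdorff asymmetry $\lambda_*(F)=\inf_{x\in\mathbb R^3} d_H(F,B+x)$, and $$\mathcal Q_*(F)=\frac{\delta(F)\,\log\!\left(\delta(F)+\frac1{\delta(F)}\right)P(F)^3}{\lambda_*(F)^2}$$ if $F$ is not a ball, while $\mathcal Q_*(F)=+\infty$ if $F$ is a ball. *)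

theory Defs
  imports "HOL-Analysis.Analysis"
begin

definition convex_body :: "'a::euclidean_space set \<Rightarrow> bool" where
  "convex_body F \<longleftrightarrow> compact F \<and> convex F \<and> interior F \<noteq> {}"

definition volume_class :: "(real ^ 3) set set" where
  "volume_class = {F. convex_body F \<and> emeasure lebesgue F = ennreal (4 * pi / 3)}"

definition divergence :: "('a::euclidean_space \<Rightarrow> 'a) \<Rightarrow> 'a \<Rightarrow> real" where
  "divergence \<phi> x = (\<Sum>b\<in>Basis. frechet_derivative \<phi> (at x) b \<bullet> b)"

definition C1_compact_support :: "('a::euclidean_space \<Rightarrow> 'b::euclidean_space) \<Rightarrow> bool" where
  "C1_compact_support \<phi> \<longleftrightarrow>
     (\<forall>x. \<phi> differentiable (at x)) \<and>
     (\<forall>v. continuous_on UNIV (\<lambda>x. frechet_derivative \<phi> (at x) v)) \<and>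
     compact (closure {x. \<phi> x \<noteq> 0})"

text \<open>De Giorgi perimeter: the total variation of the distributional gradient of the
  indicator function, which for a convex body is its surface area.\<close>

definition perimeter :: "'a::euclidean_space set \<Rightarrow> ereal" where
  "perimeter F =
     (SUP \<phi>\<in>{\<phi> :: 'a \<Rightarrow> 'a. C1_compact_support \<phi> \<and> (\<forall>x. norm (\<phi> x) \<le> 1)}.
        ereal (set_lebesgue_integral lebesgue F (divergence \<phi>)))"

text \<open>The coercion to \<^typ>\<open>real\<close> loses nothing on convex bodies, whose perimeter is finite.\<close>

definition surface_area :: "'a::euclidean_space set \<Rightarrow> real" where
  "surface_area F = real_of_ereal (perimeter F)"

definition isoperimetric_deficit :: "(real ^ 3) set \<Rightarrow> real" where
  "isoperimetric_deficit F =
     (surface_area F - surface_area (cball (0 :: real ^ 3) 1)) /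
     surface_area (cball (0 :: real ^ 3) 1)"

text \<open>The suprema are real-valued, so this is meaningful for nonempty bounded sets only.\<close>

definition hausdorff_dist :: "'a::metric_space set \<Rightarrow> 'a set \<Rightarrow> real" where
  "hausdorff_dist A B = max (SUP a\<in>A. infdist a B) (SUP b\<in>B. infdist b A)"

definition hausdorff_asymmetry :: "(real ^ 3) set \<Rightarrow> real" where
  "hausdorff_asymmetry F = (INF x. hausdorff_dist F ((+) x ` cball 0 1))"

definition Q_star :: "(real ^ 3) set \<Rightarrow> ereal" where
  "Q_star F =
     (if \<exists>x r. r > 0 \<and> F = cball x r then \<infinity>
      else ereal
        (isoperimetric_deficit F *
           ln (isoperimetric_deficit F + 1 / isoperimetric_deficit F) *
           surface_area F ^ 3 / (hausdorff_asymmetry F)\<^sup>2))"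

end

theory Submission
  imports Defs "HOL-Real_Asymp.Real_Asymp" "HOL-Complex_Analysis.Great_Picard"
begin

text \<open>
  By the direct method, it suffices to exclude that a minimizing sequence converges to the ball or that its
  diameter diverges. For a convex body F of volume \<open>4 * pi / 3\<close> and a direction e, the map S transports the
  mass distribution of the unit ball along an axis onto that of F along e. Transporting sections and applying
  the Brunn--Minkowski inequality to them bounds the volume of the parallel sets of F from below, and the
  perimeter dominates the growth rate of these volumes. The result is
  \<open>P(F) - 4 * pi \<ge> pi * (integral over {-1..1} of (1 - s\<^sup>2) * Psi (S' s))\<close> with
  \<open>Psi x = 1 / x + 2 * sqrt x - 3 \<ge> 0\<close>. For bounded deficit this bounds the width in the direction e.
  For small deficit \<open>\<delta>\<close> the weight \<open>1 - s\<^sup>2\<close> produces a logarithm in the estimate of \<open>S s - s\<close>, which is cut off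
  at distance \<open>sqrt \<delta>\<close> from the end points by convexity; with the origin at the centroid of F it follows that
  the Hausdorff asymmetry is at most \<open>sqrt (3 / 2 * \<delta> * ln (1 / \<delta>)) + O(sqrt \<delta>)\<close>. Hence the quotient, divided by
  \<open>(4 * pi) ^ 3\<close>, has lower limit at least 2/3 near the ball, whereas its value at the spheroid with semi-axes
  1/2, 1/2, 4 is at most \<open>8 / 9 * ln 2 < 2 / 3\<close>.
\<close>

section \<open>Perimeter and Minkowski content\<close>

text \<open>The perimeter is a supremum over test fields, without any boundary measure, so every
  lower bound requires an explicit field. It is built around a homothetic contraction of the body:
  the gap makes room for a parallel set and for mollification, and is closed by letting the ratio
  tend to 1. The constant 3/2 comes from the Cauchy-Schwarz inequality. The integral of
  \<open>1 / (1 - s\<^sup>2)\<close> from 0 up to distance \<open>sqrt \<delta>\<close> from an end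
  is about \<open>ln (1 / \<delta>) / 4\<close>, the energy is at most \<open>4 * \<delta>\<close>,
  and \<open>Psi x \<ge> 2 / 3 * (x - 1)\<^sup>2\<close> near 1, so the squared displacement is
  about \<open>3 / 2 * 4 * \<delta> * ln (1 / \<delta>) / 4\<close>. The ball compared with must not
  depend on the direction. The centroid serves all directions at once, since the displacement
  weighted by \<open>1 - s\<^sup>2\<close> carries no logarithm. The functional is lower
  semicontinuous because the perimeter enters through an increasing weight. For large deficit this
  weight grows like a fourth power times a logarithm, the squared asymmetry at most like a fourth
  power: the logarithm excludes diverging diameters.\<close>

lemma DERIV_max0_power:
  "((\<lambda>u::real. max 0 u ^ Suc (Suc n)) has_real_derivative real (n + 2) * max 0 u ^ Suc n) (at u)"
proof -
  consider "u > 0" | "u < 0" | "u = 0" by linarith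
  then show ?thesis
  proof cases
    case 1
    have "((\<lambda>u::real. u ^ Suc (Suc n)) has_real_derivative real (n + 2) * u ^ Suc n) (at u)"
      using DERIV_pow[of "Suc (Suc n)" u] by simp
    from has_field_derivative_transform_within_open[OF this, of "{0<..}"] 1
    show ?thesis by auto
  next
    case 2
    have "((\<lambda>u::real. 0) has_real_derivative 0) (at u)" by simp
    from has_field_derivative_transform_within_open[OF this, of "{..<0}"] 2
    show ?thesis by auto
  next
    case 3
    have lim: "((\<lambda>h::real. max 0 h ^ Suc n) \<longlongrightarrow> 0) (at 0)"
      by (rule tendsto_eq_intros | simp)+
    have eq: "(max 0 h ^ Suc (Suc n) - max 0 0 ^ Suc (Suc n)) / h = max 0 h ^ Suc n" if "h \<noteq> 0" for h :: real
      using that by (cases "h > 0") (auto simp: max_def)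
    have "((\<lambda>h::real. (max 0 h ^ Suc (Suc n) - max 0 0 ^ Suc (Suc n)) / h) \<longlongrightarrow> 0) (at 0)"
      by (rule Lim_transform_eventually[OF lim]) (unfold eventually_at_filter, rule always_eventually, use eq in metis)
    then show ?thesis
      by (simp add: 3 DERIV_def)
  qed
qed

text \<open>The cube makes the function twice continuously differentiable, so that the gradient of a
  mollification is an admissible C1 field. Being polynomial on its support, it has explicit
  derivatives.\<close>

definition bump :: "real \<Rightarrow> 'a::euclidean_space \<Rightarrow> real" where
  "bump \<epsilon> z = max 0 (\<epsilon>\<^sup>2 - z \<bullet> z) ^ 3"

definition grad_bump :: "real \<Rightarrow> 'a::euclidean_space \<Rightarrow> 'a" where
  "grad_bump \<epsilon> z = (- 6 * max 0 (\<epsilon>\<^sup>2 - z \<bullet> z) ^ 2) *\<^sub>R z"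

text \<open>\<open>leibniz_rule\<close> takes derivatives as bounded linear functions that depend
  continuously on the parameter, hence the encoding in this type.\<close>

definition hess_bump :: "real \<Rightarrow> 'a::euclidean_space \<Rightarrow> 'a \<Rightarrow>\<^sub>L 'a" where
  "hess_bump \<epsilon> z = (- 6 * max 0 (\<epsilon>\<^sup>2 - z \<bullet> z) ^ 2) *\<^sub>R id_blinfun +
     (24 * max 0 (\<epsilon>\<^sup>2 - z \<bullet> z)) *\<^sub>R (blinfun_scaleR_left z o\<^sub>L blinfun_inner_left z)"

lemma bump_has_derivative:
  "(bump \<epsilon> has_derivative blinfun_apply (blinfun_inner_left (grad_bump \<epsilon> z))) (at z)"
proof -
  have 1: "((\<lambda>z. \<epsilon>\<^sup>2 - z \<bullet> z) has_derivative (\<lambda>v. - 2 * (z \<bullet> v))) (at z)"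
    by (auto intro!: derivative_eq_intros simp: inner_commute)
  have 2: "((\<lambda>u::real. max 0 u ^ 3) has_derivative (*) (3 * max 0 (\<epsilon>\<^sup>2 - z \<bullet> z) ^ 2)) (at (\<epsilon>\<^sup>2 - z \<bullet> z))"
    using DERIV_max0_power[of 1] by (simp add: has_field_derivative_def eval_nat_numeral)
  have "((\<lambda>z. max 0 (\<epsilon>\<^sup>2 - z \<bullet> z) ^ 3) has_derivative
     (\<lambda>v. (3 * max 0 (\<epsilon>\<^sup>2 - z \<bullet> z) ^ 2) * (- 2 * (z \<bullet> v)))) (at z)"
    using diff_chain_at[OF 1 2] by (simp add: o_def)
  then show ?thesis
    by (auto simp: bump_def[abs_def] grad_bump_def inner_commute algebra_simps
        elim!: has_derivative_eq_rhs)
qed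

lemma grad_bump_has_derivative:
  "(grad_bump \<epsilon> has_derivative blinfun_apply (hess_bump \<epsilon> z)) (at z)"
proof -
  have 1: "((\<lambda>z. \<epsilon>\<^sup>2 - z \<bullet> z) has_derivative (\<lambda>v. - 2 * (z \<bullet> v))) (at z)"
    by (auto intro!: derivative_eq_intros simp: inner_commute)
  have 2: "((\<lambda>u::real. max 0 u ^ 2) has_derivative (*) (2 * max 0 (\<epsilon>\<^sup>2 - z \<bullet> z))) (at (\<epsilon>\<^sup>2 - z \<bullet> z))"
    using DERIV_max0_power[of 0] by (simp add: has_field_derivative_def eval_nat_numeral)
  have "((\<lambda>z. max 0 (\<epsilon>\<^sup>2 - z \<bullet> z) ^ 2) has_derivative
     (\<lambda>v. (2 * max 0 (\<epsilon>\<^sup>2 - z \<bullet> z)) * (- 2 * (z \<bullet> v)))) (at z)"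
    using diff_chain_at[OF 1 2] by (simp add: o_def)
  from has_derivative_scaleR[OF has_derivative_mult_right[OF this, of "- 6"] has_derivative_ident]
  show ?thesis
    unfolding grad_bump_def[abs_def] hess_bump_def
    by (rule has_derivative_eq_rhs)
      (rule ext, simp add: blinfun.add_left blinfun.diff_left blinfun.scaleR_left blinfun.minus_left inner_commute algebra_simps)
qed

lemma continuous_on_bump [continuous_intros]:
  "continuous_on S f \<Longrightarrow> continuous_on S (\<lambda>x. bump \<epsilon> (f x))"
  unfolding bump_def by (intro continuous_intros) auto

lemma continuous_on_grad_bump [continuous_intros]:
  "continuous_on S f \<Longrightarrow> continuous_on S (\<lambda>x. grad_bump \<epsilon> (f x))"
  unfolding grad_bump_def by (intro continuous_intros) auto

lemma continuous_on_hess_bump [continuous_intros]: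
  "continuous_on S f \<Longrightarrow> continuous_on S (\<lambda>x. hess_bump \<epsilon> (f x))"
  unfolding hess_bump_def by (intro continuous_intros) auto

lemma bump_nonneg: "bump \<epsilon> z \<ge> 0"
  by (simp add: bump_def)

lemma bump_eq_0_iff: "\<epsilon> > 0 \<Longrightarrow> bump \<epsilon> z = 0 \<longleftrightarrow> norm z \<ge> \<epsilon>"
  by (auto simp: bump_def max_def dot_square_norm abs_le_square_iff[symmetric] power_mono)

lemma grad_bump_eq_0: "\<epsilon> > 0 \<Longrightarrow> norm z \<ge> \<epsilon> \<Longrightarrow> grad_bump \<epsilon> z = 0"
  by (auto simp: grad_bump_def max_def dot_square_norm abs_le_square_iff[symmetric] power_mono)

lemma bump_minus: "bump \<epsilon> (- z) = bump \<epsilon> z"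
  by (simp add: bump_def)

text \<open>A single use of l'Hospital's rule reduces the claim to \<open>h'\<close>, which needs a
  derivative only at 0: the new quotient is the mean of the two one-sided difference quotients of
  \<open>h'\<close>.\<close>

lemma second_difference_tendsto:
  fixes h h' :: "real \<Rightarrow> real"
  assumes 1: "\<And>t. (h has_real_derivative h' t) (at t)" and 2: "(h' has_real_derivative c) (at 0)"
  shows "((\<lambda>t. (h t + h (- t) - 2 * h 0) / t\<^sup>2) \<longlongrightarrow> c) (at_right 0)"
proof (rule lhopital_right_0)
  have hc: "isCont h 0" using 1 DERIV_isCont by blast
  have "(h \<longlongrightarrow> h 0) (at_right 0)" using hc
    by (simp add: isCont_def filterlim_at_split)
  moreover have "((\<lambda>t. h (- t)) \<longlongrightarrow> h 0) (at_right 0)"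
    using hc by (simp add: isCont_def filterlim_at_split filterlim_at_left_to_right)
  ultimately have "((\<lambda>t. h t + h (- t) - 2 * h 0) \<longlongrightarrow> h 0 + h 0 - 2 * h 0) (at_right 0)"
    by (intro tendsto_intros)
  then show "((\<lambda>t. h t + h (- t) - 2 * h 0) \<longlongrightarrow> 0) (at_right 0)" by simp
  show "((\<lambda>t::real. t\<^sup>2) \<longlongrightarrow> 0) (at_right 0)"
    by (rule tendsto_eq_intros | simp)+
  show "eventually (\<lambda>t::real. t\<^sup>2 \<noteq> 0) (at_right 0)"
    by (auto simp: eventually_at_filter)
  show "eventually (\<lambda>t::real. 2 * t \<noteq> 0) (at_right 0)"
    by (auto simp: eventually_at_filter)
  show "eventually (\<lambda>t. ((\<lambda>t. h t + h (- t) - 2 * h 0) has_real_derivative h' t - h' (- t)) (at t)) (at_right 0)"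
    by (rule always_eventually)
      (auto intro!: derivative_eq_intros 1 DERIV_chain2[OF 1])
  show "eventually (\<lambda>t::real. ((\<lambda>t. t\<^sup>2) has_real_derivative 2 * t) (at t)) (at_right 0)"
    by (rule always_eventually) (auto intro!: derivative_eq_intros)
  have l0: "((\<lambda>t. (h' t - h' 0) / t) \<longlongrightarrow> c) (at 0)"
    using 2 by (simp add: DERIV_def)
  have r: "((\<lambda>t. (h' t - h' 0) / t) \<longlongrightarrow> c) (at_right 0)"
    and l: "((\<lambda>t. (h' (- t) - h' 0) / (- t)) \<longlongrightarrow> c) (at_right 0)"
    using l0 by (simp_all add: filterlim_at_split filterlim_at_left_to_right)
  have "((\<lambda>t. ((h' t - h' 0) / t + (h' (- t) - h' 0) / (- t)) / 2) \<longlongrightarrow> (c + c) / 2) (at_right 0)"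
    by (intro tendsto_intros r l) auto
  then show "((\<lambda>t. (h' t - h' (- t)) / (2 * t)) \<longlongrightarrow> c) (at_right 0)"
    by (auto elim!: Lim_transform_eventually simp: eventually_at_filter field_simps)
qed


lemma bump_integral_pos:
  assumes "\<epsilon> > 0"
  shows "integrable lborel (bump \<epsilon> :: 'a::euclidean_space \<Rightarrow> real)"
    and "(LINT z|lborel. bump \<epsilon> (z::'a)) > 0"
proof -
  have eq: "bump \<epsilon> z = indicator (cball 0 \<epsilon>) z *\<^sub>R bump \<epsilon> z" for z :: 'a
    using bump_eq_0_iff[OF assms, of z] by (auto simp: indicator_def)
  show int: "integrable lborel (bump \<epsilon> :: 'a \<Rightarrow> real)"
    by (subst eq[abs_def]) (intro borel_integrable_compact compact_cball continuous_intros)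
  have "(LINT z|lborel. bump \<epsilon> (z::'a)) \<noteq> 0"
  proof
    assume "(LINT z|lborel. bump \<epsilon> (z::'a)) = 0"
    then have "AE z in lborel. bump \<epsilon> (z::'a) = 0"
      using integral_nonneg_eq_0_iff_AE[OF int] bump_nonneg by auto
    then have "AE z in lborel. (z::'a) \<notin> ball 0 \<epsilon>"
      by eventually_elim (metis bump_eq_0_iff[OF assms] mem_ball_0 not_le)
    then have "ball 0 \<epsilon> \<in> null_sets (lborel :: 'a measure)"
      by (subst AE_iff_null_sets) auto
    then show False
      using assms open_not_negligible[of "ball (0::'a) \<epsilon>"]
      by (auto simp: negligible_iff_null_sets null_sets_completion_iff)
  qed
  moreover have "(LINT z|lborel. bump \<epsilon> (z::'a)) \<ge> 0"
    by (simp add: bump_nonneg)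
  ultimately show "(LINT z|lborel. bump \<epsilon> (z::'a)) > 0" by linarith
qed

definition kernel :: "real \<Rightarrow> 'a::euclidean_space \<Rightarrow> real" where
  "kernel \<epsilon> z = bump \<epsilon> z / (LINT z|lborel. bump \<epsilon> (z::'a))"

lemma kernel:
  assumes "\<epsilon> > 0"
  shows "kernel \<epsilon> (z::'a::euclidean_space) \<ge> 0" "norm z \<ge> \<epsilon> \<Longrightarrow> kernel \<epsilon> z = 0"
    "integrable lborel (kernel \<epsilon> :: 'a \<Rightarrow> real)" "(LINT z|lborel. kernel \<epsilon> (z::'a)) = 1"
    "continuous_on UNIV (kernel \<epsilon> :: 'a \<Rightarrow> real)"
  using bump_integral_pos[OF assms, where 'a='a] bump_nonneg[of \<epsilon> z] bump_eq_0_iff[OF assms, of z]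
  unfolding kernel_def[abs_def] by (auto intro!: continuous_intros)

lemma continuous_on_nonexpansive:
  fixes f :: "'a::real_normed_vector \<Rightarrow> real"
  assumes "\<And>x y. \<bar>f x - f y\<bar> \<le> norm (x - y)"
  shows "continuous_on S f"
proof (rule continuous_onI)
  fix x e assume "(0::real) < e" "x \<in> S"
  moreover have "dist (f x') (f x) \<le> e" if "dist x' x < e" for x'
    using assms[of x' x] that by (simp add: dist_norm)
  ultimately show "\<exists>d>0. \<forall>x'\<in>S. dist x' x < d \<longrightarrow> dist (f x') (f x) \<le> e"
    by blast
qed

text \<open>The field is the gradient of the convolution of \<open>g\<close> with
  \<open>kernel \<epsilon>\<close>. Convolution keeps the Lipschitz constant 1, which bounds the
  norm. The divergence is the Laplacian of the convolution, hence a limit of averaged second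
  differences of \<open>g\<close>, so a quadratic lower bound for these suffices and
  \<open>g\<close> itself need not be differentiable.\<close>

lemma mollify_field:
  fixes g :: "'a::euclidean_space \<Rightarrow> real"
  assumes lip: "\<And>x y. \<bar>g x - g y\<bar> \<le> norm (x - y)"
    and supp: "\<And>y. norm y > R \<Longrightarrow> g y = 0" and \<epsilon>: "\<epsilon> > 0"
  shows "\<exists>\<phi> :: 'a \<Rightarrow> 'a. C1_compact_support \<phi> \<and> (\<forall>x. norm (\<phi> x) \<le> 1) \<and>
    (\<forall>x c t0. 0 < t0 \<longrightarrow> (\<forall>t. 0 < t \<longrightarrow> t < t0 \<longrightarrow>
        c * t\<^sup>2 \<le> (LINT z|lborel. kernel \<epsilon> z *
           (\<Sum>b\<in>Basis. g (x + z + t *\<^sub>R b) + g (x + z - t *\<^sub>R b) - 2 * g (x + z)))) \<longrightarrow> c \<le> divergence \<phi> x)"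
proof -
  define K where "K = (LINT z|lborel. bump \<epsilon> (z::'a))"
  have K: "K > 0" using bump_integral_pos(2)[OF \<epsilon>] by (simp add: K_def)
  obtain a b :: 'a where ab: "cball 0 R \<subseteq> cbox a b"
    by (meson bounded_cball bounded_subset_cbox_symmetric)
  have gC: "g y = 0" if "y \<notin> cbox a b" for y
    using supp[of y] ab that by (meson mem_cball_0 not_le subsetD)
  have contg: "continuous_on S g" for S
    by (rule continuous_on_nonexpansive[OF lip])
  note contg2 [continuous_intros] = continuous_on_compose2[OF contg[of UNIV], OF _ subset_UNIV]
  \<comment> \<open>The convolutions with the bump, its gradient and its Hessian, not yet divided by
    the mass \<open>K\<close>. All derivatives fall on the bump, and the box supplies the compact
    domain for differentiating under the integral.\<close>
  define F where "F x = integral (cbox a b) (\<lambda>y. g y * bump \<epsilon> (x - y))" for x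
  define \<Phi> where "\<Phi> x = integral (cbox a b) (\<lambda>y. g y *\<^sub>R grad_bump \<epsilon> (x - y))" for x
  define H where "H x = integral (cbox a b) (\<lambda>y. g y *\<^sub>R hess_bump \<epsilon> (x - y))" for x
  have derF: "(F has_derivative (\<lambda>v. \<Phi> x \<bullet> v)) (at x)" for x
  proof -
    have "((\<lambda>x. integral (cbox a b) (\<lambda>y. g y * bump \<epsilon> (x - y))) has_derivative
        integral (cbox a b) (\<lambda>y. g y *\<^sub>R blinfun_inner_left (grad_bump \<epsilon> (x - y)))) (at x within UNIV)"
    proof (rule leibniz_rule)
      fix x t :: 'a
      have d: "((\<lambda>x. x - t) has_derivative (\<lambda>v. v)) (at x)"
        by (auto intro!: derivative_eq_intros)
      have "((\<lambda>x. bump \<epsilon> (x - t)) has_derivative blinfun_inner_left (grad_bump \<epsilon> (x - t))) (at x)"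
        using diff_chain_at[OF d bump_has_derivative] by (simp add: o_def)
      from has_derivative_mult_right[OF this, of "g t"]
      show "((\<lambda>x. g t * bump \<epsilon> (x - t)) has_derivative
          blinfun_apply (g t *\<^sub>R blinfun_inner_left (grad_bump \<epsilon> (x - t)))) (at x within UNIV)"
        by (simp add: blinfun.bilinear_simps[abs_def])
    qed (auto intro!: integrable_continuous continuous_intros simp: split_beta)
    also have "integral (cbox a b) (\<lambda>y. g y *\<^sub>R blinfun_inner_left (grad_bump \<epsilon> (x - y))) =
        blinfun_inner_left (\<Phi> x)"
      unfolding \<Phi>_def
      by (subst integral_linear[symmetric, OF _ bounded_linear_blinfun_inner_left])
        (auto intro!: integrable_continuous continuous_intros
          simp: o_def linear_cmul[OF bounded_linear.linear[OF bounded_linear_blinfun_inner_left]])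
    finally show ?thesis
      unfolding F_def[abs_def] by (simp add: inner_commute blinfun_inner_left.rep_eq[abs_def])
  qed
  have der\<Phi>: "(\<Phi> has_derivative blinfun_apply (H x)) (at x)" for x
  proof -
    have "((\<lambda>x. integral (cbox a b) (\<lambda>y. g y *\<^sub>R grad_bump \<epsilon> (x - y))) has_derivative
        integral (cbox a b) (\<lambda>y. g y *\<^sub>R hess_bump \<epsilon> (x - y))) (at x within UNIV)"
    proof (rule leibniz_rule)
      fix x t :: 'a
      have d: "((\<lambda>x. x - t) has_derivative (\<lambda>v. v)) (at x)"
        by (auto intro!: derivative_eq_intros)
      have "((\<lambda>x. grad_bump \<epsilon> (x - t)) has_derivative hess_bump \<epsilon> (x - t)) (at x)"
        using diff_chain_at[OF d grad_bump_has_derivative] by (simp add: o_def)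
      from has_derivative_scaleR_right[OF this, of "g t"]
      show "((\<lambda>x. g t *\<^sub>R grad_bump \<epsilon> (x - t)) has_derivative
          blinfun_apply (g t *\<^sub>R hess_bump \<epsilon> (x - t))) (at x within UNIV)"
        by (simp add: blinfun.bilinear_simps[abs_def])
    qed (auto intro!: integrable_continuous continuous_intros simp: split_beta)
    then show ?thesis
      unfolding \<Phi>_def[abs_def] H_def by simp
  qed
  have contH: "continuous_on UNIV H"
    unfolding H_def[abs_def]
    by (rule integral_continuous_on_param) (auto intro!: continuous_intros simp: split_beta)
  have F_eq: "F x = (LINT z|lborel. bump \<epsilon> z * g (x + z))" for x
  proof -
    have "F x = (LINT y:cbox a b|lborel. g y * bump \<epsilon> (x - y))"
      unfolding F_def
      by (rule set_borel_integral_eq_integral(2)[symmetric])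
        (unfold set_integrable_def, intro borel_integrable_compact compact_cbox continuous_intros)
    also have "\<dots> = (LINT y|lborel. bump \<epsilon> (y - x) * g y)"
      unfolding set_lebesgue_integral_def
      by (rule Bochner_Integration.integral_cong)
        (auto simp: indicator_def gC bump_minus[of \<epsilon> "x - _", symmetric])
    also have "\<dots> = (LINT y|distr lborel borel ((+) x). bump \<epsilon> (y - x) * g y)"
      by (simp add: lborel_distr_plus)
    also have "\<dots> = (LINT z|lborel. bump \<epsilon> z * g (x + z))"
      by (subst integral_distr) (auto intro!: borel_measurable_continuous_onI continuous_intros)
    finally show ?thesis .
  qed
  have int: "integrable lborel (\<lambda>z. bump \<epsilon> z * g (x + z))" for x
  proof -
    have eq: "bump \<epsilon> z * g (x + z) = indicator (cball 0 \<epsilon>) z *\<^sub>R (bump \<epsilon> z * g (x + z))" for z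
      using bump_eq_0_iff[OF \<epsilon>, of z] by (auto simp: indicator_def)
    show ?thesis
      by (subst eq[abs_def]) (intro borel_integrable_compact compact_cball continuous_intros)
  qed
  have Flip: "\<bar>F x - F y\<bar> \<le> K * norm (x - y)" for x y
  proof -
    have "\<bar>F x - F y\<bar> = \<bar>LINT z|lborel. bump \<epsilon> z * (g (x + z) - g (y + z))\<bar>"
      using int by (simp add: F_eq right_diff_distrib)
    also have "\<dots> \<le> (LINT z|lborel. bump \<epsilon> (z::'a) * norm (x - y))"
    proof (rule Bochner_Integration.integral_abs_bound_integral)
      show "integrable lborel (\<lambda>z. bump \<epsilon> z * (g (x + z) - g (y + z)))"
        using int[of x] int[of y] by (simp add: right_diff_distrib)
      show "integrable lborel (\<lambda>z::'a. bump \<epsilon> z * norm (x - y))"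
        using bump_integral_pos(1)[OF \<epsilon>] by auto
      fix z :: 'a
      show "\<bar>bump \<epsilon> z * (g (x + z) - g (y + z))\<bar> \<le> bump \<epsilon> z * norm (x - y)"
        using lip[of "x + z" "y + z"] by (simp add: abs_mult bump_nonneg mult_left_mono)
    qed
    also have "\<dots> = K * norm (x - y)" by (simp add: K_def)
    finally show ?thesis .
  qed
  \<comment> \<open>Differentiating \<open>F\<close> in the direction of its own gradient turns the
    Lipschitz bound into a bound for the norm of the gradient.\<close>
  have \<Phi>bd: "norm (\<Phi> x) \<le> K" for x
  proof -
    let ?h = "\<lambda>t::real. F (x + t *\<^sub>R \<Phi> x)"
    have "((\<lambda>t. x + t *\<^sub>R \<Phi> x) has_derivative (\<lambda>t. t *\<^sub>R \<Phi> x)) (at 0)"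
      by (auto intro!: derivative_eq_intros)
    from diff_chain_at[OF this, of F "\<lambda>v. \<Phi> x \<bullet> v"] derF[of x]
    have "(?h has_real_derivative \<Phi> x \<bullet> \<Phi> x) (at 0)"
      by (intro has_derivative_imp_has_field_derivative[where D = "\<lambda>t. \<Phi> x \<bullet> (t *\<^sub>R \<Phi> x)"]) (simp_all add: o_def)
    then have "((\<lambda>t. \<bar>(?h t - ?h 0) / t\<bar>) \<longlongrightarrow> \<bar>\<Phi> x \<bullet> \<Phi> x\<bar>) (at 0)"
      by (intro tendsto_rabs) (simp add: DERIV_def)
    moreover have "eventually (\<lambda>t. \<bar>(?h t - ?h 0) / t\<bar> \<le> K * norm (\<Phi> x)) (at 0)"
    proof (rule eventually_at_filter[THEN iffD2], rule always_eventually, intro allI impI)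
      fix t :: real assume "t \<noteq> 0"
      then show "\<bar>(?h t - ?h 0) / t\<bar> \<le> K * norm (\<Phi> x)"
        using Flip[of "x + t *\<^sub>R \<Phi> x" x] by (simp add: divide_simps mult_ac)
    qed
    ultimately have "\<bar>\<Phi> x \<bullet> \<Phi> x\<bar> \<le> K * norm (\<Phi> x)"
      by (rule tendsto_upperbound) simp
    then have "norm (\<Phi> x) * norm (\<Phi> x) \<le> K * norm (\<Phi> x)"
      by (simp add: dot_square_norm power2_eq_square)
    then show ?thesis using K by (cases "\<Phi> x = 0") auto
  qed
  define \<phi> where "\<phi> x = (1 / K) *\<^sub>R \<Phi> x" for x
  have der\<phi>: "(\<phi> has_derivative (\<lambda>v. (1 / K) *\<^sub>R H x v)) (at x)" for x
    unfolding \<phi>_def by (intro has_derivative_scaleR_right der\<Phi>)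
  have fr: "frechet_derivative \<phi> (at x) = (\<lambda>v. (1 / K) *\<^sub>R H x v)" for x
    using frechet_derivative_at[OF der\<phi>] by simp
  have supp\<phi>: "{x. \<phi> x \<noteq> 0} \<subseteq> cball 0 (R + \<epsilon>)"
  proof safe
    fix x assume "\<phi> x \<noteq> 0"
    show "x \<in> cball 0 (R + \<epsilon>)"
    proof (rule ccontr)
      assume "x \<notin> cball 0 (R + \<epsilon>)"
      then have x: "norm x > R + \<epsilon>" by simp
      have z: "g y *\<^sub>R grad_bump \<epsilon> (x - y) = 0" for y
      proof (cases "norm y > R")
        case False
        then have "norm (x - y) \<ge> \<epsilon>" using x norm_triangle_ineq2[of x y] by linarith
        then show ?thesis by (simp add: grad_bump_eq_0 \<epsilon>)
      qed (simp add: supp)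
      have "\<Phi> x = 0" unfolding \<Phi>_def z by simp
      with \<open>\<phi> x \<noteq> 0\<close> show False by (simp add: \<phi>_def)
    qed
  qed
  show ?thesis
  proof (intro exI[of _ \<phi>] conjI allI impI)
    show "C1_compact_support \<phi>"
      unfolding C1_compact_support_def
    proof (intro conjI allI)
      show "\<phi> differentiable (at x)" for x using der\<phi> by (auto simp: differentiable_def)
      show "continuous_on UNIV (\<lambda>x. frechet_derivative \<phi> (at x) v)" for v
        unfolding fr by (intro continuous_intros contH)
      show "compact (closure {x. \<phi> x \<noteq> 0})"
        using supp\<phi> bounded_subset[OF bounded_cball] by (simp add: compact_closure)
    qed
    show "norm (\<phi> x) \<le> 1" for x
      using \<Phi>bd[of x] K by (simp add: \<phi>_def)
    fix x c t0
    assume t0: "(t0::real) > 0" and le: "\<forall>t. 0 < t \<longrightarrow> t < t0 \<longrightarrow>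
        c * t\<^sup>2 \<le> (LINT z|lborel. kernel \<epsilon> z *
           (\<Sum>b\<in>Basis. g (x + z + t *\<^sub>R b) + g (x + z - t *\<^sub>R b) - 2 * g (x + z)))"
    have *: "((\<lambda>t. (F (x + t *\<^sub>R b) + F (x - t *\<^sub>R b) - 2 * F x) / t\<^sup>2) \<longlongrightarrow> H x b \<bullet> b) (at_right 0)" for b
    proof -
      have l: "((\<lambda>t. x + t *\<^sub>R b) has_derivative (\<lambda>t. t *\<^sub>R b)) (at t)" for t :: real
        by (auto intro!: derivative_eq_intros)
      have 1: "((\<lambda>t. F (x + t *\<^sub>R b)) has_real_derivative \<Phi> (x + t *\<^sub>R b) \<bullet> b) (at t)" for t
        using diff_chain_at[OF l derF]
        by (intro has_derivative_imp_has_field_derivative[where D = "\<lambda>s. \<Phi> (x + t *\<^sub>R b) \<bullet> (s *\<^sub>R b)"])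
          (simp_all add: o_def)
      have "((\<lambda>t. \<Phi> (x + t *\<^sub>R b) \<bullet> b) has_derivative (\<lambda>t. H x (t *\<^sub>R b) \<bullet> b)) (at 0)"
        using has_derivative_inner_left[OF diff_chain_at[OF l der\<Phi>, of 0], of b] by (simp add: o_def)
      then have 2: "((\<lambda>t. \<Phi> (x + t *\<^sub>R b) \<bullet> b) has_real_derivative H x b \<bullet> b) (at 0)"
        by (rule has_derivative_imp_has_field_derivative) (simp add: blinfun.bilinear_simps)
      show ?thesis using second_difference_tendsto[OF 1 2] by simp
    qed
    have "((\<lambda>t. (1 / K) * (\<Sum>b\<in>Basis. (F (x + t *\<^sub>R b) + F (x - t *\<^sub>R b) - 2 * F x) / t\<^sup>2)) \<longlongrightarrow>
        (1 / K) * (\<Sum>b\<in>Basis. H x b \<bullet> b)) (at_right 0)"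
      by (intro tendsto_intros *)
    also have "(1 / K) * (\<Sum>b\<in>Basis. H x b \<bullet> b) = divergence \<phi> x"
      by (simp add: divergence_def fr sum_divide_distrib)
    finally show "c \<le> divergence \<phi> x"
    proof (rule tendsto_lowerbound)
      show "eventually (\<lambda>t. c \<le> (1 / K) * (\<Sum>b\<in>Basis. (F (x + t *\<^sub>R b) + F (x - t *\<^sub>R b) - 2 * F x) / t\<^sup>2)) (at_right 0)"
        using eventually_at_right_less[of 0] eventually_at_right_real[OF t0]
      proof eventually_elim
        case (elim t)
        have "(LINT z|lborel. kernel \<epsilon> z *
           (\<Sum>b\<in>Basis. g (x + z + t *\<^sub>R b) + g (x + z - t *\<^sub>R b) - 2 * g (x + z)))
           = (LINT z|lborel. (1 / K) * (\<Sum>b\<in>Basis. bump \<epsilon> z * g ((x + t *\<^sub>R b) + z) +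
               bump \<epsilon> z * g ((x - t *\<^sub>R b) + z) - 2 * (bump \<epsilon> z * g (x + z))))"
          by (rule Bochner_Integration.integral_cong)
            (auto simp: kernel_def K_def[symmetric] sum_distrib_left algebra_simps sum_divide_distrib
               intro!: sum.cong)
        also have "\<dots> = (1 / K) * (\<Sum>b\<in>Basis. F (x + t *\<^sub>R b) + F (x - t *\<^sub>R b) - 2 * F x)"
          unfolding F_eq
          by (subst integral_mult_right_zero, subst Bochner_Integration.integral_sum)
            (auto intro!: Bochner_Integration.integrable_add Bochner_Integration.integrable_diff
              integrable_mult_right int sum.cong simp: int)
        finally have "c * t\<^sup>2 \<le> (1 / K) * (\<Sum>b\<in>Basis. F (x + t *\<^sub>R b) + F (x - t *\<^sub>R b) - 2 * F x)"
          using le[rule_format, of t] elim by auto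
        then show ?case
          using elim K by (simp add: sum_divide_distrib[symmetric] pos_le_divide_eq mult.assoc mult.commute mult.left_commute)
      qed
    qed simp
  qed
qed


section \<open>Test fields from the distance to a convex set\<close>

lemma C1_divergence_continuous:
  "C1_compact_support \<phi> \<Longrightarrow> continuous_on UNIV (divergence \<phi>)"
  unfolding C1_compact_support_def divergence_def[abs_def] by (intro continuous_intros) auto

lemma set_lebesgue_integral_lborel:
  fixes f :: "'a::euclidean_space \<Rightarrow> real"
  assumes "continuous_on UNIV f" "F \<in> sets borel"
  shows "set_lebesgue_integral lebesgue F f = set_lebesgue_integral lborel F f"
  unfolding set_lebesgue_integral_def
  using assms borel_measurable_continuous_onI[of f] by (intro integral_completion) auto

lemma perimeter_ge:
  fixes \<phi> :: "'a::euclidean_space \<Rightarrow> 'a"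
  assumes "C1_compact_support \<phi>" "\<And>x. norm (\<phi> x) \<le> 1" "F \<in> sets borel"
  shows "ereal (LINT x:F|lborel. divergence \<phi> x) \<le> perimeter F"
  unfolding perimeter_def
  using assms set_lebesgue_integral_lborel[OF C1_divergence_continuous[OF assms(1)] assms(3)]
  by (intro SUP_upper2[of \<phi>]) auto

text \<open>Composed with the distance from G, this is the Moreau envelope of the indicator of G. Its mollified gradient is the
  vector field that bounds the perimeter from below.\<close>

definition huber :: "real \<Rightarrow> real \<Rightarrow> real" where
  "huber s d = (if d \<le> s then d\<^sup>2 / (2 * s) else d - s / 2)"

text \<open>Affine minorants with slope \<open>m\<close> in the unit interval; the slope
  \<open>min 1 (d / s)\<close> is the one that touches at \<open>d\<close>. This duality replaces
  case distinctions in all later estimates.\<close>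

lemma huber_ge:
  assumes "s > 0" "m \<le> 1" "m \<ge> 0"
  shows "huber s d \<ge> m * d - s * m\<^sup>2 / 2"
proof (cases "d \<le> s")
  case True
  have "0 \<le> (d - s * m)\<^sup>2" by simp
  then show ?thesis using True assms by (simp add: huber_def field_simps power2_eq_square)
next
  case False
  have "0 \<le> (1 - m) * (d - s)" using False assms by simp
  moreover have "s * (1 - m)\<^sup>2 \<ge> 0" using assms by simp
  ultimately show ?thesis using False by (simp add: huber_def field_simps power2_eq_square)
qed

lemma huber_eq:
  assumes "s > 0" "d \<ge> 0"
  shows "huber s d = min 1 (d / s) * d - s * (min 1 (d / s))\<^sup>2 / 2"
  using assms by (auto simp: huber_def min_def field_simps power2_eq_square)

lemma huber_bounds:
  assumes "s > 0" "d \<ge> 0"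
  shows "0 \<le> huber s d" "huber s d \<le> d"
proof -
  show "0 \<le> huber s d" using huber_ge[of s 0 d] assms by simp
  have "d * d \<le> d * (s * 2)" if "d \<le> s" using assms that by (intro mult_left_mono) auto
  then show "huber s d \<le> d" using assms by (auto simp: huber_def field_simps power2_eq_square)
qed

lemma huber_lip:
  assumes s: "s > 0" and "d \<ge> 0" "d' \<ge> 0"
  shows "\<bar>huber s d - huber s d'\<bar> \<le> \<bar>d - d'\<bar>"
proof -
  have *: "huber s d - huber s d' \<le> \<bar>d - d'\<bar>" if "d \<ge> 0" "d' \<ge> 0" for d d'
  proof -
    let ?m = "min 1 (d / s)"
    have m: "?m \<ge> 0" "?m \<le> 1" using s that by auto
    have "huber s d - huber s d' \<le> ?m * (d - d')"
      using huber_ge[OF s m(2,1), of d'] huber_eq[OF s that(1)] by (simp add: algebra_simps)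
    also have "\<dots> \<le> ?m * \<bar>d - d'\<bar>" using m by (intro mult_left_mono) auto
    also have "\<dots> \<le> 1 * \<bar>d - d'\<bar>" using m by (intro mult_right_mono) auto
    finally show ?thesis by simp
  qed
  show ?thesis using *[of d d'] *[of d' d] assms by (auto simp: abs_le_iff)
qed

text \<open>The half-space through the nearest point \<open>p\<close> with outer normal
  \<open>n\<close> contains \<open>G\<close>. The distance to it is affine outside, bounds the
  distance to \<open>G\<close> from below, and agrees with it at \<open>x\<close>.\<close>

lemma infdist_ge_normal:
  fixes G :: "'a::euclidean_space set"
  assumes G: "closed G" "convex G" "G \<noteq> {}" and x: "infdist x G > 0"
  obtains n where "norm n = 1" "\<And>y. infdist x G + n \<bullet> (y - x) \<le> infdist y G"
proof -
  obtain p where p: "p \<in> G" "infdist x G = dist x p"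
    using infdist_attains_inf[OF G(1,3)] by metis
  define n where "n = (x - p) /\<^sub>R norm (x - p)"
  have nz: "norm (x - p) > 0" using x p by (simp add: dist_norm)
  have n1: "norm n = 1" using nz by (simp add: n_def)
  have xp: "n \<bullet> (x - p) = infdist x G"
    using nz by (simp add: n_def p dist_norm dot_square_norm power2_eq_square)
  have sup: "n \<bullet> (q - p) \<le> 0" if "q \<in> G" for q
  proof -
    have "(x - p) \<bullet> (q - p) \<le> 0"
      using any_closest_point_dot[OF G(2,1) p(1) that, of x] p infdist_le[of _ G x] by auto
    then show ?thesis using nz by (simp add: n_def divide_simps mult_le_0_iff)
  qed
  have "infdist x G + n \<bullet> (y - x) \<le> infdist y G" for y
  proof -
    have "infdist x G + n \<bullet> (y - x) \<le> dist y q" if "q \<in> G" for q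
    proof -
      have "infdist x G + n \<bullet> (y - x) = n \<bullet> (y - q) + n \<bullet> (q - p)"
        unfolding xp[symmetric] by (simp add: inner_diff_right)
      also have "\<dots> \<le> n \<bullet> (y - q)" using sup[OF that] by simp
      also have "\<dots> \<le> dist y q" using norm_cauchy_schwarz[of n "y - q"] by (simp add: n1 dist_norm)
      finally show ?thesis .
    qed
    then show ?thesis unfolding infdist_notempty[OF G(3)] using G(3) by (intro cINF_greatest) auto
  qed
  with n1 show ?thesis using that by blast
qed

text \<open>Near x, compare with the half-space that supports G at the point nearest to x. Since the envelope enters only
  through second differences, its differentiability is not needed.\<close>

lemma huber_infdist_second_difference:
  fixes G :: "'a::euclidean_space set"
  assumes G: "closed G" "convex G" "G \<noteq> {}" and s: "s > 0" and t: "t > 0"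
  shows "(\<Sum>b\<in>Basis. huber s (infdist (x + t *\<^sub>R b) G) + huber s (infdist (x - t *\<^sub>R b) G)
            - 2 * huber s (infdist x G)) \<ge> t\<^sup>2 / s * indicator {y. t < infdist y G \<and> infdist y G < s - t} x"
proof (cases "infdist x G > 0")
  case False
  then have "infdist x G = 0" using infdist_nonneg[of x G] by linarith
  then show ?thesis
    using t s by (auto intro!: sum_nonneg add_nonneg_nonneg huber_bounds infdist_nonneg simp: huber_def)
next
  case True
  obtain n where n: "norm n = 1" "\<And>y. infdist x G + n \<bullet> (y - x) \<le> infdist y G"
    using infdist_ge_normal[OF G True] by blast
  let ?d = "infdist x G"
  have lin: "huber s (infdist y G) \<ge> m * (?d + n \<bullet> (y - x)) - s * m\<^sup>2 / 2" if "0 \<le> m" "m \<le> 1" for y m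
    using huber_ge[OF s that(2,1), of "infdist y G"] mult_left_mono[OF n(2)[of y] that(1)] by linarith
  show ?thesis
  proof (cases "t < ?d \<and> ?d < s - t")
    case False
    have "huber s (infdist (x + t *\<^sub>R b) G) + huber s (infdist (x - t *\<^sub>R b) G) - 2 * huber s ?d \<ge> 0" for b
    proof -
      \<comment> \<open>The slope that is optimal at \<open>x\<close>, used on both sides, makes the
        first-order terms cancel.\<close>
      let ?m = "min 1 (?d / s)"
      have m: "0 \<le> ?m" "?m \<le> 1" using s True by auto
      show ?thesis
        using lin[OF m, of "x + t *\<^sub>R b"] lin[OF m, of "x - t *\<^sub>R b"] huber_eq[OF s, of ?d] True
        by (simp add: algebra_simps)
    qed
    then show ?thesis using False by (auto intro!: sum_nonneg)
  next
    case d: True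
    have "huber s (infdist (x + t *\<^sub>R b) G) + huber s (infdist (x - t *\<^sub>R b) G) - 2 * huber s ?d
        \<ge> t\<^sup>2 / s * (n \<bullet> b)\<^sup>2" if "b \<in> Basis" for b
    proof -
      have nb: "\<bar>n \<bullet> b\<bar> \<le> 1" using Basis_le_norm[OF that, of n] n(1) by simp
      then have tn: "\<bar>t * (n \<bullet> b)\<bar> \<le> t" using t by (simp add: abs_mult)
      \<comment> \<open>In the annulus the slope may depend on the point; the margins
        \<open>t\<close> keep it between 0 and 1. The optimal slope yields a parabola whose second
        difference is \<open>t\<^sup>2 / s * (n \<bullet> b)\<^sup>2\<close>, and these sum to
        \<open>t\<^sup>2 / s\<close> because \<open>n\<close> is a unit vector.\<close>
      have *: "huber s (infdist (x + u *\<^sub>R b) G) \<ge> (?d + u * (n \<bullet> b))\<^sup>2 / (2 * s)" if "\<bar>u\<bar> = t" for u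
      proof -
        have un: "\<bar>u * (n \<bullet> b)\<bar> \<le> t" using nb that t by (simp add: abs_mult)
        let ?m = "(?d + u * (n \<bullet> b)) / s"
        have "0 \<le> ?m" "?m \<le> 1" using un d s by (auto simp: field_simps abs_le_iff)
        from lin[OF this, of "x + u *\<^sub>R b"] have "?m * (?d + u * (n \<bullet> b)) - s * ?m\<^sup>2 / 2 \<le> huber s (infdist (x + u *\<^sub>R b) G)"
          by simp
        moreover have "?m * w - s * ?m\<^sup>2 / 2 = w\<^sup>2 / (2 * s)" if "w = ?d + u * (n \<bullet> b)" for w
          unfolding that[symmetric] using s by (simp add: field_simps power2_eq_square)
        ultimately show ?thesis by simp
      qed
      have "(?d + t * (n \<bullet> b))\<^sup>2 / (2 * s) + (?d - t * (n \<bullet> b))\<^sup>2 / (2 * s) - 2 * huber s ?d = t\<^sup>2 / s * (n \<bullet> b)\<^sup>2"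
        using d s t by (simp add: huber_def field_simps power2_eq_square)
      with *[of t] *[of "- t"] t show ?thesis by simp
    qed
    from sum_mono[OF this] have "(\<Sum>b\<in>Basis. t\<^sup>2 / s * (n \<bullet> b)\<^sup>2) \<le> (\<Sum>b\<in>Basis. huber s (infdist (x + t *\<^sub>R b) G) +
        huber s (infdist (x - t *\<^sub>R b) G) - 2 * huber s ?d)" by simp
    also have "(\<Sum>b\<in>Basis. t\<^sup>2 / s * (n \<bullet> b)\<^sup>2) = t\<^sup>2 / s * (n \<bullet> n)"
      by (subst euclidean_inner) (simp add: sum_distrib_left power2_eq_square)
    finally show ?thesis using d n(1) by (simp add: dot_square_norm)
  qed
qed

text \<open>On \<open>F\<close> the divergence of the field is at least \<open>1 / s\<close> times
  the mollified indicator of the annulus \<open>D\<close>. After exchanging the integrations the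
  kernel integrates to 1 and \<open>measure lborel D / s\<close> remains. The margin
  \<open>t0\<close> keeps second differences of step \<open>t < t0\<close> inside the region where
  the envelope is quadratic.\<close>

lemma perimeter_ge_parallel_volume_aux:
  fixes G F :: "'a::euclidean_space set"
  assumes G: "closed G" "convex G" "G \<noteq> {}" and F: "compact F"
    and s: "s > 0" and \<epsilon>: "\<epsilon> > 0" and t0: "t0 > 0" "t0 < 1"
    and sub: "\<And>x. infdist x G < s + \<epsilon> \<Longrightarrow> x \<in> F"
  shows "ereal (measure lborel {y. t0 < infdist y G \<and> infdist y G < s - t0} / s) \<le> perimeter F"
proof -
  define D where "D = {y. t0 < infdist y G \<and> infdist y G < s - t0}"
  obtain p0 where p0: "p0 \<in> G" using G by blast
  obtain M where M: "\<And>x. x \<in> F \<Longrightarrow> norm x \<le> M" "M \<ge> 0"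
    using compact_imp_bounded[OF F] by (metis bounded_pos less_imp_le)
  define R where "R = 2 * (M + \<epsilon> + 1) + norm p0"
  \<comment> \<open>The cut-off by \<open>R - norm x\<close> gives compact support without raising
    the Lipschitz constant. It is inactive within radius \<open>M + \<epsilon> + 1\<close>, which
    contains every point that enters the second differences at \<open>x \<in> F\<close>.\<close>
  define g where "g x = max 0 (min (huber s (infdist x G)) (R - norm x))" for x
  have contd: "continuous_on S (\<lambda>x. infdist x G)" for S by (intro continuous_intros)
  have Dopen: "open D"
  proof -
    have "D = (\<lambda>x. infdist x G) -` {t0<..<s - t0}" by (auto simp: D_def)
    then show ?thesis using contd[of UNIV] by (simp add: open_vimage)
  qed
  have DF: "D \<subseteq> F" 
  proof
    fix x assume "x \<in> D"
    then have "infdist x G < s + \<epsilon>" using t0 \<epsilon> by (simp add: D_def)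
    then show "x \<in> F" by (rule sub)
  qed
  have Dfin: "emeasure lborel D < \<infinity>"
    using emeasure_mono[OF DF, of lborel] emeasure_bounded_finite[OF compact_imp_bounded[OF F]] F
    by (auto simp: borel_compact)
  have hl: "\<bar>huber s (infdist x G) - huber s (infdist y G)\<bar> \<le> norm (x - y)" for x y
    using huber_lip[OF s infdist_nonneg infdist_nonneg, of x G y G] infdist_triangle_abs[of x G y]
    by (simp add: dist_norm)
  have lip: "\<bar>g x - g y\<bar> \<le> norm (x - y)" for x y
  proof -
    have "\<bar>(R - norm x) - (R - norm y)\<bar> \<le> norm (x - y)"
      using norm_triangle_ineq3[of x y] by simp
    moreover have "\<bar>max 0 (min a b) - max 0 (min a' b')\<bar> \<le> c"
      if "\<bar>a - a'\<bar> \<le> c" "\<bar>b - b'\<bar> \<le> c" for a b a' b' c :: real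
      using that by (auto simp: max_def min_def)
    ultimately show ?thesis unfolding g_def using hl[of x y] by blast
  qed
  have supp: "g y = 0" if "norm y > R" for y
    using that by (simp add: g_def max_def min_def)
  have geq: "g x = huber s (infdist x G)" if "norm x \<le> M + \<epsilon> + 1" for x
  proof -
    have "huber s (infdist x G) \<le> infdist x G" by (intro huber_bounds s infdist_nonneg)
    also have "\<dots> \<le> norm x + norm p0"
      using infdist_le[OF p0, of x] norm_triangle_ineq4[of x p0] by (simp add: dist_norm)
    finally have "huber s (infdist x G) \<le> R - norm x" using that by (simp add: R_def)
    moreover have "0 \<le> huber s (infdist x G)" by (intro huber_bounds s infdist_nonneg)
    ultimately show ?thesis by (simp add: g_def)
  qed
  obtain \<phi> :: "'a \<Rightarrow> 'a" where \<phi>: "C1_compact_support \<phi>" "\<And>x. norm (\<phi> x) \<le> 1"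
    and div: "\<forall>x c t0. 0 < t0 \<longrightarrow> (\<forall>t. 0 < t \<longrightarrow> t < t0 \<longrightarrow>
        c * t\<^sup>2 \<le> (LINT z|lborel. kernel \<epsilon> z *
           (\<Sum>b\<in>Basis. g (x + z + t *\<^sub>R b) + g (x + z - t *\<^sub>R b) - 2 * g (x + z)))) \<longrightarrow> c \<le> divergence \<phi> x"
    using mollify_field[OF lip supp \<epsilon>] by blast
  have contg: "continuous_on UNIV g"
    by (rule continuous_on_nonexpansive[OF lip])
  note contg2 [continuous_intros] = continuous_on_compose2[OF contg, OF _ subset_UNIV]
  have kz: "kernel \<epsilon> z = 0" if "norm z \<ge> \<epsilon>" for z :: 'a
    using kernel(2)[OF \<epsilon> that] .
  have [measurable]: "(kernel \<epsilon> :: 'a \<Rightarrow> real) \<in> borel_measurable borel"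
    using kernel(5)[OF \<epsilon>] by (rule borel_measurable_continuous_onI)
  have [measurable]: "D \<in> sets borel" using Dopen by (rule borel_open)
  have intD: "integrable lborel (\<lambda>z. kernel \<epsilon> z * indicator D (x + z))" for x :: 'a
  proof (rule Bochner_Integration.integrable_bound[OF kernel(3)[OF \<epsilon>]])
    show "(\<lambda>z. kernel \<epsilon> z * indicator D (x + z)) \<in> borel_measurable lborel"
      by measurable
    have "norm (kernel \<epsilon> z * indicator D (x + z)) \<le> norm (kernel \<epsilon> z)" for z
      by (simp add: indicator_def)
    then show "AE z in lborel. norm (kernel \<epsilon> z * indicator D (x + z)) \<le> norm (kernel \<epsilon> z)"
      by simp
  qed
  have Fb [measurable]: "F \<in> sets borel" using F by (rule borel_compact)
  have knn: "kernel \<epsilon> z * indicator D w \<ge> 0" for z w :: 'a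
    using kernel(1)[OF \<epsilon>, of z] by simp
  define u where "u x = (LINT z|lborel. kernel \<epsilon> z * indicator D (x + z))" for x :: 'a
  have u_nn: "ennreal (u x) = (\<integral>\<^sup>+z. ennreal (kernel \<epsilon> z * indicator D (x + z)) \<partial>lborel)" for x
    unfolding u_def by (intro nn_integral_eq_integral[symmetric] intD AE_I2 knn)
  have u0: "u x \<ge> 0" for x
    unfolding u_def by (intro integral_nonneg_AE AE_I2 knn)
  have div_ge: "u x / s \<le> divergence \<phi> x" if x: "x \<in> F" for x
  proof (rule div[rule_format, OF t0(1)])
    fix t :: real assume t: "0 < t" "t < t0"
    let ?S = "\<lambda>z. \<Sum>b\<in>Basis. g (x + z + t *\<^sub>R b) + g (x + z - t *\<^sub>R b) - 2 * g (x + z)"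
    have "u x / s * t\<^sup>2 = (LINT z|lborel. (t\<^sup>2 / s) * (kernel \<epsilon> z * indicator D (x + z)))"
      by (simp add: u_def)
    also have "\<dots> \<le> (LINT z|lborel. kernel \<epsilon> z * ?S z)"
    proof (rule integral_mono)
      show "integrable lborel (\<lambda>z. (t\<^sup>2 / s) * (kernel \<epsilon> z * indicator D (x + z)))"
        by (intro integrable_mult_right intD)
      have eq: "kernel \<epsilon> z * ?S z = indicator (cball 0 \<epsilon>) z *\<^sub>R (kernel \<epsilon> z * ?S z)" for z
        using kz[of z] by (auto simp: indicator_def)
      show "integrable lborel (\<lambda>z. kernel \<epsilon> z * ?S z)"
        by (subst eq[abs_def])
          (intro borel_integrable_compact compact_cball continuous_intros
             continuous_on_subset[OF kernel(5)[OF \<epsilon>]] subset_UNIV)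
      fix z :: 'a
      show "(t\<^sup>2 / s) * (kernel \<epsilon> z * indicator D (x + z)) \<le> kernel \<epsilon> z * ?S z"
      proof (cases "norm z < \<epsilon>")
        case True
        have b1: "norm (x + z) \<le> M + \<epsilon>"
          using M(1)[OF x] True norm_triangle_ineq[of x z] by linarith
        have "g (x + z) = huber s (infdist (x + z) G)" using b1 by (intro geq) simp
        moreover have "g (x + z + t *\<^sub>R b) = huber s (infdist (x + z + t *\<^sub>R b) G)"
          "g (x + z - t *\<^sub>R b) = huber s (infdist (x + z - t *\<^sub>R b) G)" if "b \<in> Basis" for b
          using b1 norm_triangle_ineq[of "x + z" "t *\<^sub>R b"] norm_triangle_ineq4[of "x + z" "t *\<^sub>R b"]
            t t0 that by (auto intro!: geq)
        ultimately have S: "?S z = (\<Sum>b\<in>Basis. huber s (infdist (x + z + t *\<^sub>R b) G)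
            + huber s (infdist (x + z - t *\<^sub>R b) G) - 2 * huber s (infdist (x + z) G))"
          by (intro sum.cong) auto
        have "t\<^sup>2 / s * indicator D (x + z) \<le> t\<^sup>2 / s * indicator {y. t < infdist y G \<and> infdist y G < s - t} (x + z)"
          using t s by (intro mult_left_mono) (auto simp: D_def indicator_def)
        also have "\<dots> \<le> ?S z"
          unfolding S by (rule huber_infdist_second_difference[OF G s t(1)])
        finally have "kernel \<epsilon> z * (t\<^sup>2 / s * indicator D (x + z)) \<le> kernel \<epsilon> z * ?S z"
          using kernel(1)[OF \<epsilon>] by (intro mult_left_mono) auto
        then show ?thesis by (simp add: mult_ac)
      qed (simp add: kz)
    qed
    finally show "u x / s * t\<^sup>2 \<le> (LINT z|lborel. kernel \<epsilon> z * ?S z)" .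
  qed
  have meas2: "(\<lambda>(x, z). ennreal (kernel \<epsilon> z * indicator D (x + z))) \<in> borel_measurable (lborel \<Otimes>\<^sub>M (lborel :: 'a measure))"
    by measurable
  have u_meas: "u \<in> borel_measurable lborel"
  proof -
    have "(\<lambda>x. ennreal (u x)) \<in> borel_measurable lborel"
      unfolding u_nn using lborel.borel_measurable_nn_integral[OF meas2] by simp
    then have "(\<lambda>x. enn2real (ennreal (u x))) \<in> borel_measurable lborel" by measurable
    then show ?thesis using u0 by simp
  qed
  have "(\<integral>\<^sup>+x. ennreal (indicator F x * u x) \<partial>lborel)
      = (\<integral>\<^sup>+x. \<integral>\<^sup>+z. ennreal (indicator F x) * ennreal (kernel \<epsilon> z * indicator D (x + z)) \<partial>lborel \<partial>lborel)"
  proof (intro nn_integral_cong)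
    fix x :: 'a
    have "ennreal (indicator F x * u x) = ennreal (indicator F x) * ennreal (u x)"
      by (simp add: ennreal_mult')
    also have "\<dots> = (\<integral>\<^sup>+z. ennreal (indicator F x) * ennreal (kernel \<epsilon> z * indicator D (x + z)) \<partial>lborel)"
      unfolding u_nn by (rule nn_integral_cmult[symmetric]) measurable
    finally show "ennreal (indicator F x * u x)
       = (\<integral>\<^sup>+z. ennreal (indicator F x) * ennreal (kernel \<epsilon> z * indicator D (x + z)) \<partial>lborel)" .
  qed
  also have "\<dots> = (\<integral>\<^sup>+z. \<integral>\<^sup>+x. ennreal (indicator F x) * ennreal (kernel \<epsilon> z * indicator D (x + z)) \<partial>lborel \<partial>lborel)"
    by (intro lborel_pair.Fubini') measurable
  also have "\<dots> = (\<integral>\<^sup>+z. ennreal (kernel \<epsilon> (z::'a)) * emeasure lborel D \<partial>lborel)"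
  proof (intro nn_integral_cong)
    fix z :: 'a
    show "(\<integral>\<^sup>+x. ennreal (indicator F x) * ennreal (kernel \<epsilon> z * indicator D (x + z)) \<partial>lborel)
       = ennreal (kernel \<epsilon> z) * emeasure lborel D"
    proof (cases "norm z < \<epsilon>")
      case True
      \<comment> \<open>Here the margin \<open>\<epsilon>\<close> enters: \<open>D\<close> shifted
        by less than \<open>\<epsilon>\<close> stays inside \<open>F\<close>, so no mass is lost by
        integrating over \<open>F\<close> only.\<close>
      have F_in: "x \<in> F" if "x + z \<in> D" for x
        using that True t0 infdist_triangle[of x G "x + z"] by (intro sub) (simp add: D_def dist_norm)
      have "(\<integral>\<^sup>+x. ennreal (indicator F x) * ennreal (kernel \<epsilon> z * indicator D (x + z)) \<partial>lborel)
         = (\<integral>\<^sup>+x. ennreal (kernel \<epsilon> z) * indicator D (z + x) \<partial>lborel)"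
        using F_in by (intro nn_integral_cong) (simp add: indicator_def add.commute)
      also have "\<dots> = (\<integral>\<^sup>+x. ennreal (kernel \<epsilon> z) * indicator D x \<partial>distr lborel borel ((+) z))"
        by (subst nn_integral_distr) simp_all
      also have "\<dots> = ennreal (kernel \<epsilon> z) * emeasure lborel D"
        by (simp add: lborel_distr_plus nn_integral_cmult_indicator)
      finally show ?thesis .
    qed (simp add: kz)
  qed
  also have "\<dots> = (\<integral>\<^sup>+z. ennreal (kernel \<epsilon> (z::'a)) \<partial>lborel) * emeasure lborel D"
    by (intro nn_integral_multc) measurable
  also have "(\<integral>\<^sup>+z. ennreal (kernel \<epsilon> (z::'a)) \<partial>lborel) = 1"
    using kernel(3,4)[OF \<epsilon>, where 'a='a]
    by (subst nn_integral_eq_integral) (simp_all add: kernel(1)[OF \<epsilon>])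
  finally have nn: "(\<integral>\<^sup>+x. ennreal (indicator F x * u x) \<partial>lborel) = emeasure lborel D" by simp
  have Iu: "(LINT x:F|lborel. u x) = measure lborel D"
    unfolding set_lebesgue_integral_def measure_def nn[symmetric]
    using u_meas by (subst integral_eq_nn_integral) (simp_all add: u0)
  have intu: "set_integrable lborel F u"
    unfolding set_integrable_def
    using u_meas nn Dfin by (intro integrableI_nonneg) (simp_all add: u0)
  have intdiv: "set_integrable lborel F (divergence \<phi>)"
    unfolding set_integrable_def
    by (intro borel_integrable_compact F continuous_on_subset[OF C1_divergence_continuous[OF \<phi>(1)]] subset_UNIV)
  have "measure lborel D / s = (LINT x:F|lborel. u x / s)"
    using Iu by simp
  also have "\<dots> \<le> (LINT x:F|lborel. divergence \<phi> x)"
    using intu intdiv by (intro set_integral_mono div_ge) simp_all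
  finally have "ereal (measure lborel D / s) \<le> ereal (LINT x:F|lborel. divergence \<phi> x)" by simp
  also have "\<dots> \<le> perimeter F" by (rule perimeter_ge[OF \<phi>(1,2) Fb])
  finally show ?thesis by (simp add: D_def)
qed


lemma perimeter_ge_parallel_volume:
  fixes G F :: "'a::euclidean_space set"
  assumes G: "compact G" "convex G" "G \<noteq> {}" and F: "compact F"
    and s: "s > 0" and \<epsilon>: "\<epsilon> > 0"
    and sub: "\<And>x. infdist x G < s + \<epsilon> \<Longrightarrow> x \<in> F"
  shows "ereal ((measure lborel {y. infdist y G < s} - measure lborel G) / s) \<le> perimeter F"
proof -
  define D where "D n = {y. 1 / (real n + 2) < infdist y G \<and> infdist y G < s - 1 / (real n + 2)}" for n
  have op: "open {y. infdist y G < s}"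
    by (intro open_Collect_less continuous_intros)
  have subF: "{y. infdist y G < s} \<subseteq> F" using sub \<epsilon> by force
  have fin: "emeasure lborel S < \<infinity>" if "S \<subseteq> F" "S \<in> sets borel" for S
    using emeasure_bounded_finite[OF bounded_subset[OF compact_imp_bounded[OF F] that(1)]] by simp
  have Gs: "G \<subseteq> {y. infdist y G < s}" using s by auto
  have Dop: "open (D n)" for n
    unfolding D_def by (intro open_Collect_conj open_Collect_less continuous_intros)
  have UD: "(\<Union>n. D n) = {y. infdist y G < s} - G"
  proof (intro equalityI subsetI)
    fix y assume "y \<in> {y. infdist y G < s} - G"
    then have y: "infdist y G < s" "infdist y G > 0"
      using in_closed_iff_infdist_zero[OF compact_imp_closed[OF G(1)] G(3)] infdist_nonneg[of y G] by auto
    have "eventually (\<lambda>n. 1 / (real n + 2) < min (infdist y G) (s - infdist y G)) sequentially"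
      using y by real_asymp
    then obtain n where "1 / (real n + 2) < min (infdist y G) (s - infdist y G)"
      by (auto simp: eventually_sequentially)
    then show "y \<in> (\<Union>n. D n)" by (auto simp: D_def intro!: exI[of _ n])
  next
    fix y assume "y \<in> (\<Union>n. D n)"
    then obtain n where n: "1 / (real n + 2) < infdist y G" "infdist y G < s - 1 / (real n + 2)"
      by (auto simp: D_def)
    have "1 / (real n + 2) > 0" by simp
    with n have "infdist y G < s" "infdist y G > 0" by linarith+
    then show "y \<in> {y. infdist y G < s} - G" by auto
  qed
  have inc: "incseq D"
  proof (rule incseq_SucI)
    fix n
    have "1 / (real (Suc n) + 2) \<le> 1 / (real n + 2)" by (simp add: field_simps)
    then show "D n \<le> D (Suc n)" unfolding D_def by force
  qed
  have "(\<lambda>n. measure lborel (D n)) \<longlonglongrightarrow> measure lborel (\<Union>n. D n)"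
  proof (rule Lim_measure_incseq[OF _ inc])
    show "range D \<subseteq> sets lborel" using Dop by auto
    have "emeasure lborel (\<Union>n. D n) < \<infinity>"
      unfolding UD by (rule fin) (use subF op borel_compact[OF G(1)] in auto)
    then show "emeasure lborel (\<Union>n. D n) \<noteq> \<infinity>" by simp
  qed
  then have "(\<lambda>n. ereal (measure lborel (D n) / s)) \<longlonglongrightarrow> ereal (measure lborel (\<Union>n. D n) / s)"
    by (intro tendsto_intros) (use s in auto)
  moreover have "ereal (measure lborel (D n) / s) \<le> perimeter F" for n
    unfolding D_def
    by (rule perimeter_ge_parallel_volume_aux[OF compact_imp_closed[OF G(1)] G(2,3) F s \<epsilon> _ _ sub])
      (auto simp: field_simps)
  ultimately have "ereal (measure lborel (\<Union>n. D n) / s) \<le> perimeter F"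
    by (intro Lim_bounded[where M = 0 and f = "\<lambda>n. ereal (measure lborel (D n) / s)"]) blast+
  also have "measure lborel (\<Union>n. D n) = measure lborel {y. infdist y G < s} - measure lborel G"
    unfolding UD using fin[of "{y. infdist y G < s}"] subF op G Gs
    by (intro measure_Diff) (auto simp: borel_compact)
  finally show ?thesis .
qed

section \<open>From a contracted copy to the Minkowski content\<close>

lemma parallel_set_subset_contraction:
  fixes F :: "'a::euclidean_space set"
  assumes F: "compact F" "convex F" and r: "cball x0 r \<subseteq> F" "r > 0" and \<tau>: "0 < \<tau>" "\<tau> < 1"
    and x: "infdist x ((\<lambda>q. \<tau> *\<^sub>R x0 + (1 - \<tau>) *\<^sub>R q) ` F) \<le> \<tau> * r"
  shows "x \<in> F"
proof -
  let ?G = "(\<lambda>q. \<tau> *\<^sub>R x0 + (1 - \<tau>) *\<^sub>R q) ` F"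
  have "F \<noteq> {}" using r by auto
  moreover have "compact ?G" by (intro compact_continuous_image continuous_intros F)
  ultimately obtain p where p: "p \<in> ?G" "infdist x ?G = dist x p"
    using infdist_attains_inf[of ?G x] compact_imp_closed by auto
  then obtain q where q: "q \<in> F" "p = \<tau> *\<^sub>R x0 + (1 - \<tau>) *\<^sub>R q" by auto
  \<comment> \<open>The displacement \<open>x - p\<close>, enlarged by \<open>1 / \<tau>\<close>,
    still fits into the inner ball, and \<open>x\<close> becomes a convex combination of
    \<open>w\<close> and \<open>q\<close>. Contraction thus frees a margin
    \<open>\<tau> * r\<close>.\<close>
  define w where "w = x0 + (1 / \<tau>) *\<^sub>R (x - p)"
  have "w \<in> F"
  proof (rule subsetD[OF r(1)])
    have "dist x0 w = norm (x - p) / \<tau>" using \<tau> by (simp add: w_def dist_norm)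
    also have "\<dots> \<le> r" using x p(2) \<tau> by (simp add: dist_norm pos_divide_le_eq mult.commute)
    finally show "w \<in> cball x0 r" by simp
  qed
  moreover have "x = \<tau> *\<^sub>R w + (1 - \<tau>) *\<^sub>R q"
    using \<tau> by (simp add: w_def q algebra_simps)
  ultimately show ?thesis
    using convexD[OF F(2), of w q \<tau> "1 - \<tau>"] q(1) \<tau> by auto
qed

lemma measure_affine_image:
  fixes S :: "'a::euclidean_space set"
  assumes "c > 0" "S \<in> sets lebesgue"
  shows "measure lebesgue ((\<lambda>q. v + c *\<^sub>R q) ` S) = c ^ DIM('a) * measure lebesgue S"
  using measure_lebesgue_affine[of c v S] assms by (simp add: add.commute)

text \<open>The outer parallel set of \<open>F\<close> leaves \<open>F\<close>, so the field is
  built for the contraction \<open>G\<close> of ratio \<open>1 - \<tau>\<close>. Half of the freed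
  margin \<open>\<tau> * r\<close> is the parallel distance \<open>s\<close>, the other half is left
  for mollifying. The contraction maps the parallel set of \<open>F\<close> into that of
  \<open>G\<close>, so the volume growth of \<open>F\<close> reappears with the factor
  \<open>(1 - \<tau>) ^ n\<close>, which tends to 1.\<close>

lemma perimeter_ge_content:
  fixes F :: "'a::euclidean_space set"
  assumes F: "compact F" "convex F" and r: "cball x0 r \<subseteq> F" "r > 0"
    and I: "\<And>e. e > 0 \<Longrightarrow> measure lborel F + e * I \<le> measure lborel {x. infdist x F \<le> e}"
  shows "ereal I \<le> perimeter F"
proof (rule ccontr)
  assume neg: "\<not> ereal I \<le> perimeter F"
  have Fne: "F \<noteq> {}" using r by auto
  define n where "n = DIM('a)"
  have key: "ereal ((1 - \<tau>) ^ n * I) \<le> perimeter F" if \<tau>: "0 < \<tau>" "\<tau> < 1" for \<tau>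
  proof -
    define h where "h q = \<tau> *\<^sub>R x0 + (1 - \<tau>) *\<^sub>R q" for q
    define G where "G = h ` F"
    define s where "s = \<tau> * r / 2"
    define e where "e = s"
    have s: "s > 0" using \<tau> r by (simp add: s_def)
    have cG: "compact G" unfolding G_def h_def by (intro compact_continuous_image continuous_intros F)
    have vG: "convex G"
    proof -
      have "G = (+) (\<tau> *\<^sub>R x0) ` ((*\<^sub>R) (1 - \<tau>) ` F)" by (auto simp: G_def h_def image_image)
      then show ?thesis using F by (simp add: convex_translation convex_scaling)
    qed
    have main: "ereal ((measure lborel {y. infdist y G < s} - measure lborel G) / s) \<le> perimeter F"
    proof (rule perimeter_ge_parallel_volume[OF cG vG _ F(1) s])
      show "G \<noteq> {}" using Fne by (simp add: G_def)
      show "\<tau> * r / 2 > 0" using \<tau> r by simp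
      show "x \<in> F" if "infdist x G < s + \<tau> * r / 2" for x
        using parallel_set_subset_contraction[OF F r \<tau>, of x] that by (simp add: G_def h_def s_def)
    qed
    define U where "U = {x. infdist x F \<le> s}"
    have Ucl: "closed U" unfolding U_def by (intro closed_Collect_le continuous_intros)
    have hU: "h ` U \<subseteq> {y. infdist y G < s}"
    proof safe
      fix x assume "x \<in> U"
      then have d: "infdist x F \<le> s" by (simp add: U_def)
      obtain q where "q \<in> F" "infdist x F = dist x q"
        using infdist_attains_inf[OF compact_imp_closed[OF F(1)] Fne] by metis
      with d have q: "q \<in> F" "dist x q \<le> s" by simp_all
      have "infdist (h x) G \<le> dist (h x) (h q)" using q by (intro infdist_le) (auto simp: G_def)
      also have "\<dots> = (1 - \<tau>) * dist x q"
        using \<tau> by (simp add: h_def dist_norm scaleR_diff_right[symmetric])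
      also have "\<dots> \<le> (1 - \<tau>) * s" using q \<tau> by (intro mult_left_mono) auto
      also have "\<dots> < s" using \<tau> s by (simp add: field_simps)
      finally show "infdist (h x) G < s" .
    qed
    have op: "open {y. infdist y G < s}"
      by (intro open_Collect_less continuous_intros)
    have sb: "{y. infdist y G < s} \<subseteq> F"
      using parallel_set_subset_contraction[OF F r \<tau>] s by (auto simp: G_def h_def s_def)
    have mh: "measure lebesgue (h ` S) = (1 - \<tau>) ^ n * measure lebesgue S" if "S \<in> sets lebesgue" for S
      unfolding h_def n_def using \<tau> that by (intro measure_affine_image) auto
    have "measure lebesgue (h ` U) \<le> measure lebesgue {y. infdist y G < s}"
    proof (rule measure_mono_fmeasurable[OF hU])
      have "closed (h ` U)"
      proof -
        have "h ` U = (+) (\<tau> *\<^sub>R x0) ` ((*\<^sub>R) (1 - \<tau>) ` U)" by (auto simp: h_def image_image)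
        then show ?thesis using Ucl by (simp add: closed_translation closed_scaling)
      qed
      then show "h ` U \<in> sets lebesgue" by auto
      show "{y. infdist y G < s} \<in> lmeasurable"
        using bounded_subset[OF compact_imp_bounded[OF F(1)] sb] op by (intro bounded_set_imp_lmeasurable) auto
    qed
    moreover have "measure lebesgue (h ` U) = (1 - \<tau>) ^ n * measure lborel U"
      using mh[of U] Ucl by simp
    moreover have "(1 - \<tau>) ^ n * (measure lborel F + s * I) \<le> (1 - \<tau>) ^ n * measure lborel U"
      using I[OF s] \<tau> by (intro mult_left_mono) (simp_all add: U_def)
    ultimately have "(1 - \<tau>) ^ n * (measure lborel F + s * I) \<le> measure lebesgue {y. infdist y G < s}"
      by linarith
    moreover have "measure lebesgue G = (1 - \<tau>) ^ n * measure lebesgue F"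
      unfolding G_def using F by (intro mh) (auto simp: borel_compact)
    ultimately have "(1 - \<tau>) ^ n * I \<le> (measure lborel {y. infdist y G < s} - measure lborel G) / s"
      using s op cG F by (simp add: field_simps borel_compact)
    with main show ?thesis by (meson ereal_less_eq(3) order_trans)
  qed
  have "((\<lambda>\<tau>. (1 - \<tau>) ^ n * I) \<longlongrightarrow> (1 - 0) ^ n * I) (at_right 0)"
    by (intro tendsto_intros)
  then have "((\<lambda>\<tau>. ereal ((1 - \<tau>) ^ n * I)) \<longlongrightarrow> ereal I) (at_right 0)"
    by simp
  moreover have "eventually (\<lambda>\<tau>. ereal ((1 - \<tau>) ^ n * I) \<le> perimeter F) (at_right 0)"
    using eventually_at_right_real[of 0 1] by (rule eventually_mono) (use key in auto)
  ultimately have "ereal I \<le> perimeter F" by (rule tendsto_upperbound) simp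
  with neg show False ..
qed

section \<open>Sections of convex bodies and transport\<close>

definition slice :: "(real \<times> 'b) set \<Rightarrow> real \<Rightarrow> 'b set" where
  "slice K t = {y. (t, y) \<in> K}"

definition slice_area :: "(real \<times> 'b::euclidean_space) set \<Rightarrow> real \<Rightarrow> real" where
  "slice_area K t = measure lborel (slice K t)"

lemma slice_compact: "compact (slice K t)" if "compact K" for K :: "(real \<times> 'b::euclidean_space) set"
proof -
  have "slice K t = snd ` (K \<inter> ({t} \<times> UNIV))" by (force simp: slice_def)
  moreover have "compact (K \<inter> ({t} \<times> UNIV))"
    using that by (intro compact_Int_closed closed_Times) auto
  ultimately show ?thesis by (simp add: compact_continuous_image continuous_on_snd continuous_on_id)
qed

text \<open>By convexity \<open>K\<close> contains the cone with the section at \<open>t0\<close> as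
  base and \<open>(t1, y1)\<close> as apex; its intermediate sections are scaled copies of the
  base.\<close>

lemma slice_cone:
  fixes K :: "(real \<times> 'b::euclidean_space) set"
  assumes K: "compact K" "convex K" and ap: "(t1, y1) \<in> K" and \<theta>: "0 \<le> \<theta>" "\<theta> \<le> 1"
  shows "(1 - \<theta>) ^ DIM('b) * slice_area K t0 \<le> slice_area K ((1 - \<theta>) * t0 + \<theta> * t1)"
proof (cases "\<theta> = 1")
  case False
  then have \<theta>1: "1 - \<theta> > 0" using \<theta> by simp
  have sub: "(\<lambda>q. \<theta> *\<^sub>R y1 + (1 - \<theta>) *\<^sub>R q) ` slice K t0 \<subseteq> slice K ((1 - \<theta>) * t0 + \<theta> * t1)"
  proof safe
    fix q assume "q \<in> slice K t0"
    then have "\<theta> *\<^sub>R (t1, y1) + (1 - \<theta>) *\<^sub>R (t0, q) \<in> K"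
      using convexD[OF K(2) ap, of "(t0, q)" \<theta> "1 - \<theta>"] \<theta> by (simp add: slice_def)
    then show "\<theta> *\<^sub>R y1 + (1 - \<theta>) *\<^sub>R q \<in> slice K ((1 - \<theta>) * t0 + \<theta> * t1)"
      by (simp add: slice_def add.commute)
  qed
  have c: "compact (slice K t)" for t by (rule slice_compact[OF K(1)])
  have ci: "compact ((\<lambda>q. \<theta> *\<^sub>R y1 + (1 - \<theta>) *\<^sub>R q) ` slice K t0)"
    by (intro compact_continuous_image continuous_intros c)
  have "(1 - \<theta>) ^ DIM('b) * measure lebesgue (slice K t0)
      = measure lebesgue ((\<lambda>q. \<theta> *\<^sub>R y1 + (1 - \<theta>) *\<^sub>R q) ` slice K t0)"
    using c by (intro measure_affine_image[symmetric] \<theta>1) (auto simp: borel_compact)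
  also have "\<dots> \<le> measure lebesgue (slice K ((1 - \<theta>) * t0 + \<theta> * t1))"
    using ci c by (intro measure_mono_fmeasurable[OF sub] lmeasurable_compact) (auto simp: borel_compact)
  finally show ?thesis using c by (simp add: slice_area_def borel_compact)
next
  case True
  then show ?thesis by (simp add: slice_area_def zero_power)
qed

lemma slice_area_nonneg: "slice_area K t \<ge> 0"
  by (simp add: slice_area_def)

lemma emeasure_slice:
  fixes K :: "(real \<times> 'b::euclidean_space) set"
  assumes "compact K"
  shows "emeasure lborel (slice K t) = ennreal (slice_area K t)"
  unfolding slice_area_def
  using emeasure_bounded_finite[OF compact_imp_bounded[OF slice_compact[OF assms, of t]]]
  by (intro emeasure_eq_ennreal_measure) auto

lemma slice_area_measurable [measurable]:
  fixes K :: "(real \<times> 'b::euclidean_space) set"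
  assumes "compact K"
  shows "slice_area K \<in> borel_measurable borel"
proof -
  have "K \<in> sets (lborel \<Otimes>\<^sub>M (lborel :: 'b measure))"
    unfolding lborel_prod using assms by (simp add: borel_compact)
  then have "(\<lambda>t. emeasure lborel (Pair t -` K)) \<in> borel_measurable lborel"
    by (rule lborel.measurable_emeasure_Pair)
  moreover have "Pair t -` K = slice K t" for t by (auto simp: slice_def)
  ultimately have "(\<lambda>t. enn2real (ennreal (slice_area K t))) \<in> borel_measurable borel"
    by (simp add: emeasure_slice[OF assms])
  then show ?thesis by (simp add: slice_area_nonneg)
qed

lemma emeasure_eq_slices:
  fixes K :: "(real \<times> 'b::euclidean_space) set"
  assumes "compact K"
  shows "emeasure lborel K = (\<integral>\<^sup>+t. ennreal (slice_area K t) \<partial>lborel)"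
proof -
  have "K \<in> sets (lborel \<Otimes>\<^sub>M (lborel :: 'b measure))"
    unfolding lborel_prod using assms by (simp add: borel_compact)
  from lborel.emeasure_pair_measure_alt[OF this]
  have "emeasure lborel K = (\<integral>\<^sup>+t. emeasure lborel (Pair t -` K) \<partial>lborel)"
    by (simp add: lborel_prod)
  moreover have "Pair t -` K = slice K t" for t by (auto simp: slice_def)
  ultimately show ?thesis by (simp add: emeasure_slice[OF assms])
qed

text \<open>The two cone inequalities replace the concavity of a power of the section function.\<close>

lemma slice_area_props:
  fixes K :: "(real \<times> 'b::euclidean_space) set"
  assumes K: "compact K" "convex K" and pos: "measure lborel K > 0"
  obtains a b where "a < b" "fst ` K = {a..b}"
    "\<And>t. a < t \<Longrightarrow> t < b \<Longrightarrow> slice_area K t > 0"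
    "continuous_on {a<..<b} (slice_area K)"
    "\<And>t t'. t \<le> t' \<Longrightarrow> t' \<le> b \<Longrightarrow> (b - t') ^ DIM('b) * slice_area K t \<le> (b - t) ^ DIM('b) * slice_area K t'"
    "\<And>t t'. t \<le> t' \<Longrightarrow> a \<le> t \<Longrightarrow> (t - a) ^ DIM('b) * slice_area K t' \<le> (t' - a) ^ DIM('b) * slice_area K t"
    "slice_area K integrable_on {a..b}" "integral {a..b} (slice_area K) = measure lborel K"
    "\<And>t. t \<notin> {a..b} \<Longrightarrow> slice_area K t = 0"
proof -
  let ?A = "slice_area K" and ?m = "DIM('b)"
  have ne: "K \<noteq> {}" using pos by auto
  have "compact (fst ` K)" "connected (fst ` K)"
    using K by (auto intro!: compact_continuous_image continuous_on_fst continuous_on_id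
        connected_continuous_image convex_connected[OF K(2)])
  then obtain a b where ab: "fst ` K = {a..b}"
    using connected_compact_interval_1[of "fst ` K"] by (auto simp: cbox_interval)
  with ne have le: "a \<le> b" by auto
  have out: "?A t = 0" if "t \<notin> {a..b}" for t
  proof -
    have "slice K t = {}" using that ab[symmetric] by (force simp: slice_def)
    then show ?thesis by (simp add: slice_area_def)
  qed
  have nn: "(\<integral>\<^sup>+t. ennreal (?A t) \<partial>lborel) = ennreal (measure lborel K)"
    using emeasure_eq_slices[OF K(1)] emeasure_bounded_finite[OF compact_imp_bounded[OF K(1)]]
      emeasure_eq_ennreal_measure[of lborel K] by simp
  have intA: "integrable lborel ?A"
    using nn slice_area_measurable[OF K(1)] slice_area_nonneg
    by (intro integrableI_nonneg) auto
  have IA: "(LINT t|lborel. ?A t) = measure lborel K"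
    using nn slice_area_measurable[OF K(1)] slice_area_nonneg[of K]
    by (subst integral_eq_nn_integral) auto
  \<comment> \<open>The volume is the integral of the sections, so one of them is positive between
    the ends. The cone inequalities then carry positivity to all the others.\<close>
  have ex0: "\<exists>t0. a < t0 \<and> t0 < b \<and> ?A t0 > 0"
  proof (rule ccontr)
    assume neg: "\<not> ?thesis"
    have z: "?A t = 0" if "t \<notin> {a, b}" for t
    proof (cases "t \<in> {a..b}")
      case True
      with that have "a < t" "t < b" by auto
      with neg have "\<not> ?A t > 0" by blast
      with slice_area_nonneg[of K t] show ?thesis by linarith
    qed (rule out)
    have "AE t in lborel. t \<notin> {a, b}"
      by (rule AE_not_in) (auto intro: countable_imp_null_set_lborel)
    then have "AE t in lborel. ?A t = 0" by eventually_elim (rule z)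
    then have "(LINT t|lborel. ?A t) = 0" by (rule integral_eq_zero_AE)
    with IA pos show False by simp
  qed
  then obtain t0 where t0: "a < t0" "t0 < b" "?A t0 > 0" by blast
  have ablt: "a < b" using t0 by simp
  obtain ya yb where y: "(a, ya) \<in> K" "(b, yb) \<in> K"
  proof -
    have "a \<in> fst ` K" "b \<in> fst ` K" using ab le by simp_all
    then obtain p q where "p \<in> K" "fst p = a" "q \<in> K" "fst q = b" by blast
    then show ?thesis using that[of "snd p" "snd q"] by (metis prod.collapse)
  qed
  have cb: "(b - t') ^ ?m * ?A t \<le> (b - t) ^ ?m * ?A t'" if "t \<le> t'" "t' \<le> b" for t t'
  proof (cases "t = b")
    case False
    then have tb: "b - t > 0" using that by simp
    let ?\<theta> = "(t' - t) / (b - t)"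
    have th: "0 \<le> ?\<theta>" "?\<theta> \<le> 1" using tb that by auto
    have 1: "1 - ?\<theta> = (b - t') / (b - t)" using tb by (simp add: field_simps)
    have 2: "(1 - ?\<theta>) * t + ?\<theta> * b = t'"
      using tb by (simp add: 1) (simp add: divide_simps, simp add: algebra_simps)
    have "((b - t') / (b - t)) ^ ?m * ?A t \<le> ?A t'"
      using slice_cone[OF K y(2) th, of t] unfolding 2 unfolding 1 .
    then show ?thesis using tb by (simp add: power_divide field_simps)
  qed (use that in auto)
  have ca: "(t - a) ^ ?m * ?A t' \<le> (t' - a) ^ ?m * ?A t" if "t \<le> t'" "a \<le> t" for t t'
  proof (cases "t' = a")
    case False
    then have tb: "t' - a > 0" using that by simp
    let ?\<theta> = "(t' - t) / (t' - a)"
    have th: "0 \<le> ?\<theta>" "?\<theta> \<le> 1" using tb that by auto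
    have 1: "1 - ?\<theta> = (t - a) / (t' - a)" using tb by (simp add: field_simps)
    have 2: "(1 - ?\<theta>) * t' + ?\<theta> * a = t"
      using tb by (simp add: 1) (simp add: divide_simps, simp add: algebra_simps)
    have "((t - a) / (t' - a)) ^ ?m * ?A t' \<le> ?A t"
      using slice_cone[OF K y(1) th, of t'] unfolding 2 unfolding 1 .
    then show ?thesis using tb by (simp add: power_divide field_simps)
  qed (use that in auto)
  have Apos: "?A t > 0" if "a < t" "t < b" for t
  proof (cases "t \<le> t0")
    case True
    have "0 < (t - a) ^ ?m * ?A t0" using that t0 by simp
    also have "\<dots> \<le> (t0 - a) ^ ?m * ?A t" using True that by (intro ca) auto
    finally show ?thesis using t0 by (simp add: zero_less_mult_iff)
  next
    case False
    have "0 < (b - t) ^ ?m * ?A t0" using that t0 by simp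
    also have "\<dots> \<le> (b - t0) ^ ?m * ?A t" using False that by (intro cb) auto
    finally show ?thesis using t0 by (simp add: zero_less_mult_iff)
  qed
  have cont: "continuous_on {a<..<b} ?A"
  proof (rule continuous_at_imp_continuous_on, rule ballI)
    fix t1 assume t1: "t1 \<in> {a<..<b}"
    let ?p = "\<lambda>t. (b - t) / (b - t1)" and ?q = "\<lambda>t. (t - a) / (t1 - a)"
    have nz: "b - t1 > 0" "t1 - a > 0" using t1 by auto
    \<comment> \<open>The two cone inequalities squeeze \<open>?A t\<close> between these multiples
      of \<open>?A t1\<close>, which gives continuity.\<close>
    have lim: "((\<lambda>t. min (?p t) (?q t) ^ ?m * ?A t1) \<longlongrightarrow> min (?p t1) (?q t1) ^ ?m * ?A t1) (at t1)"
      "((\<lambda>t. max (?p t) (?q t) ^ ?m * ?A t1) \<longlongrightarrow> max (?p t1) (?q t1) ^ ?m * ?A t1) (at t1)"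
      by (intro tendsto_intros tendsto_min tendsto_max; use nz in simp)+
    have ev: "eventually (\<lambda>t. t \<in> {a<..<b}) (at t1)"
      using t1 by (intro eventually_at_in_open') auto
    have bnd: "min (?p t) (?q t) ^ ?m * ?A t1 \<le> ?A t \<and> ?A t \<le> max (?p t) (?q t) ^ ?m * ?A t1"
      if t: "t \<in> {a<..<b}" for t
    proof -
      have pq: "?p t \<ge> 0" "?q t \<ge> 0" using nz t by auto
      have mm: "min (?p t) (?q t) ^ ?m \<le> ?p t ^ ?m" "min (?p t) (?q t) ^ ?m \<le> ?q t ^ ?m"
        "?p t ^ ?m \<le> max (?p t) (?q t) ^ ?m" "?q t ^ ?m \<le> max (?p t) (?q t) ^ ?m"
        using pq by (auto intro!: power_mono)
      note mm = mm[THEN mult_right_mono[OF _ slice_area_nonneg[of K t1]]]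
      show ?thesis
      proof (cases "t1 \<le> t")
        case True
        have "?p t ^ ?m * ?A t1 \<le> ?A t"
          using cb[OF True] t nz by (simp add: power_divide field_simps)
        moreover have "?A t \<le> ?q t ^ ?m * ?A t1"
          using ca[OF True] t t1 nz by (simp add: power_divide field_simps)
        ultimately show ?thesis using mm by linarith
      next
        case False
        then have tl: "t \<le> t1" by simp
        have "?q t ^ ?m * ?A t1 \<le> ?A t"
          using ca[OF tl] t nz by (simp add: power_divide field_simps)
        moreover have "?A t \<le> ?p t ^ ?m * ?A t1"
          using cb[OF tl] t t1 nz by (simp add: power_divide field_simps)
        ultimately show ?thesis using mm by linarith
      qed
    qed
    have "(?A \<longlongrightarrow> ?A t1) (at t1)"
    proof (rule tendsto_sandwich)
      show "((\<lambda>t. min (?p t) (?q t) ^ ?m * ?A t1) \<longlongrightarrow> ?A t1) (at t1)"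
        "((\<lambda>t. max (?p t) (?q t) ^ ?m * ?A t1) \<longlongrightarrow> ?A t1) (at t1)"
        using lim nz by simp_all
    qed (use ev bnd in \<open>auto elim!: eventually_mono\<close>)
    then show "isCont ?A t1" by (simp add: isCont_def)
  qed
  have AI: "(?A has_integral measure lborel K) UNIV"
    using has_integral_integral_lborel[OF intA] IA by simp
  have "((\<lambda>t. if t \<in> {a..b} then ?A t else 0) has_integral measure lborel K) UNIV"
    using AI by (rule has_integral_eq[rotated]) (use out in auto)
  then have AI2: "(?A has_integral measure lborel K) {a..b}"
    using has_integral_restrict[OF subset_UNIV] by blast
  show ?thesis
    using that[OF ablt ab Apos cont cb ca _ _ out] AI2 by (auto simp: has_integral_iff)
qed


section \<open>Monotone transport and volumes of parallel sets\<close>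

lemma transport_exists:
  fixes f g :: "real \<Rightarrow> real"
  assumes ab: "a < b" and cd: "c < d"
    and f: "f integrable_on {a..b}" "continuous_on {a<..<b} f" "\<And>t. a < t \<Longrightarrow> t < b \<Longrightarrow> f t > 0"
    and g: "g integrable_on {c..d}" "continuous_on {c<..<d} g" "\<And>t. c < t \<Longrightarrow> t < d \<Longrightarrow> g t > 0"
    and eq: "integral {a..b} f = integral {c..d} g"
  obtains S where "continuous_on {c..d} S" "S c = a" "S d = b"
    "\<And>s. s \<in> {c..d} \<Longrightarrow> S s \<in> {a..b} \<and> integral {a..S s} f = integral {c..s} g"
    "\<And>s. c < s \<Longrightarrow> s < d \<Longrightarrow> a < S s \<and> S s < b \<and> (S has_real_derivative g s / f (S s)) (at s)"
proof -
  have aux: "continuous_on {a..b} (\<lambda>t. integral {a..t} f)"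
      "\<And>t. a < t \<Longrightarrow> t < b \<Longrightarrow> ((\<lambda>t. integral {a..t} f) has_real_derivative f t) (at t)"
      "strict_mono_on {a..b} (\<lambda>t. integral {a..t} f)"
    if ab: "a < b" and f: "f integrable_on {a..b}" "continuous_on {a<..<b} f" "\<And>t. a < t \<Longrightarrow> t < b \<Longrightarrow> f t > 0"
    for a b :: real and f :: "real \<Rightarrow> real"
  proof -
    show c: "continuous_on {a..b} (\<lambda>t. integral {a..t} f)"
      by (rule indefinite_integral_continuous_1[OF f(1)])
    show d: "((\<lambda>t. integral {a..t} f) has_real_derivative f t) (at t)" if t: "a < t" "t < b" for t
    proof -
      have ct: "continuous (at t within {a..b}) f"
        using f(2) t by (simp add: continuous_on_eq_continuous_at continuous_at_imp_continuous_at_within)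
      have "((\<lambda>t. integral {a..t} f) has_vector_derivative f t) (at t within {a..b})"
        using integral_has_vector_derivative_continuous_at[OF f(1), of t "{}"] t ct by auto
      then show ?thesis
        using t by (simp add: has_real_derivative_iff_has_vector_derivative at_within_Icc_at)
    qed
    show "strict_mono_on {a..b} (\<lambda>t. integral {a..t} f)"
    proof (rule strict_mono_onI)
      fix r s assume rs: "r \<in> {a..b}" "s \<in> {a..b}" "r < s"
      show "integral {a..r} f < integral {a..s} f"
      proof (rule DERIV_pos_imp_increasing_open[of r s "\<lambda>t. integral {a..t} f"])
        show "r < s" by fact
        fix x assume "r < x" "x < s"
        then have "a < x" "x < b" using rs by auto
        with d f(3) show "\<exists>y. ((\<lambda>t. integral {a..t} f) has_real_derivative y) (at x) \<and> y > 0" by blast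
      qed (use rs in \<open>auto intro: continuous_on_subset[OF c]\<close>)
    qed
  qed
  define Ff where "Ff t = integral {a..t} f" for t
  define Fg where "Fg t = integral {c..t} g" for t
  have Ff: "continuous_on {a..b} Ff" "\<And>t. a < t \<Longrightarrow> t < b \<Longrightarrow> (Ff has_real_derivative f t) (at t)" "strict_mono_on {a..b} Ff"
    unfolding Ff_def by (rule aux[OF ab f]; assumption)+
  have Fg: "continuous_on {c..d} Fg" "\<And>t. c < t \<Longrightarrow> t < d \<Longrightarrow> (Fg has_real_derivative g t) (at t)" "strict_mono_on {c..d} Fg"
    unfolding Fg_def by (rule aux[OF cd g]; assumption)+
  define m where "m = integral {a..b} f"
  have ends: "Ff a = 0" "Ff b = m" "Fg c = 0" "Fg d = m"
    using eq by (simp_all add: Ff_def Fg_def m_def)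
  have injf: "inj_on Ff {a..b}" using Ff(3) by (rule strict_mono_on_imp_inj_on)
  have monf: "mono_on {a..b} Ff" and mong: "mono_on {c..d} Fg"
    using Ff(3) Fg(3) by (auto intro: strict_mono_on_imp_mono_on)
  have imf: "Ff ` {a..b} = {0..m}"
  proof
    show "Ff ` {a..b} \<subseteq> {0..m}" using ends monotone_onD[OF monf] ab by force
    show "{0..m} \<subseteq> Ff ` {a..b}"
      using IVT'[of Ff a _ b] Ff(1) ends ab by force
  qed
  have img: "Fg s \<in> {0..m}" if "s \<in> {c..d}" for s
    using ends monotone_onD[OF mong, of c s] monotone_onD[OF mong, of s d] that by auto
  define R where "R = the_inv_into {a..b} Ff"
  have R: "R y \<in> {a..b}" "Ff (R y) = y" if "y \<in> {0..m}" for y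
    using that imf the_inv_into_into[OF injf, of y "{a..b}"] f_the_inv_into_f[OF injf, of y]
    by (auto simp: R_def)
  have RF: "R (Ff t) = t" if "t \<in> {a..b}" for t
    using that by (simp add: R_def the_inv_into_f_f[OF injf])
  have contR: "continuous_on {0..m} R"
    unfolding imf[symmetric] by (rule continuous_on_inv[OF Ff(1)]) (auto simp: RF)
  \<comment> \<open>The distribution function of \<open>g\<close> followed by the inverse of that of
    \<open>f\<close>. The densities may degenerate at the end points, so \<open>S\<close> is
    differentiated only in the interior.\<close>
  define S where "S s = R (Fg s)" for s
  have SI: "S s \<in> {a..b} \<and> integral {a..S s} f = integral {c..s} g" if "s \<in> {c..d}" for s
    using R[OF img[OF that]] by (simp add: S_def Ff_def Fg_def)
  show ?thesis
  proof
    show "continuous_on {c..d} S"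
      unfolding S_def by (rule continuous_on_compose2[OF contR Fg(1)]) (use img in auto)
    show "S c = a" "S d = b"
      using RF[of a] RF[of b] ends ab by (simp_all add: S_def)
    show "S s \<in> {a..b} \<and> integral {a..S s} f = integral {c..s} g" if "s \<in> {c..d}" for s by (rule SI[OF that])
    show "a < S s \<and> S s < b \<and> (S has_real_derivative g s / f (S s)) (at s)" if s: "c < s" "s < d" for s
    proof -
      have y: "0 < Fg s" "Fg s < m"
        using strict_mono_onD[OF Fg(3), of c s] strict_mono_onD[OF Fg(3), of s d] s ends by auto
      have Sab: "S s \<in> {a..b}" and FS: "Ff (S s) = Fg s" using R[of "Fg s"] y by (auto simp: S_def)
      have "S s \<noteq> a" "S s \<noteq> b" using FS y ends by auto
      with Sab have S: "a < S s" "S s < b" by auto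
      have "(R has_real_derivative inverse (f (R (Fg s)))) (at (Fg s))"
      proof (rule DERIV_inverse_function)
        show "(Ff has_real_derivative f (R (Fg s))) (at (R (Fg s)))"
          using Ff(2)[OF S] by (simp add: S_def)
        show "f (R (Fg s)) \<noteq> 0" using f(3)[OF S] by (simp add: S_def)
        show "0 < Fg s" "Fg s < m" by fact+
        show "Ff (R y) = y" if "0 < y" "y < m" for y using R(2)[of y] that by simp
        show "isCont R (Fg s)" using contR y by (simp add: continuous_on_interior)
      qed
      from DERIV_chain2[OF this Fg(2)[OF s]] S show ?thesis
        by (simp add: S_def[abs_def] divide_inverse mult.commute)
    qed
  qed
qed

text \<open>The derivative may be unbounded near the end points, so the substitution is made on the
  compact intervals \<open>I n\<close> that exhaust the open one. An inequality results because the
  image of \<open>\<sigma>\<close> need not be the whole line.\<close>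

lemma nn_integral_substitution_open:
  fixes \<sigma> \<sigma>' h :: "real \<Rightarrow> real"
  assumes h: "h \<in> borel_measurable borel" "\<And>u. h u \<ge> 0" and cd: "c < d"
    and der: "\<And>s. c < s \<Longrightarrow> s < d \<Longrightarrow> (\<sigma> has_real_derivative \<sigma>' s) (at s)"
    and cont: "continuous_on {c<..<d} \<sigma>'" and nonneg: "\<And>s. c < s \<Longrightarrow> s < d \<Longrightarrow> \<sigma>' s \<ge> 0"
  shows "(\<integral>\<^sup>+s. ennreal (h (\<sigma> s) * \<sigma>' s) * indicator {c<..<d} s \<partial>lborel) \<le> (\<integral>\<^sup>+u. ennreal (h u) \<partial>lborel)"
proof -
  define I where "I n = {c + (d - c) / (real n + 3) .. d - (d - c) / (real n + 3)}" for n
  have Isub: "I n \<subseteq> {c<..<d}" for n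
  proof -
    have "(d - c) / (real n + 3) > 0" using cd by simp
    then show ?thesis unfolding I_def by auto
  qed
  have inc: "incseq I"
  proof (rule incseq_SucI)
    fix n
    have "(d - c) / (real (Suc n) + 3) \<le> (d - c) / (real n + 3)"
      using cd by (intro divide_left_mono) auto
    then show "I n \<le> I (Suc n)" unfolding I_def by auto
  qed
  have UI: "(\<Union>n. I n) = {c<..<d}"
  proof (intro equalityI subsetI)
    fix s assume "s \<in> {c<..<d}"
    then have s: "c < s" "s < d" by auto
    have "eventually (\<lambda>n. (d - c) / (real n + 3) < min (s - c) (d - s)) sequentially"
      using s by real_asymp
    then obtain n where "(d - c) / (real n + 3) < min (s - c) (d - s)"
      by (auto simp: eventually_sequentially)
    then show "s \<in> (\<Union>n. I n)" by (auto simp: I_def intro!: exI[of _ n])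
  qed (use Isub in blast)
  have c\<sigma>: "continuous_on {c<..<d} \<sigma>"
    using der by (meson DERIV_continuous_on greaterThanLessThan_iff has_field_derivative_at_within)
  define \<phi> where "\<phi> s = ennreal (h (\<sigma> s) * \<sigma>' s) * indicator {c<..<d} s" for s
  have \<phi>m: "\<phi> \<in> borel_measurable lborel"
  proof -
    have m1: "(\<lambda>s. indicator {c<..<d} s *\<^sub>R \<sigma> s) \<in> borel_measurable borel"
      "(\<lambda>s. indicator {c<..<d} s *\<^sub>R \<sigma>' s) \<in> borel_measurable borel"
      using c\<sigma> cont by (intro borel_measurable_continuous_on_indicator; simp)+
    note [measurable] = m1 h(1)
    have "(\<lambda>s. ennreal (h (indicator {c<..<d} s *\<^sub>R \<sigma> s) * (indicator {c<..<d} s *\<^sub>R \<sigma>' s))) \<in> borel_measurable lborel"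
      by measurable
    also have "(\<lambda>s. ennreal (h (indicator {c<..<d} s *\<^sub>R \<sigma> s) * (indicator {c<..<d} s *\<^sub>R \<sigma>' s))) = \<phi>"
      by (auto simp: \<phi>_def indicator_def fun_eq_iff)
    finally show ?thesis .
  qed
  have bound: "(\<integral>\<^sup>+s. \<phi> s * indicator (I n) s \<partial>lborel) \<le> (\<integral>\<^sup>+u. ennreal (h u) \<partial>lborel)" for n
  proof -
    define p q where "p = c + (d - c) / (real n + 3)" and "q = d - (d - c) / (real n + 3)"
    have Ipq: "I n = {p..q}" by (simp add: I_def p_def q_def)
    have pq: "p \<le> q"
    proof -
      have "(d - c) / (real n + 3) \<le> (d - c) / 2" using cd by (intro divide_left_mono) auto
      moreover have "c + x \<le> d - x" if "x \<le> (d - c) / 2" for x using that by simp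
      ultimately show ?thesis unfolding p_def q_def by blast
    qed
    have sub: "c < s" "s < d" if "s \<in> {p..q}" for s using Isub[of n] that Ipq by auto
    have "(\<integral>\<^sup>+s. \<phi> s * indicator (I n) s \<partial>lborel) = (\<integral>\<^sup>+s. ennreal (h (\<sigma> s) * \<sigma>' s * indicator {p..q} s) \<partial>lborel)"
      unfolding Ipq using sub
      by (intro nn_integral_cong) (auto simp: \<phi>_def indicator_def)
    also have "\<dots> = (\<integral>\<^sup>+u. ennreal (h u * indicator {\<sigma> p..\<sigma> q} u) \<partial>lborel)"
    proof (rule nn_integral_substitution[symmetric])
      show "set_borel_measurable borel {\<sigma> p..\<sigma> q} h"
        unfolding set_borel_measurable_def using h(1) by measurable
      show "continuous_on {p..q} \<sigma>'" using sub by (intro continuous_on_subset[OF cont]) auto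
    qed (use sub der nonneg pq in auto)
    also have "\<dots> \<le> (\<integral>\<^sup>+u. ennreal (h u) \<partial>lborel)"
      using h(2) by (intro nn_integral_mono) (auto simp: indicator_def)
    finally show ?thesis .
  qed
  have Im [measurable]: "I n \<in> sets borel" for n by (simp add: I_def)
  have "(\<integral>\<^sup>+s. \<phi> s * indicator (\<Union>n. I n) s \<partial>lborel) = emeasure (density lborel \<phi>) (\<Union>n. I n)"
    using \<phi>m by (subst emeasure_density) auto
  also have "\<dots> = (SUP n. emeasure (density lborel \<phi>) (I n))"
    using inc by (intro SUP_emeasure_incseq[symmetric]) auto
  also have "\<dots> \<le> (\<integral>\<^sup>+u. ennreal (h u) \<partial>lborel)"
    using \<phi>m bound by (intro SUP_least) (auto simp: emeasure_density)
  finally show ?thesis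
    unfolding UI by (simp add: \<phi>_def mult.assoc flip: indicator_inter_arith)
qed

abbreviation parallel_set :: "'a::metric_space set \<Rightarrow> real \<Rightarrow> 'a set" where
  "parallel_set K r \<equiv> {x. infdist x K \<le> r}"

lemma parallel_set_compact:
  fixes K :: "'a::euclidean_space set"
  assumes "compact K" "K \<noteq> {}"
  shows "compact (parallel_set K r)"
proof -
  obtain M where M: "\<And>x. x \<in> K \<Longrightarrow> norm x \<le> M"
    using compact_imp_bounded[OF assms(1)] by (metis bounded_iff)
  have "norm x \<le> M + r" if x: "infdist x K \<le> r" for x
  proof -
    obtain q where "q \<in> K" "infdist x K = dist x q"
      using infdist_attains_inf[OF compact_imp_closed[OF assms(1)] assms(2)] by metis
    then show ?thesis using M[of q] x norm_triangle_sub[of x q] by (simp add: dist_norm)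
  qed
  then have "bounded (parallel_set K r)" by (auto simp: bounded_iff)
  moreover have "closed (parallel_set K r)" by (intro closed_Collect_le continuous_intros)
  ultimately show ?thesis by (simp add: compact_eq_bounded_closed)
qed

text \<open>Pythagoras: after a step \<open>e * s\<close> along the axis, a ball of radius
  \<open>e\<close> still allows lateral steps of length
  \<open>e * sqrt (1 - s\<^sup>2)\<close>.\<close>

lemma slice_parallel_set:
  fixes K :: "(real \<times> 'b::euclidean_space) set"
  assumes K: "compact K" and ne: "slice K t \<noteq> {}" and s: "\<bar>s\<bar> \<le> 1" and e: "e \<ge> 0"
  shows "parallel_set (slice K t) (e * sqrt (1 - s\<^sup>2)) \<subseteq> slice (parallel_set K e) (t + e * s)"
proof
  fix w assume "w \<in> parallel_set (slice K t) (e * sqrt (1 - s\<^sup>2))"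
  moreover obtain y where y: "y \<in> slice K t" "infdist w (slice K t) = dist w y"
    using infdist_attains_inf[OF compact_imp_closed[OF slice_compact[OF K]] ne] by metis
  ultimately have d: "dist w y \<le> e * sqrt (1 - s\<^sup>2)" by simp
  have s2: "s\<^sup>2 \<le> 1" using s by (simp add: abs_square_le_1)
  have "infdist (t + e * s, w) K \<le> dist (t + e * s, w) (t, y)"
    using y by (intro infdist_le) (simp add: slice_def)
  also have "\<dots> = sqrt ((e * s)\<^sup>2 + (dist w y)\<^sup>2)"
    by (simp add: dist_Pair_Pair dist_real_def)
  also have "\<dots> \<le> sqrt ((e * s)\<^sup>2 + (e * sqrt (1 - s\<^sup>2))\<^sup>2)"
    using d by (intro real_sqrt_le_mono add_left_mono power_mono) auto
  also have "\<dots> = e" using s2 e by (simp add: power_mult_distrib algebra_simps)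
  finally show "w \<in> slice (parallel_set K e) (t + e * s)" by (simp add: slice_def)
qed

text \<open>The section of the body at \<open>S s\<close> is combined with the section of the ball
  of radius \<open>e\<close> at \<open>e * s\<close>. Both lie over the height
  \<open>S s + e * s\<close> of the parallel set, and the substitution by this height brings in the
  factor \<open>S' s + e\<close>.\<close>

lemma parallel_volume_ge_slices:
  fixes K :: "(real \<times> 'b::euclidean_space) set" and S S' :: "real \<Rightarrow> real"
  assumes K: "compact K" "K \<noteq> {}" and e: "e \<ge> 0"
    and S: "\<And>s. -1 < s \<Longrightarrow> s < 1 \<Longrightarrow> (S has_real_derivative S' s) (at s)"
    and S': "continuous_on {-1<..<1} S'" "\<And>s. -1 < s \<Longrightarrow> s < 1 \<Longrightarrow> S' s \<ge> 0"
    and H: "\<And>s. -1 < s \<Longrightarrow> s < 1 \<Longrightarrow>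
        slice K (S s) \<noteq> {} \<and> H s \<le> measure lborel (parallel_set (slice K (S s)) (e * sqrt (1 - s\<^sup>2))) * (S' s + e)"
    and HI: "H integrable_on {-1..1}" "\<And>s. -1 < s \<Longrightarrow> s < 1 \<Longrightarrow> H s \<ge> 0"
    and Hm: "(\<lambda>s. indicator {-1<..<1} s *\<^sub>R H s) \<in> borel_measurable borel"
  shows "integral {-1..1} H \<le> measure lborel (parallel_set K e)"
proof -
  let ?N = "parallel_set K e"
  have cN: "compact ?N" by (rule parallel_set_compact[OF K])
  have Hb: "H s \<le> slice_area ?N (S s + e * s) * (S' s + e)" if s: "-1 < s" "s < 1" for s
  proof -
    have cs: "compact (slice K (S s))" by (rule slice_compact[OF K(1)])
    have "measure lborel (parallel_set (slice K (S s)) (e * sqrt (1 - s\<^sup>2))) \<le> slice_area ?N (S s + e * s)"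
      unfolding slice_area_def
      by (rule measure_mono_fmeasurable[OF slice_parallel_set[OF K(1) _ _ e]])
        (use H[OF s] s parallel_set_compact[OF cs] slice_compact[OF cN] in
          \<open>auto simp: borel_compact fmeasurable_def emeasure_slice[OF cN]\<close>)
    then have "measure lborel (parallel_set (slice K (S s)) (e * sqrt (1 - s\<^sup>2))) * (S' s + e)
       \<le> slice_area ?N (S s + e * s) * (S' s + e)"
      using S'(2)[OF s] e by (intro mult_right_mono) auto
    with H[OF s] show ?thesis by linarith
  qed
  have "(\<integral>\<^sup>+s. ennreal (H s) * indicator {-1<..<1} s \<partial>lborel)
     \<le> (\<integral>\<^sup>+s. ennreal (slice_area ?N (S s + e * s) * (S' s + e)) * indicator {-1<..<1} s \<partial>lborel)"
    using Hb by (intro nn_integral_mono) (auto simp: indicator_def intro!: ennreal_leI)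
  also have "\<dots> \<le> (\<integral>\<^sup>+u. ennreal (slice_area ?N u) \<partial>lborel)"
  proof (rule nn_integral_substitution_open)
    show "slice_area ?N \<in> borel_measurable borel" by (rule slice_area_measurable[OF cN])
    show "((\<lambda>s. S s + e * s) has_real_derivative S' s + e) (at s)" if "-1 < s" "s < 1" for s
      by (auto intro!: derivative_eq_intros S that)
    show "continuous_on {-1<..<1} (\<lambda>s. S' s + e)" by (intro continuous_intros S')
    show "S' s + e \<ge> 0" if "-1 < s" "s < 1" for s using S'(2)[OF that] e by simp
  qed (auto simp: slice_area_nonneg)
  also have "\<dots> = ennreal (measure lborel ?N)"
    using emeasure_eq_slices[OF cN] emeasure_bounded_finite[OF compact_imp_bounded[OF cN]]
      emeasure_eq_ennreal_measure[of lborel ?N] by simp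
  finally have le: "(\<integral>\<^sup>+s. ennreal (H s) * indicator {-1<..<1} s \<partial>lborel) \<le> ennreal (measure lborel ?N)" .
  have nn2: "(\<integral>\<^sup>+s. ennreal (H s) * indicator {-1<..<1} s \<partial>lborel) = ennreal (integral {-1<..<1} H)"
  proof -
    have hi: "(H has_integral integral {-1<..<1} H) {-1<..<1}"
      using HI(1) by (simp add: integrable_integral integrable_on_Icc_iff_Ioo)
    have eq: "(\<integral>\<^sup>+s. ennreal (H s) * indicator {-1<..<1} s \<partial>lborel)
       = (\<integral>\<^sup>+s. ennreal (indicator {-1<..<1} s *\<^sub>R H s) \<partial>lborel)"
      by (intro nn_integral_cong) (auto simp: indicator_def)
    show ?thesis unfolding eq
    proof (rule nn_integral_has_integral_lborel[OF Hm])
      show "0 \<le> indicator {-1<..<1} s *\<^sub>R H s" for s using HI(2)[of s] by (auto simp: indicator_def)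
      show "((\<lambda>s. indicator {-1<..<1} s *\<^sub>R H s) has_integral integral {-1<..<1} H) UNIV"
        using iffD2[OF has_integral_restrict[OF subset_UNIV] hi]
        by (rule has_integral_eq[rotated]) (simp add: indicator_def)
    qed
  qed
  have "integral {-1<..<1} H = integral {-1..1} H" by (simp add: integral_open_interval_real)
  with le nn2 show ?thesis by simp
qed

section \<open>The planar Brunn-Minkowski inequality with a disc\<close>

lemma has_integral_semicircle: "((\<lambda>s. 2 * sqrt (1 - s\<^sup>2)) has_integral pi) {-1..1}"
proof -
  have "((\<lambda>s. 2 * sqrt (1 - s\<^sup>2)) has_integral
     (1 * sqrt (1 - 1\<^sup>2) + arcsin 1 - (- 1 * sqrt (1 - (-1)\<^sup>2) + arcsin (-1)))) {-1..1}"
  proof (rule fundamental_theorem_of_calculus_interior)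
    show "continuous_on {-1..1} (\<lambda>s. s * sqrt (1 - s\<^sup>2) + arcsin s)"
      by (intro continuous_intros) auto
    fix s :: real assume s: "s \<in> {-1<..<1}"
    then have p: "1 - s\<^sup>2 > 0" by (simp add: abs_square_less_1 abs_less_iff)
    have "((\<lambda>s. s * sqrt (1 - s\<^sup>2) + arcsin s) has_real_derivative
        sqrt (1 - s\<^sup>2) + s * (- (2 * s) * (inverse (sqrt (1 - s\<^sup>2)) / 2)) + inverse (sqrt (1 - s\<^sup>2))) (at s)"
      using s p by (auto intro!: derivative_eq_intros)
    moreover have "sqrt (1 - s\<^sup>2) + s * (- (2 * s) * (inverse (sqrt (1 - s\<^sup>2)) / 2)) + inverse (sqrt (1 - s\<^sup>2)) = 2 * sqrt (1 - s\<^sup>2)"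
    proof -
      define q where "q = sqrt (1 - s\<^sup>2)"
      have q: "q > 0" "q * q = 1 - s * s" using p by (auto simp: q_def power2_eq_square)
      then show ?thesis unfolding q_def[symmetric] by (simp add: field_simps)
    qed
    ultimately have "((\<lambda>s. s * sqrt (1 - s\<^sup>2) + arcsin s) has_real_derivative 2 * sqrt (1 - s\<^sup>2)) (at s)"
      by metis
    then show "((\<lambda>s. s * sqrt (1 - s\<^sup>2) + arcsin s) has_vector_derivative 2 * sqrt (1 - s\<^sup>2)) (at s)"
      by (simp add: has_real_derivative_iff_has_vector_derivative)
  qed auto
  then show ?thesis by (simp add: arcsin_minus)
qed

lemma measure_parallel_interval:
  fixes K :: "real set"
  assumes "compact K" "convex K" "K \<noteq> {}" "\<rho> \<ge> 0"
  shows "measure lborel K + 2 * \<rho> \<le> measure lborel (parallel_set K \<rho>)"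
proof -
  have "connected K" using assms convex_connected by blast
  then obtain p q where K: "K = {p..q}"
    using connected_compact_interval_1[of K] assms by (auto simp: cbox_interval)
  with assms have pq: "p \<le> q" by auto
  have sub: "{p - \<rho>..q + \<rho>} \<subseteq> parallel_set K \<rho>"
  proof
    fix x assume x: "x \<in> {p - \<rho>..q + \<rho>}"
    have "infdist x K \<le> dist x (max p (min q x))"
      using pq by (intro infdist_le) (auto simp: K)
    also have "\<dots> \<le> \<rho>" using x pq assms(4) by (auto simp: dist_real_def max_def min_def)
    finally show "x \<in> parallel_set K \<rho>" by simp
  qed
  have "measure lborel {p - \<rho>..q + \<rho>} \<le> measure lborel (parallel_set K \<rho>)"
    using parallel_set_compact[OF assms(1,3), of \<rho>] emeasure_bounded_finite[of "parallel_set K \<rho>"]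
    by (intro measure_mono_fmeasurable[OF sub]) (auto simp: fmeasurable_def compact_imp_bounded borel_compact)
  then show ?thesis using pq assms(4) by (simp add: K)
qed

text \<open>After expansion only the terms linear in \<open>r\<close> differ, and they are compared
  by the arithmetic-geometric mean inequality for \<open>\<kappa> / x\<close> and
  \<open>x\<close>.\<close>

lemma AM_GM_product:
  fixes x :: real
  assumes "x > 0" "r \<ge> 0" "\<kappa> > 0"
  shows "(sqrt \<kappa> + r)\<^sup>2 \<le> (\<kappa> / x + r) * (x + r)"
proof -
  have "0 \<le> (sqrt (\<kappa> / x) - sqrt x)\<^sup>2" by simp
  moreover have "sqrt (\<kappa> / x) * sqrt x = sqrt \<kappa>"
    using assms by (simp flip: real_sqrt_mult)
  ultimately have "2 * sqrt \<kappa> \<le> \<kappa> / x + x"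
    using assms by (simp add: power2_diff mult.assoc)
  then have "r * (2 * sqrt \<kappa>) \<le> r * (\<kappa> / x + x)"
    using assms by (intro mult_left_mono) auto
  moreover have "(\<kappa> / x + r) * (x + r) = \<kappa> + r * (\<kappa> / x + x) + r\<^sup>2"
    using assms by (simp add: field_simps power2_eq_square)
  moreover have "(sqrt \<kappa> + r)\<^sup>2 = \<kappa> + r * (2 * sqrt \<kappa>) + r\<^sup>2"
    using assms by (simp add: power2_sum)
  ultimately show ?thesis by linarith
qed

lemma convex_slice: "convex K \<Longrightarrow> convex (slice K t)" for K :: "(real \<times> 'b::real_vector) set"
proof (rule convexI)
  fix x y and u v :: real assume K: "convex K" and "x \<in> slice K t" "y \<in> slice K t" "u \<ge> 0" "v \<ge> 0" "u + v = 1"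
  then show "u *\<^sub>R x + v *\<^sub>R y \<in> slice K t"
    using convexD[OF K, of "(t, x)" "(t, y)" u v] by (simp add: slice_def distrib_right[symmetric])
qed

text \<open>The transport argument one dimension lower. The source is the chord length of the unit
  disc, scaled by \<open>\<kappa>\<close> so that \<open>sqrt \<kappa>\<close> is the radius of the
  disc with the area of \<open>K\<close>. Sections are intervals, whose parallel sets gain twice the
  radius in length, and \<open>AM_GM_product\<close> bounds the integrand by a multiple of the chord
  length alone.\<close>

lemma brunn_minkowski_disc:
  fixes K :: "(real \<times> real) set"
  assumes K: "compact K" "convex K" and pos: "measure lborel K > 0" and r: "r \<ge> 0"
  shows "(sqrt (measure lborel K) + sqrt pi * r)\<^sup>2 \<le> measure lborel (parallel_set K r)"
proof -
  obtain a b where ab: "a < b" "fst ` K = {a..b}"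
    and Apos: "\<And>t. a < t \<Longrightarrow> t < b \<Longrightarrow> slice_area K t > 0"
    and Ac: "continuous_on {a<..<b} (slice_area K)"
    and AI: "slice_area K integrable_on {a..b}" "integral {a..b} (slice_area K) = measure lborel K"
    by (rule slice_area_props[OF K pos]) blast
  define \<kappa> where "\<kappa> = measure lborel K / pi"
  have \<kappa>: "\<kappa> > 0" using pos by (simp add: \<kappa>_def)
  define g where "g s = \<kappa> * (2 * sqrt (1 - s\<^sup>2))" for s
  have gI: "(g has_integral measure lborel K) {-1..1}"
    unfolding g_def using has_integral_mult_right[OF has_integral_semicircle, of \<kappa>] by (simp add: \<kappa>_def)
  have gp: "g s > 0" if "-1 < s" "s < 1" for s
    using that \<kappa> by (simp add: g_def abs_square_less_1)
  have gc: "continuous_on {-1<..<1} g"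
    unfolding g_def by (intro continuous_intros)
  have geq: "integral {a..b} (slice_area K) = integral {-1..1} g"
    using AI gI by (simp add: integral_unique)
  obtain S where S: "continuous_on {-1..1} S"
    "\<And>s. -1 < s \<Longrightarrow> s < 1 \<Longrightarrow> a < S s \<and> S s < b \<and> (S has_real_derivative g s / slice_area K (S s)) (at s)"
    by (rule transport_exists[OF ab(1) _ AI(1) Ac Apos has_integral_integrable[OF gI] gc gp geq]) (auto intro: that)
  define S' where "S' s = g s / slice_area K (S s)" for s
  have A: "slice_area K (S s) > 0" if "-1 < s" "s < 1" for s using S(2)[OF that] Apos by auto
  have S'p: "S' s > 0" if "-1 < s" "s < 1" for s using A gp that by (simp add: S'_def)
  have cS': "continuous_on {-1<..<1} S'"
    unfolding S'_def
  proof (intro continuous_on_divide gc continuous_on_compose2[OF Ac])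
    show "continuous_on {-1<..<1} S" by (rule continuous_on_subset[OF S(1)]) auto
    show "S ` {-1<..<1} \<subseteq> {a<..<b}" using S(2) by auto
    show "\<forall>s\<in>{-1<..<1}. slice_area K (S s) \<noteq> 0" using A by force
  qed
  define H where "H s = 2 * sqrt (1 - s\<^sup>2) * (sqrt \<kappa> + r)\<^sup>2" for s
  have HI: "(H has_integral pi * (sqrt \<kappa> + r)\<^sup>2) {-1..1}"
    unfolding H_def by (rule has_integral_mult_left[OF has_integral_semicircle])
  have "integral {-1..1} H \<le> measure lborel (parallel_set K r)"
  proof (rule parallel_volume_ge_slices[OF K(1) _ r, of S S'])
    show "K \<noteq> {}" using pos by auto
    show "(S has_real_derivative S' s) (at s)" if "-1 < s" "s < 1" for s using S(2)[OF that] by (simp add: S'_def)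
    show "S' s \<ge> 0" if "-1 < s" "s < 1" for s using S'p[OF that] by simp
    show "H integrable_on {-1..1}" using HI by auto
    show "(\<lambda>s. indicator {-1<..<1} s *\<^sub>R H s) \<in> borel_measurable borel" unfolding H_def by measurable
    fix s :: real assume s: "-1 < s" "s < 1"
    then have s2: "1 - s\<^sup>2 > 0" by (simp add: abs_square_less_1)
    show "H s \<ge> 0" using s2 by (simp add: H_def)
    have ne: "slice K (S s) \<noteq> {}" using A[OF s] by (auto simp: slice_area_def)
    have Aeq: "slice_area K (S s) = \<kappa> * (2 * sqrt (1 - s\<^sup>2)) / S' s"
      using A[OF s] gp[OF s] by (simp add: S'_def g_def[symmetric])
    have "H s \<le> 2 * sqrt (1 - s\<^sup>2) * ((\<kappa> / S' s + r) * (S' s + r))"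
      unfolding H_def using s2 S'p[OF s] r \<kappa> by (intro mult_left_mono AM_GM_product) auto
    also have "\<dots> = (slice_area K (S s) + 2 * (r * sqrt (1 - s\<^sup>2))) * (S' s + r)"
      by (simp add: Aeq algebra_simps)
    also have "\<dots> \<le> measure lborel (parallel_set (slice K (S s)) (r * sqrt (1 - s\<^sup>2))) * (S' s + r)"
      unfolding slice_area_def using s2 r S'p[OF s]
      by (intro mult_right_mono measure_parallel_interval slice_compact convex_slice K ne) auto
    finally show "slice K (S s) \<noteq> {} \<and> H s \<le> measure lborel (parallel_set (slice K (S s)) (r * sqrt (1 - s\<^sup>2))) * (S' s + r)"
      using ne by simp
  qed (use cS' in auto)
  moreover have "integral {-1..1} H = (sqrt (measure lborel K) + sqrt pi * r)\<^sup>2"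
  proof -
    have "measure lborel K = pi * \<kappa>" by (simp add: \<kappa>_def)
    then have "(sqrt (measure lborel K) + sqrt pi * r)\<^sup>2 = (sqrt pi * (sqrt \<kappa> + r))\<^sup>2"
      by (simp add: real_sqrt_mult algebra_simps)
    then show ?thesis using HI by (simp add: has_integral_iff power_mult_distrib)
  qed
  ultimately show ?thesis by simp
qed

text \<open>The gap in the arithmetic-geometric mean inequality for \<open>1 / x\<close>,
  \<open>sqrt x\<close>, \<open>sqrt x\<close>, whose product is 1. For \<open>x = y\<^sup>2\<close>
  the sum \<open>3 + Psi x\<close> is the coefficient of \<open>e\<close> in
  \<open>(1 / y + e)\<^sup>2 * (y\<^sup>2 + e)\<close>.\<close>

definition Psi :: "real \<Rightarrow> real" where
  "Psi x = 1 / x + 2 * sqrt x - 3"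

lemma Psi_sqrt:
  assumes "y > 0" shows "Psi (y\<^sup>2) = (y - 1)\<^sup>2 * (2 * y + 1) / y\<^sup>2"
  using assms by (simp add: Psi_def field_simps power2_eq_square)

lemma Psi_nonneg: "x > 0 \<Longrightarrow> Psi x \<ge> 0"
  using Psi_sqrt[of "sqrt x"] by simp

lemma has_integral_disc_area:
  assumes "c \<le> (d::real)"
  shows "((\<lambda>s. pi * (1 - s\<^sup>2)) has_integral pi * (d - d ^ 3 / 3 - (c - c ^ 3 / 3))) {c..d}"
proof -
  have "((\<lambda>s. pi * (1 - s\<^sup>2)) has_integral (pi * (d - d ^ 3 / 3) - pi * (c - c ^ 3 / 3))) {c..d}"
    using assms
    by (intro fundamental_theorem_of_calculus)
      (auto intro!: derivative_eq_intros simp: has_real_derivative_iff_has_vector_derivative[symmetric]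
        algebra_simps power2_eq_square)
  then show ?thesis by (simp add: algebra_simps)
qed

text \<open>The section function A of a convex body of volume \<open>4 * pi / 3\<close>, with the monotone transport S of the
  mass distribution of the unit ball onto that of the body (the first component of the Knothe map).\<close>

locale profile =
  fixes A S S' :: "real \<Rightarrow> real" and a b :: real
  assumes ab: "a < b"
    and A_pos: "\<And>t. a < t \<Longrightarrow> t < b \<Longrightarrow> A t > 0"
    and A_nonneg: "\<And>t. A t \<ge> 0"
    and cone_b: "\<And>t t'. t \<le> t' \<Longrightarrow> t' \<le> b \<Longrightarrow> (b - t')\<^sup>2 * A t \<le> (b - t)\<^sup>2 * A t'"
    and cone_a: "\<And>t t'. t \<le> t' \<Longrightarrow> a \<le> t \<Longrightarrow> (t - a)\<^sup>2 * A t' \<le> (t' - a)\<^sup>2 * A t"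
    and A_integral: "(A has_integral 4 * pi / 3) {a..b}"
    and A_cont: "continuous_on {a<..<b} A"
    and S_cont: "continuous_on {-1..1} S" and S_ends: "S (-1) = a" "S 1 = b"
    and S_deriv: "\<And>s. -1 < s \<Longrightarrow> s < 1 \<Longrightarrow> (S has_real_derivative S' s) (at s)"
    and S_range: "\<And>s. -1 < s \<Longrightarrow> s < 1 \<Longrightarrow> a < S s \<and> S s < b"
    and S'_cont: "continuous_on {-1<..<1} S'"
    and S'_pos: "\<And>s. -1 < s \<Longrightarrow> s < 1 \<Longrightarrow> S' s > 0"
    and A_S': "\<And>s. -1 < s \<Longrightarrow> s < 1 \<Longrightarrow> A (S s) * S' s = pi * (1 - s\<^sup>2)"
    and mass: "\<And>s. s \<in> {-1..1} \<Longrightarrow> integral {a..S s} A = integral {-1..s} (\<lambda>x. pi * (1 - x\<^sup>2))"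

lemma profile_exists:
  fixes K :: "(real \<times> (real \<times> real)) set"
  assumes K: "compact K" "convex K" and vol: "measure lborel K = 4 * pi / 3"
  obtains a b S S' where "profile (slice_area K) S S' a b" "fst ` K = {a..b}"
proof -
  have pos: "measure lborel K > 0" unfolding vol by simp
  obtain a b where ab: "a < b" "fst ` K = {a..b}"
    and A: "\<And>t. a < t \<Longrightarrow> t < b \<Longrightarrow> slice_area K t > 0"
      "continuous_on {a<..<b} (slice_area K)"
    and cb: "\<And>t t'. t \<le> t' \<Longrightarrow> t' \<le> b \<Longrightarrow> (b - t') ^ DIM(real \<times> real) * slice_area K t \<le> (b - t) ^ DIM(real \<times> real) * slice_area K t'"
    and ca: "\<And>t t'. t \<le> t' \<Longrightarrow> a \<le> t \<Longrightarrow> (t - a) ^ DIM(real \<times> real) * slice_area K t' \<le> (t' - a) ^ DIM(real \<times> real) * slice_area K t"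
    and AI: "slice_area K integrable_on {a..b}" "integral {a..b} (slice_area K) = measure lborel K"
    by (rule slice_area_props[OF K pos]) blast
  define g where "g s = pi * (1 - s\<^sup>2)" for s :: real
  have gI: "(g has_integral 4 * pi / 3) {-1..1}"
    unfolding g_def using has_integral_disc_area[of "-1" 1] by (simp add: algebra_simps)
  have gp: "g s > 0" if "-1 < s" "s < 1" for s
    using that by (simp add: g_def abs_square_less_1 abs_less_iff)
  have gc: "continuous_on {-1<..<1} g"
    unfolding g_def by (intro continuous_intros)
  have geq: "integral {a..b} (slice_area K) = integral {-1..1} g"
    using AI gI vol by (simp add: integral_unique)
  obtain S where S: "continuous_on {-1..1} S" "S (-1) = a" "S 1 = b"
    "\<And>s. s \<in> {-1..1} \<Longrightarrow> S s \<in> {a..b} \<and> integral {a..S s} (slice_area K) = integral {-1..s} g"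
    "\<And>s. -1 < s \<Longrightarrow> s < 1 \<Longrightarrow> a < S s \<and> S s < b \<and> (S has_real_derivative g s / slice_area K (S s)) (at s)"
    by (rule transport_exists[OF ab(1) _ AI(1) A(2,1) has_integral_integrable[OF gI] gc gp geq]) (auto intro: that)
  define S' where "S' s = g s / slice_area K (S s)" for s
  have AS: "slice_area K (S s) > 0" if "-1 < s" "s < 1" for s using S(5)[OF that] A by auto
  have cS': "continuous_on {-1<..<1} S'"
    unfolding S'_def
  proof (intro continuous_on_divide gc continuous_on_compose2[OF A(2)])
    show "continuous_on {-1<..<1} S" by (rule continuous_on_subset[OF S(1)]) auto
    show "S ` {-1<..<1} \<subseteq> {a<..<b}" using S(5) by auto
    show "\<forall>s\<in>{-1<..<1}. slice_area K (S s) \<noteq> 0" using AS by force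
  qed
  have dim: "DIM(real \<times> real) = 2" by simp
  have "profile (slice_area K) S S' a b"
  proof
    show "(b - t')\<^sup>2 * slice_area K t \<le> (b - t)\<^sup>2 * slice_area K t'" if "t \<le> t'" "t' \<le> b" for t t'
      using cb[OF that] by (simp only: dim)
    show "(t - a)\<^sup>2 * slice_area K t' \<le> (t' - a)\<^sup>2 * slice_area K t" if "t \<le> t'" "a \<le> t" for t t'
      using ca[OF that] by (simp only: dim)
    show "(slice_area K has_integral 4 * pi / 3) {a..b}" using AI vol by (simp add: has_integral_iff)
    show "(S has_real_derivative S' s) (at s)" if "-1 < s" "s < 1" for s using S(5)[OF that] by (simp add: S'_def)
    show "S' s > 0" if "-1 < s" "s < 1" for s using AS[OF that] gp[OF that] by (simp add: S'_def)
    show "slice_area K (S s) * S' s = pi * (1 - s\<^sup>2)" if "-1 < s" "s < 1" for s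
      using AS[OF that] by (simp add: S'_def g_def)
    show "integral {a..S s} (slice_area K) = integral {-1..s} (\<lambda>x. pi * (1 - x\<^sup>2))" if "s \<in> {-1..1}" for s
      using S(4)[OF that] by (simp add: g_def[abs_def])
  qed (use ab A S cS' in \<open>auto simp: slice_area_nonneg\<close>)
  then show ?thesis using that ab(2) by blast
qed

lemma volume_growth_aux:
  fixes y e :: real
  assumes "y > 0" "e \<ge> 0"
  shows "1 + e * (3 + Psi (y\<^sup>2)) \<le> (1 / y + e)\<^sup>2 * (y\<^sup>2 + e)"
proof -
  have "(1 / y + e)\<^sup>2 * (y\<^sup>2 + e) = 1 + e * (3 + Psi (y\<^sup>2)) + (e\<^sup>2 * y\<^sup>2 + 2 * e\<^sup>2 / y + e ^ 3)"
    using assms by (simp add: Psi_def field_simps power2_eq_square power3_eq_cube)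
  moreover have "e\<^sup>2 * y\<^sup>2 + 2 * e\<^sup>2 / y + e ^ 3 \<ge> 0" using assms by auto
  ultimately show ?thesis by linarith
qed

text \<open>With \<open>y = sqrt (S' s)\<close> the section at \<open>S s\<close> has the area of a
  disc of radius \<open>sqrt (1 - s\<^sup>2) / y\<close>. Planar Brunn-Minkowski and the height
  factor \<open>S' s + e\<close> give the integrand
  \<open>pi * (1 - s\<^sup>2) * (1 / y + e)\<^sup>2 * (y\<^sup>2 + e)\<close>, of which only the
  terms of order 0 and 1 in \<open>e\<close> are kept.\<close>

lemma parallel_volume_ge_energy:
  fixes K :: "(real \<times> (real \<times> real)) set"
  assumes K: "compact K" "convex K" and vol: "measure lborel K = 4 * pi / 3"
    and prof: "profile (slice_area K) S S' a b" and cd: "-1 < c" "c \<le> d" "d < 1" and e: "e > 0"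
  shows "measure lborel K + e * (4 * pi + integral {c..d} (\<lambda>s. pi * (1 - s\<^sup>2) * Psi (S' s)))
       \<le> measure lborel (parallel_set K e)"
proof -
  interpret profile "slice_area K" S S' a b by fact
  have sq: "1 - s\<^sup>2 > 0" if "-1 < s" "s < 1" for s :: real
    using that by (simp add: abs_square_less_1 abs_less_iff)
  have A: "slice_area K (S s) > 0" if "-1 < s" "s < 1" for s using S_range[OF that] A_pos by auto
  have cPsi: "continuous_on {-1<..<1} (\<lambda>s. Psi (S' s))"
    unfolding Psi_def using S'_cont S'_pos by (intro continuous_intros) force+
  define w where "w s = pi * (1 - s\<^sup>2) * Psi (S' s)" for s
  have cw: "continuous_on {-1<..<1} w" unfolding w_def by (intro continuous_intros cPsi)
  \<comment> \<open>The energy density is kept only on \<open>{c..d}\<close>, where it is continuous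
    and hence integrable; elsewhere it is dropped as \<open>Psi\<close> is nonnegative.\<close>
  define H where "H s = pi * (1 - s\<^sup>2) * (1 + 3 * e) + e * (if s \<in> {c..d} then w s else 0)" for s
  have wI: "((\<lambda>s. if s \<in> {c..d} then w s else 0) has_integral integral {c..d} w) {-1..1}"
  proof -
    have "w integrable_on {c..d}"
      using cd by (intro integrable_continuous_interval continuous_on_subset[OF cw]) auto
    then have "(w has_integral integral {c..d} w) {c..d}" by (simp add: integrable_integral)
    then show ?thesis using cd by (subst has_integral_restrict) auto
  qed
  have HI: "(H has_integral 4 * pi / 3 * (1 + 3 * e) + e * integral {c..d} w) {-1..1}"
    unfolding H_def
  proof (intro has_integral_add has_integral_mult_left has_integral_mult_right wI)
    show "((\<lambda>s. pi * (1 - s\<^sup>2)) has_integral 4 * pi / 3) {-1..1}"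
      using has_integral_disc_area[of "-1" 1] by (simp add: algebra_simps)
  qed
  have "integral {-1..1} H \<le> measure lborel (parallel_set K e)"
  proof (rule parallel_volume_ge_slices[OF K(1) _ _ S_deriv S'_cont])
    show "K \<noteq> {}" using vol by auto
    show "e \<ge> 0" using e by simp
    show "S' s \<ge> 0" if "-1 < s" "s < 1" for s using S'_pos[OF that] by simp
    show "H integrable_on {-1..1}" using HI by auto
    show "(\<lambda>s. indicator {-1<..<1} s *\<^sub>R H s) \<in> borel_measurable borel"
    proof -
      have [measurable]: "(\<lambda>s. indicator {c..d} s *\<^sub>R w s) \<in> borel_measurable borel"
        using cd by (intro borel_measurable_continuous_on_indicator continuous_on_subset[OF cw]) auto
      have Heq: "H = (\<lambda>s. pi * (1 - s\<^sup>2) * (1 + 3 * e) + e * (indicator {c..d} s *\<^sub>R w s))"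
        by (auto simp: H_def indicator_def fun_eq_iff)
      have [measurable]: "H \<in> borel_measurable borel" unfolding Heq by measurable
      show ?thesis by measurable
    qed
    fix s :: real assume s: "-1 < s" "s < 1"
    have P0: "Psi (S' s) \<ge> 0" by (rule Psi_nonneg[OF S'_pos[OF s]])
    show "H s \<ge> 0" using sq[OF s] P0 e by (auto simp: H_def w_def)
    have ne: "slice K (S s) \<noteq> {}" using A[OF s] by (auto simp: slice_area_def)
    define y where "y = sqrt (S' s)"
    have y: "y > 0" "y\<^sup>2 = S' s" using S'_pos[OF s] by (simp_all add: y_def)
    have Aeq: "slice_area K (S s) = pi * (1 - s\<^sup>2) / y\<^sup>2"
      using A_S'[OF s] S'_pos[OF s] by (simp add: y(2) field_simps)
    have "H s \<le> pi * (1 - s\<^sup>2) * (1 + 3 * e) + e * w s"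
      using e P0 sq[OF s] by (simp add: H_def w_def)
    also have "\<dots> = pi * (1 - s\<^sup>2) * (1 + e * (3 + Psi (y\<^sup>2)))"
      by (simp add: w_def y(2) algebra_simps)
    also have "\<dots> \<le> pi * (1 - s\<^sup>2) * ((1 / y + e)\<^sup>2 * (y\<^sup>2 + e))"
      using sq[OF s] e y by (intro mult_left_mono volume_growth_aux) auto
    also have "\<dots> = (sqrt (slice_area K (S s)) + sqrt pi * (e * sqrt (1 - s\<^sup>2)))\<^sup>2 * (S' s + e)"
    proof -
      have "sqrt (slice_area K (S s)) + sqrt pi * (e * sqrt (1 - s\<^sup>2)) = sqrt (pi * (1 - s\<^sup>2)) * (1 / y + e)"
      proof -
        have "sqrt (slice_area K (S s)) = sqrt (pi * (1 - s\<^sup>2)) / y"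
          unfolding Aeq real_sqrt_divide using y(1) by simp
        then show ?thesis unfolding real_sqrt_mult by (simp add: ring_distribs)
      qed
      then show ?thesis using sq[OF s] by (simp add: power_mult_distrib y(2))
    qed
    also have "\<dots> \<le> measure lborel (parallel_set (slice K (S s)) (e * sqrt (1 - s\<^sup>2))) * (S' s + e)"
      using brunn_minkowski_disc[OF slice_compact[OF K(1)] convex_slice[OF K(2)], of "S s" "e * sqrt (1 - s\<^sup>2)"]
        A[OF s] S'_pos[OF s] e sq[OF s]
      by (intro mult_right_mono) (auto simp: slice_area_def)
    finally show "slice K (S s) \<noteq> {} \<and> H s \<le> measure lborel (parallel_set (slice K (S s)) (e * sqrt (1 - s\<^sup>2))) * (S' s + e)"
      using ne by simp
  qed
  moreover have "integral {-1..1} H = measure lborel K + e * (4 * pi + integral {c..d} w)"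
    using HI vol by (simp add: integral_unique algebra_simps)
  ultimately show ?thesis by (simp add: w_def[abs_def])
qed

section \<open>The one-dimensional stability problem\<close>

context profile
begin

text \<open>Estimates proved for the right end \<open>b\<close> or for \<open>s \<ge> 0\<close>
  carry over to the other side by this symmetry.\<close>

lemma reflect: "profile (\<lambda>t. A (- t)) (\<lambda>s. - S (- s)) (\<lambda>s. S' (- s)) (- b) (- a)"
proof
  show "- b < - a" using ab by simp
  show "A (- t) > 0" if "- b < t" "t < - a" for t using that by (intro A_pos) auto
  show "A (- t) \<ge> 0" for t by (rule A_nonneg)
  show "(- a - t')\<^sup>2 * A (- t) \<le> (- a - t)\<^sup>2 * A (- t')" if "t \<le> t'" "t' \<le> - a" for t t'
    using cone_a[of "- t'" "- t"] that
    by (simp add: minus_diff_commute)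
  show "(t - - b)\<^sup>2 * A (- t') \<le> (t' - - b)\<^sup>2 * A (- t)" if "t \<le> t'" "- b \<le> t" for t t'
    using cone_b[of "- t'" "- t"] that by (simp add: add.commute)
  show AI: "((\<lambda>t. A (- t)) has_integral 4 * pi / 3) {- b..- a}"
    using A_integral has_integral_reflect_real[of A "4 * pi / 3" a b] ab by simp
  show "continuous_on {- b<..<- a} (\<lambda>t. A (- t))"
    by (intro continuous_on_compose2[OF A_cont] continuous_intros) auto
  show "continuous_on {-1..1} (\<lambda>s. - S (- s))"
    by (intro continuous_on_compose2[OF S_cont] continuous_intros) auto
  show "- S (- (-1)) = - b" "- S (- 1) = - a" using S_ends by simp_all
  show "((\<lambda>s. - S (- s)) has_real_derivative S' (- s)) (at s)" if "-1 < s" "s < 1" for s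
    using that by (auto intro!: derivative_eq_intros DERIV_chain2[OF S_deriv])
  show "- b < - S (- s) \<and> - S (- s) < - a" if "-1 < s" "s < 1" for s using S_range[of "- s"] that by auto
  show "continuous_on {-1<..<1} (\<lambda>s. S' (- s))"
    by (intro continuous_on_compose2[OF S'_cont] continuous_intros) auto
  show "S' (- s) > 0" if "-1 < s" "s < 1" for s using S'_pos[of "- s"] that by auto
  show "A (- (- S (- s))) * S' (- s) = pi * (1 - s\<^sup>2)" if "-1 < s" "s < 1" for s
    using A_S'[of "- s"] that by simp
  fix s :: real assume s: "s \<in> {-1..1}"
  have Sr: "S (- s) \<in> {a..b}"
    using S_range[of "- s"] S_ends ab s by (cases "s = 1 \<or> s = -1") force+
  have "integral {- b..- S (- s)} (\<lambda>t. A (- t)) = integral {S (- s)..b} A"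
    using Henstock_Kurzweil_Integration.integral_reflect_real[of b "S (- s)" A] by simp
  also have "\<dots> = 4 * pi / 3 - integral {a..S (- s)} A"
  proof -
    have "integral {a..S (- s)} A + integral {S (- s)..b} A = integral {a..b} A"
      using Sr A_integral by (intro Henstock_Kurzweil_Integration.integral_combine) auto
    then show ?thesis using A_integral by (simp add: integral_unique)
  qed
  also have "integral {a..S (- s)} A = integral {-1..- s} (\<lambda>x. pi * (1 - x\<^sup>2))"
    using mass[of "- s"] s by simp
  also have "4 * pi / 3 - \<dots> = integral {-1..s} (\<lambda>x. pi * (1 - x\<^sup>2))"
    using s has_integral_disc_area[of "-1" s] has_integral_disc_area[of "-1" "- s"]
    by (simp add: integral_unique algebra_simps)
  finally show "integral {- b..- S (- s)} (\<lambda>t. A (- t)) = integral {-1..s} (\<lambda>x. pi * (1 - x\<^sup>2))" .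
qed

lemma S_mono: "S s \<le> S s'" if "-1 \<le> s" "s \<le> s'" "s' \<le> 1"
proof (rule DERIV_nonneg_imp_increasing_open[OF that(2)])
  show "\<exists>y. (S has_real_derivative y) (at x) \<and> 0 \<le> y" if "s < x" "x < s'" for x
    using S_deriv[of x] S'_pos[of x] that \<open>-1 \<le> s\<close> \<open>s' \<le> 1\<close> by (intro exI[of _ "S' x"]) auto
  show "continuous_on {s..s'} S" using that by (intro continuous_on_subset[OF S_cont]) auto
qed

text \<open>To the right of \<open>t\<close> the sections dominate those of a cone over the section
  at \<open>t\<close> with apex at height \<open>b\<close>.\<close>

lemma cone_mass:
  assumes t: "a < t" "t < b"
  shows "A t * (b - t) / 3 \<le> integral {t..b} A"
proof -
  have hi: "((\<lambda>x. A t / (b - t)\<^sup>2 * (b - x)\<^sup>2) has_integral A t / (b - t)\<^sup>2 * ((b - t) ^ 3 / 3)) {t..b}"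
  proof (rule has_integral_mult_right)
    have "((\<lambda>x. (b - x)\<^sup>2) has_integral (- ((b - b) ^ 3 / 3) - - ((b - t) ^ 3 / 3))) {t..b}"
      using t by (intro fundamental_theorem_of_calculus)
        (auto intro!: derivative_eq_intros simp: has_real_derivative_iff_has_vector_derivative[symmetric])
    then show "((\<lambda>x. (b - x)\<^sup>2) has_integral (b - t) ^ 3 / 3) {t..b}" by simp
  qed
  have "A t / (b - t)\<^sup>2 * ((b - t) ^ 3 / 3) \<le> integral {t..b} A"
  proof (rule has_integral_le[OF hi integrable_integral])
    show "A integrable_on {t..b}"
      using t by (intro integrable_on_subinterval[OF has_integral_integrable[OF A_integral]]) auto
    show "A t / (b - t)\<^sup>2 * (b - x)\<^sup>2 \<le> A x" if "x \<in> {t..b}" for x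
      using cone_b[of t x] that t by (simp add: field_simps)
  qed
  then show ?thesis using t by (simp add: power2_eq_square power3_eq_cube)
qed

text \<open>The right-hand side is the volume of the cap of height \<open>1 - s\<close> of the unit
  ball.\<close>

lemma mass_right:
  assumes "s \<in> {-1..1}"
  shows "integral {S s..b} A = pi * (1 - s)\<^sup>2 * (2 + s) / 3"
proof -
  have Sr: "S s \<in> {a..b}" using S_mono[of "-1" s] S_mono[of s 1] S_ends assms by auto
  have "integral {a..S s} A + integral {S s..b} A = integral {a..b} A"
    using Sr A_integral by (intro Henstock_Kurzweil_Integration.integral_combine) auto
  then have "integral {S s..b} A = 4 * pi / 3 - integral {-1..s} (\<lambda>x. pi * (1 - x\<^sup>2))"
    using mass[OF assms] A_integral by (simp add: integral_unique)
  also have "integral {-1..s} (\<lambda>x. pi * (1 - x\<^sup>2)) = pi * (s - s ^ 3 / 3 + 2 / 3)"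
    using integral_unique[OF has_integral_disc_area[of "-1" s]] assms by simp
  finally show ?thesis by (simp add: field_simps power2_eq_square power3_eq_cube)
qed

text \<open>The cone over the section at \<open>S s\<close> has at most the volume of the
  transported cap. Replacing the section area by \<open>pi * (1 - s\<^sup>2) / S' s\<close> leaves
  \<open>(2 + s) / (1 + s)\<close>, which is at most 2 for \<open>s \<ge> 0\<close>.\<close>

lemma tip_length:
  assumes "0 \<le> s" "s < 1"
  shows "b - S s \<le> 2 * (1 - s) * S' s"
proof -
  have s: "-1 < s" "s < 1" using assms by auto
  have "A (S s) * (b - S s) \<le> pi * (1 - s)\<^sup>2 * (2 + s)"
    using cone_mass[of "S s"] S_range[OF s] mass_right[of s] s by simp
  then have "S' s * (A (S s) * (b - S s)) \<le> S' s * (pi * (1 - s)\<^sup>2 * (2 + s))"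
    using S'_pos[OF s] by (intro mult_left_mono) auto
  moreover have "S' s * (A (S s) * (b - S s)) = pi * (1 - s\<^sup>2) * (b - S s)"
    by (simp only: A_S'[OF s, symmetric] mult_ac)
  ultimately have "(pi * (1 - s)) * ((1 + s) * (b - S s)) \<le> (pi * (1 - s)) * ((1 - s) * (2 + s) * S' s)"
    by (simp add: power2_eq_square algebra_simps)
  then have "(1 + s) * (b - S s) \<le> (1 - s) * (2 + s) * S' s"
    using s by (simp add: mult_le_cancel_left)
  also have "\<dots> \<le> (1 - s) * (2 * (1 + s)) * S' s"
    using assms S'_pos[OF s] by (intro mult_right_mono mult_left_mono) auto
  also have "\<dots> = (1 + s) * (2 * (1 - s) * S' s)" by (simp add: algebra_simps)
  finally show ?thesis using assms by (simp add: mult_le_cancel_left)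
qed

end

text \<open>The two cones over the section at \<open>t\<close> towards both ends have total volume
  \<open>A t * (b - a) / 3\<close>, at most that of the body.\<close>

lemma (in profile) A_upper: "A t \<le> 4 * pi / (b - a)" if "a < t" "t < b"
proof -
  interpret R: profile "\<lambda>t. A (- t)" "\<lambda>s. - S (- s)" "\<lambda>s. S' (- s)" "- b" "- a" by (rule reflect)
  have "A t * (t - a) / 3 \<le> integral {- t..- a} (\<lambda>t. A (- t))"
    using R.cone_mass[of "- t"] that by simp
  also have "\<dots> = integral {a..t} A"
    using Henstock_Kurzweil_Integration.integral_reflect_real[of t a A] by simp
  finally have "A t * (t - a) / 3 + A t * (b - t) / 3 \<le> integral {a..t} A + integral {t..b} A"
    using cone_mass[OF that] by simp
  also have "\<dots> = 4 * pi / 3"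
    using that A_integral
    by (subst Henstock_Kurzweil_Integration.integral_combine) (auto simp: integral_unique)
  finally have "A t * (b - a) \<le> 4 * pi" by (simp add: field_simps)
  then show ?thesis using ab by (simp add: field_simps)
qed

text \<open>Half of the mass lies to the left of \<open>S 0\<close>, and \<open>A_upper\<close>
  limits how densely it can be packed there.\<close>

lemma (in profile) S_zero_lower: "(b - a) / 6 \<le> S 0 - a"
proof -
  have r: "a < S 0" "S 0 < b" using S_range[of 0] by auto
  have "2 * pi / 3 = integral {a..S 0} A"
    using mass[of 0] integral_unique[OF has_integral_disc_area[of "-1" 0]] by simp
  also have "\<dots> = integral {a<..<S 0} A" by (simp add: integral_open_interval_real)
  also have "\<dots> \<le> integral {a<..<S 0} (\<lambda>_. 4 * pi / (b - a))"
  proof (rule integral_le)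
    have "A integrable_on {a..S 0}"
      using r by (intro integrable_on_subinterval[OF has_integral_integrable[OF A_integral]]) auto
    then show "A integrable_on {a<..<S 0}" by (simp add: integrable_on_Icc_iff_Ioo)
    have "(\<lambda>_. 4 * pi / (b - a)) integrable_on {a..S 0}" by (rule integrable_const_ivl)
    then show "(\<lambda>_. 4 * pi / (b - a)) integrable_on {a<..<S 0}" by (simp add: integrable_on_Icc_iff_Ioo)
  qed (use A_upper r in auto)
  also have "\<dots> = integral {a..S 0} (\<lambda>_. 4 * pi / (b - a))" by (rule integral_open_interval_real[symmetric])
  also have "\<dots> = (S 0 - a) * (4 * pi / (b - a))" using r by simp
  finally have "2 * pi * (b - a) \<le> (S 0 - a) * (4 * pi) * 3" using ab by (simp add: field_simps)
  then have "pi * (b - a) \<le> pi * (6 * (S 0 - a))" by (simp add: algebra_simps)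
  then show ?thesis by simp
qed

text \<open>Up to the factor \<open>pi\<close>, \<open>S' s / (1 - s\<^sup>2)\<close> is the
  reciprocal section area. By the cone inequality at \<open>a\<close>, areas grow at most like the
  squared distance from \<open>a\<close>, which here ranges between \<open>(b - a) / 6\<close> and
  \<open>b - a\<close>; hence the factor 36.\<close>

lemma (in profile) S'_doubling:
  assumes "0 \<le> s1" "s1 \<le> s" "s < 1"
  shows "S' s1 * (1 - s\<^sup>2) \<le> 36 * (1 - s1\<^sup>2) * S' s"
proof -
  have s: "-1 < s" "s < 1" "-1 < s1" "s1 < 1" using assms by auto
  have r: "a < S s" "S s < b" "a < S s1" "S s1 < b" using S_range s by auto
  have le: "S s1 \<le> S s" "S 0 \<le> S s1" using assms by (intro S_mono; simp)+
  have A1: "A (S s1) > 0" "A (S s) > 0" using A_pos r by auto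
  have "((b - a) / 6)\<^sup>2 * A (S s) \<le> (S s1 - a)\<^sup>2 * A (S s)"
    using S_zero_lower le A1 ab by (intro mult_right_mono power_mono) auto
  also have "\<dots> \<le> (S s - a)\<^sup>2 * A (S s1)" using cone_a[OF le(1)] r by simp
  also have "\<dots> \<le> (b - a)\<^sup>2 * A (S s1)"
    using r A1 by (intro mult_right_mono power_mono) auto
  finally have "(b - a)\<^sup>2 * A (S s) \<le> (b - a)\<^sup>2 * (36 * A (S s1))" by (simp add: power_divide)
  then have A36: "A (S s) \<le> 36 * A (S s1)" using ab by simp
  have "A (S s1) * A (S s) * (S' s1 * (1 - s\<^sup>2)) = (A (S s1) * S' s1) * (1 - s\<^sup>2) * A (S s)" by simp
  also have "\<dots> = pi * (1 - s1\<^sup>2) * (1 - s\<^sup>2) * A (S s)" using A_S'[OF s(3,4)] by simp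
  also have "\<dots> \<le> pi * (1 - s1\<^sup>2) * (1 - s\<^sup>2) * (36 * A (S s1))"
    using A36 s by (intro mult_left_mono) (auto simp: abs_square_le_1)
  also have "\<dots> = (1 - s1\<^sup>2) * (A (S s) * S' s) * (36 * A (S s1))"
    using A_S'[OF s(1,2)] by simp
  also have "\<dots> = A (S s1) * A (S s) * (36 * (1 - s1\<^sup>2) * S' s)" by simp
  finally show ?thesis using A1 by (simp add: mult_le_cancel_left)
qed

text \<open>For \<open>y = sqrt x\<close> the claim reduces to
  \<open>2 * y\<^sup>2 * (y + 1)\<^sup>2 \<le> 3 * (2 * y + 1)\<close>, valid up to
  \<open>y = 21 / 20\<close>. The Taylor coefficient of \<open>Psi\<close> at 1 is 3/4; lowering it
  to 2/3 buys an interval to the right of 1 and is the source of the final constant 3/2.\<close>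

lemma Psi_ge_quadratic:
  assumes "0 < x" "x \<le> 441 / 400"
  shows "2 / 3 * (x - 1)\<^sup>2 \<le> Psi x"
proof -
  define y where "y = sqrt x"
  have y: "y > 0" "x = y\<^sup>2" using assms by (simp_all add: y_def)
  have "y \<le> 21 / 20"
  proof (rule power2_le_imp_le)
    show "y\<^sup>2 \<le> (21 / 20)\<^sup>2" using assms(2) y(2) by (simp add: power2_eq_square)
  qed simp
  have "2 * y\<^sup>2 * (y + 1)\<^sup>2 \<le> 3 * (2 * y + 1)"
  proof -
    have y2: "y * y \<le> 21 / 20 * y" using y \<open>y \<le> 21 / 20\<close> by (intro mult_right_mono) auto
    then have y3: "y * (y * y) \<le> y * (21 / 20 * y)" using y by (intro mult_left_mono) auto
    then have y4: "y * (y * (y * y)) \<le> y * (y * (21 / 20 * y))" using y by (intro mult_left_mono) auto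
    have "2 * y\<^sup>2 * (y + 1)\<^sup>2 = 2 * (y * (y * (y * y))) + 4 * (y * (y * y)) + 2 * (y * y)"
      by (simp add: power2_eq_square algebra_simps)
    also have "\<dots> \<le> 3 * (2 * y + 1)"
      using y2 y3 y4 \<open>y \<le> 21 / 20\<close> by (simp add: algebra_simps)
    finally show ?thesis .
  qed
  then have "(y - 1)\<^sup>2 * (2 * y\<^sup>2 * (y + 1)\<^sup>2) \<le> (y - 1)\<^sup>2 * (3 * (2 * y + 1))"
    by (intro mult_left_mono) auto
  moreover have "(y - 1)\<^sup>2 * (2 * y\<^sup>2 * (y + 1)\<^sup>2) = 2 * y\<^sup>2 * (x - 1)\<^sup>2"
    unfolding y(2) by (simp add: power2_eq_square algebra_simps)
  ultimately show ?thesis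
    using y(1) unfolding y(2) Psi_sqrt[OF y(1)] by (simp add: field_simps)
qed

text \<open>The range continues \<open>Psi_ge_quadratic\<close> up to the bound of
  \<open>S'_upper\<close>; in terms of \<open>y = sqrt x\<close> it lies between 21/20 and 17, where
  the quadratic \<open>(y - 21 / 20) * (17 - y)\<close> has a sign.\<close>

lemma Psi_ge_linear:
  assumes "441 / 400 \<le> x" "x \<le> 288"
  shows "x - 1 \<le> 23 * Psi x"
proof -
  define y where "y = sqrt x"
  have y: "x = y\<^sup>2" using assms by (simp add: y_def)
  have lo: "21 / 20 \<le> y" unfolding y_def using assms by (intro real_le_rsqrt) (simp add: power2_eq_square)
  have hi: "y \<le> 17" unfolding y_def using assms by (intro real_le_lsqrt) auto
  have "(y - 21 / 20) * (17 - y) \<ge> 0" using lo hi by simp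
  then have q: "y\<^sup>2 \<le> 23 * (y - 1)" using lo hi by (simp add: power2_eq_square algebra_simps) argo
  have "y\<^sup>2 * (y + 1) \<le> 23 * (y - 1) * (2 * y + 1)"
    using q lo by (intro mult_mono) auto
  then have "(y - 1) * (y\<^sup>2 * (y + 1)) \<le> (y - 1) * (23 * (y - 1) * (2 * y + 1))"
    using lo by (intro mult_left_mono) auto
  then have "(y\<^sup>2 - 1) * y\<^sup>2 \<le> 23 * ((y - 1)\<^sup>2 * (2 * y + 1))"
    by (simp add: power2_eq_square algebra_simps)
  then show ?thesis
    using lo unfolding y by (subst Psi_sqrt) (auto simp: field_simps)
qed

text \<open>Young's inequality on the region where \<open>Psi\<close> is quadratic; beyond it \<open>Psi\<close> dominates linearly.\<close>

lemma Psi_young: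
  assumes x: "0 < x" "x \<le> 288" and w: "w > 0" and \<theta>: "\<theta> > 0"
  shows "\<bar>x - 1\<bar> \<le> 3 / 4 * \<theta> * (w * Psi x) + 1 / (2 * \<theta>) * (1 / w) + 23 * Psi x"
proof -
  have P: "Psi x \<ge> 0" by (rule Psi_nonneg[OF x(1)])
  have t1: "0 \<le> 3 / 4 * \<theta> * (w * Psi x)" "0 \<le> 1 / (2 * \<theta>) * (1 / w)" using P w \<theta> by auto
  show ?thesis
  proof (cases "x \<le> 441 / 400")
    case True
    have "0 \<le> (\<theta> * w * \<bar>x - 1\<bar> - 1)\<^sup>2" by simp
    then have "2 * (\<theta> * w) * \<bar>x - 1\<bar> \<le> (\<theta> * w)\<^sup>2 * (x - 1)\<^sup>2 + 1"
      by (simp add: power2_diff power_mult_distrib)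
    then have "\<bar>x - 1\<bar> \<le> ((\<theta> * w)\<^sup>2 * (x - 1)\<^sup>2 + 1) / (2 * (\<theta> * w))"
      using w \<theta> by (simp add: pos_le_divide_eq mult.commute)
    also have "\<dots> = \<theta> * w / 2 * (x - 1)\<^sup>2 + 1 / (2 * \<theta>) * (1 / w)"
      using w \<theta> by (simp add: field_simps power2_eq_square)
    also have "\<theta> * w / 2 * (x - 1)\<^sup>2 \<le> \<theta> * w / 2 * (3 / 2 * Psi x)"
      using Psi_ge_quadratic[OF x(1) True] w \<theta> by (intro mult_left_mono) auto
    finally show ?thesis using P by (simp add: algebra_simps)
  next
    case False
    then have "\<bar>x - 1\<bar> = x - 1" "x - 1 \<le> 23 * Psi x" using Psi_ge_linear[of x] x by simp_all
    then show ?thesis using t1 by linarith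
  qed
qed

lemma Psi_ge_1: "1 \<le> Psi x" if "4 \<le> x"
proof -
  define y where "y = sqrt x"
  have x: "x = y\<^sup>2" using that by (simp add: y_def)
  have y: "2 \<le> y" unfolding y_def using that by (intro real_le_rsqrt) simp
  have "y / 2 \<le> y - 1" using y by simp
  then have "(y / 2)\<^sup>2 \<le> (y - 1)\<^sup>2" using y by (intro power_mono) auto
  then have "(y / 2)\<^sup>2 * 4 \<le> (y - 1)\<^sup>2 * (2 * y + 1)" using y by (intro mult_mono) auto
  then show ?thesis unfolding x using y by (subst Psi_sqrt) (auto simp: field_simps)
qed

text \<open>The energy bound is the perimeter excess \<open>4 * pi * \<delta>\<close> divided by the
  factor \<open>pi\<close> in front of the energy. The smallness \<open>25 * \<delta> < 1\<close>
  makes the cut point \<open>1 - 5 * sqrt \<delta>\<close> positive.\<close>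

locale near_profile = profile +
  fixes \<delta> :: real
  assumes \<delta>: "\<delta> > 0" "25 * \<delta> < 1"
    and energy: "\<And>c d. -1 < c \<Longrightarrow> c \<le> d \<Longrightarrow> d < 1 \<Longrightarrow>
      integral {c..d} (\<lambda>s. (1 - s\<^sup>2) * Psi (S' s)) \<le> 4 * \<delta>"
begin

lemma sq_pos: "-1 < s \<Longrightarrow> s < 1 \<Longrightarrow> 1 - s\<^sup>2 > (0::real)"
  by (simp add: abs_square_less_1 abs_less_iff)

lemma Psi_S'_cont: "continuous_on {-1<..<1} (\<lambda>s. Psi (S' s))"
  unfolding Psi_def using S'_cont S'_pos by (intro continuous_intros) force+

lemma energy_integrable:
  assumes "-1 < c" "d < 1"
  shows "(\<lambda>s. Psi (S' s)) integrable_on {c..d}" "(\<lambda>s. (1 - s\<^sup>2) * Psi (S' s)) integrable_on {c..d}"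
  using assms by (auto intro!: integrable_continuous_interval continuous_intros continuous_on_subset[OF Psi_S'_cont])

text \<open>Otherwise \<open>S'\<close> is at least 4, hence \<open>Psi\<close> at least 1, on the
  first half of the interval from \<open>s\<close> to 1, and the energy exceeds
  \<open>4 * \<delta>\<close>. The bound is \<open>288 = 36 * 2 * 4\<close>: the doubling factor,
  the loss in \<open>1 - x\<^sup>2\<close> over the half interval, and the threshold of
  \<open>Psi_ge_1\<close>.\<close>

lemma S'_upper:
  assumes s: "0 \<le> s" "1 - s > 4 * sqrt \<delta>"
  shows "S' s \<le> 288"
proof (rule ccontr)
  assume "\<not> S' s \<le> 288"
  then have big: "S' s > 288" by simp
  have s1: "s < 1" using s(2) \<delta> real_sqrt_ge_zero[of \<delta>] by linarith
  define d where "d = (1 + s) / 2"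
  have d: "s \<le> d" "d < 1" using s s1 by (auto simp: d_def)
  have low: "(1 - s) / 2 \<le> (1 - x\<^sup>2) * Psi (S' x)" if x: "x \<in> {s..d}" for x
  proof -
    have x1: "0 \<le> x" "x < 1" "s \<le> x" using x d s by auto
    have "1 - x\<^sup>2 = (1 - x) * (1 + x)" by (simp add: power2_eq_square algebra_simps)
    also have "\<dots> \<ge> ((1 - s) / 2) * (1 + s)"
      using x s by (intro mult_mono) (auto simp: d_def)
    finally have r: "(1 - s\<^sup>2) / 2 \<le> 1 - x\<^sup>2" by (simp add: power2_eq_square algebra_simps)
    have q: "1 - s\<^sup>2 > 0" using sq_pos[of s] s s1 by auto
    have "288 * ((1 - s\<^sup>2) / 2) \<le> S' s * (1 - x\<^sup>2)" using big r q by (intro mult_mono) auto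
    also have "\<dots> \<le> 36 * (1 - s\<^sup>2) * S' x" using S'_doubling[OF s(1) x1(3,2)] .
    finally have "(36 * (1 - s\<^sup>2)) * 4 \<le> (36 * (1 - s\<^sup>2)) * S' x" by simp
    then have "4 \<le> S' x" using q by (subst (asm) mult_le_cancel_left_pos) auto
    then have "1 \<le> Psi (S' x)" by (rule Psi_ge_1)
    moreover have "(1 - s) / 2 \<le> 1 - x\<^sup>2"
    proof -
      have "x * x \<le> x * 1" using x1 by (intro mult_left_mono) auto
      moreover have "(1 - s) / 2 \<le> 1 - x" using x by (simp add: d_def field_simps)
      ultimately show ?thesis by (simp add: power2_eq_square)
    qed
    ultimately have "(1 - s) / 2 * 1 \<le> (1 - x\<^sup>2) * Psi (S' x)"
      using s1 by (intro mult_mono) auto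
    then show ?thesis by simp
  qed
  have "(1 - s) / 2 * (d - s) = integral {s..d} (\<lambda>x. (1 - s) / 2)" using d by simp
  also have "\<dots> \<le> integral {s..d} (\<lambda>x. (1 - x\<^sup>2) * Psi (S' x))"
    using s d by (intro integral_le energy_integrable low) auto
  also have "\<dots> \<le> 4 * \<delta>" using s d by (intro energy) auto
  finally have le: "(1 - s) / 2 * (d - s) \<le> 4 * \<delta>" .
  have "d - s = (1 - s) / 2" by (simp add: d_def field_simps)
  then have "(1 - s) / 2 * (d - s) = (1 - s)\<^sup>2 / 4" by (simp add: power2_eq_square)
  moreover have "(4 * sqrt \<delta>)\<^sup>2 = 16 * \<delta>" using \<delta> by (simp add: power_mult_distrib)
  ultimately have "(1 - s)\<^sup>2 \<le> (4 * sqrt \<delta>)\<^sup>2" using le by linarith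
  then have "1 - s \<le> 4 * sqrt \<delta>" by (rule power2_le_imp_le) (use \<delta> in simp)
  with s(2) show False by linarith
qed

text \<open>\<open>Psi_young\<close> with weight \<open>1 - x\<^sup>2\<close> is integrated. Its
  three terms produce the energy, the logarithm as integral of \<open>1 / (1 - x\<^sup>2)\<close>,
  and the unweighted integral of \<open>Psi\<close>, which costs a factor
  \<open>1 / (1 - s)\<close>. The parameter \<open>\<theta>\<close> stays free since two different
  choices are made below.\<close>

lemma displacement_bound:
  assumes s: "0 \<le> s" "1 - s > 4 * sqrt \<delta>" and \<theta>: "\<theta> > 0"
  shows "\<bar>S s - s - S 0\<bar> \<le> 3 * \<theta> * \<delta> + ln (2 / (1 - s)) / (4 * \<theta>) + 92 * \<delta> / (1 - s)"
proof -
  have s1: "s < 1" using s(2) \<delta> real_sqrt_ge_zero[of \<delta>] by linarith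
  have cS': "continuous_on {0..s} S'" using s1 by (intro continuous_on_subset[OF S'_cont]) auto
  have hi: "((\<lambda>x. S' x - 1) has_integral (S s - s - (S 0 - 0))) {0..s}"
  proof (rule fundamental_theorem_of_calculus[OF s(1)])
    fix x assume "x \<in> {0..s}"
    then have "((\<lambda>x. S x - x) has_real_derivative S' x - 1) (at x)"
      using s1 by (intro derivative_intros S_deriv) auto
    then show "((\<lambda>x. S x - x) has_vector_derivative S' x - 1) (at x within {0..s})"
      by (simp add: has_real_derivative_iff_has_vector_derivative has_vector_derivative_at_within)
  qed
  define E where "E = integral {0..s} (\<lambda>x. (1 - x\<^sup>2) * Psi (S' x))"
  have E: "E \<le> 4 * \<delta>" unfolding E_def using s s1 by (intro energy) auto
  have EI: "((\<lambda>x. (1 - x\<^sup>2) * Psi (S' x)) has_integral E) {0..s}"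
    unfolding E_def using s1 by (intro integrable_integral energy_integrable) auto
  have LI: "((\<lambda>x. 1 / (1 - x\<^sup>2)) has_integral (ln ((1 + s) / (1 - s)) / 2)) {0..s}"
  proof -
    have "((\<lambda>x. 1 / (1 - x\<^sup>2)) has_integral ((ln (1 + s) - ln (1 - s)) / 2 - (ln (1 + 0) - ln (1 - 0)) / 2)) {0..s}"
    proof (rule fundamental_theorem_of_calculus[OF s(1)])
      fix x assume x: "x \<in> {0..s}"
      then have x1: "1 + x > 0" "1 - x > 0" using s1 by auto
      have "((\<lambda>x. (ln (1 + x) - ln (1 - x)) / 2) has_real_derivative (1 / (1 + x) + 1 / (1 - x)) / 2) (at x)"
      proof -
        have l1: "((\<lambda>x. ln (1 + x)) has_real_derivative 1 / (1 + x)) (at x)"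
          by (rule derivative_eq_intros refl x1 | simp)+
        have l2: "((\<lambda>x. ln (1 - x)) has_real_derivative - (1 / (1 - x))) (at x)"
          by (rule derivative_eq_intros refl x1 | simp)+
        from DERIV_cdivide[OF DERIV_diff[OF l1 l2], of 2] show ?thesis by simp
      qed
      moreover have "(1 / (1 + x) + 1 / (1 - x)) / 2 = 1 / (1 - x\<^sup>2)"
      proof -
        have "1 - x\<^sup>2 = (1 + x) * (1 - x)" by (simp add: power2_eq_square algebra_simps)
        then show ?thesis using x1 by (simp add: add_frac_eq)
      qed
      ultimately show "((\<lambda>x. (ln (1 + x) - ln (1 - x)) / 2) has_vector_derivative 1 / (1 - x\<^sup>2)) (at x within {0..s})"
        by (simp add: has_real_derivative_iff_has_vector_derivative has_vector_derivative_at_within)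
    qed
    then show ?thesis using s s1 by (simp add: ln_div)
  qed
  define Q where "Q = integral {0..s} (\<lambda>x. Psi (S' x))"
  have QI: "((\<lambda>x. Psi (S' x)) has_integral Q) {0..s}"
    unfolding Q_def using s1 by (intro integrable_integral energy_integrable) auto
  have Q: "(1 - s) * Q \<le> E"
  proof (rule has_integral_le[OF has_integral_mult_right[OF QI] EI])
    fix x assume x: "x \<in> {0..s}"
    have "x * x \<le> x * 1" using x s1 by (intro mult_left_mono) auto
    then have "1 - s \<le> 1 - x\<^sup>2" using x by (simp add: power2_eq_square)
    moreover have "Psi (S' x) \<ge> 0" using x s1 by (intro Psi_nonneg S'_pos) auto
    ultimately show "(1 - s) * Psi (S' x) \<le> (1 - x\<^sup>2) * Psi (S' x)" by (rule mult_right_mono)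
  qed
  have "\<bar>S s - s - S 0\<bar> = norm (integral {0..s} (\<lambda>x. S' x - 1))"
    using hi by (simp add: integral_unique)
  also have "\<dots> \<le> 3 / 4 * \<theta> * E + 1 / (2 * \<theta>) * (ln ((1 + s) / (1 - s)) / 2) + 23 * Q"
  proof -
    have B: "((\<lambda>x. 3 / 4 * \<theta> * ((1 - x\<^sup>2) * Psi (S' x)) + 1 / (2 * \<theta>) * (1 / (1 - x\<^sup>2)) + 23 * Psi (S' x))
       has_integral (3 / 4 * \<theta> * E + 1 / (2 * \<theta>) * (ln ((1 + s) / (1 - s)) / 2) + 23 * Q)) {0..s}"
      by (intro has_integral_add has_integral_mult_right EI LI QI)
    have "norm (integral {0..s} (\<lambda>x. S' x - 1)) \<le> integral {0..s} (\<lambda>x. 3 / 4 * \<theta> * ((1 - x\<^sup>2) * Psi (S' x)) + 1 / (2 * \<theta>) * (1 / (1 - x\<^sup>2)) + 23 * Psi (S' x))"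
    proof (rule Henstock_Kurzweil_Integration.integral_norm_bound_integral)
      show "(\<lambda>x. S' x - 1) integrable_on {0..s}" using hi by auto
      show "(\<lambda>x. 3 / 4 * \<theta> * ((1 - x\<^sup>2) * Psi (S' x)) + 1 / (2 * \<theta>) * (1 / (1 - x\<^sup>2)) + 23 * Psi (S' x)) integrable_on {0..s}"
        using B by (rule has_integral_integrable)
      fix x assume x: "x \<in> {0..s}"
      show "norm (S' x - 1) \<le> 3 / 4 * \<theta> * ((1 - x\<^sup>2) * Psi (S' x)) + 1 / (2 * \<theta>) * (1 / (1 - x\<^sup>2)) + 23 * Psi (S' x)"
        unfolding real_norm_def using x s s1 \<theta>
        by (intro Psi_young S'_pos S'_upper sq_pos) auto
    qed
    then show ?thesis using B by (simp add: integral_unique)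
  qed
  also have "\<dots> \<le> 3 * \<theta> * \<delta> + ln (2 / (1 - s)) / (4 * \<theta>) + 92 * \<delta> / (1 - s)"
  proof -
    have "3 / 4 * \<theta> * E \<le> 3 / 4 * \<theta> * (4 * \<delta>)" using E \<theta> by (intro mult_left_mono) auto
    moreover have "ln ((1 + s) / (1 - s)) \<le> ln (2 / (1 - s))"
      using s s1 by (intro ln_mono divide_right_mono) auto
    then have "1 / (2 * \<theta>) * (ln ((1 + s) / (1 - s)) / 2) \<le> 1 / (2 * \<theta>) * (ln (2 / (1 - s)) / 2)"
      using \<theta> by (intro mult_left_mono) auto
    moreover have "Q \<le> 4 * \<delta> / (1 - s)" using Q E s1 by (simp add: pos_le_divide_eq mult.commute)
    moreover have "1 / (2 * \<theta>) * (ln (2 / (1 - s)) / 2) = ln (2 / (1 - s)) / (4 * \<theta>)" by simp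
    moreover have "23 * (4 * \<delta> / (1 - s)) = 92 * \<delta> / (1 - s)" by simp
    ultimately show ?thesis by linarith
  qed
  finally show ?thesis .
qed

end

text \<open>Change of variables along \<open>S\<close>, carried out with the antiderivative of
  \<open>t * A t\<close>. It expresses the centroid condition on the body in terms of
  \<open>S\<close>.\<close>

lemma (in profile) S_moment:
  "((\<lambda>s. pi * (1 - s\<^sup>2) * S s) has_integral integral {a..b} (\<lambda>t. t * A t)) {-1..1}"
proof -
  define \<Phi> where "\<Phi> u = integral {a..u} (\<lambda>t. t * A t)" for u
  have int: "(\<lambda>t. t * A t) integrable_on {a..b}"
  proof -
    have "A absolutely_integrable_on {a..b}"
      using A_integral A_nonneg by (intro nonnegative_absolutely_integrable_1) auto
    then have "(\<lambda>t. t *\<^sub>R A t) absolutely_integrable_on {a..b}"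
      by (intro absolutely_integrable_bounded_measurable_product_real[where f = "\<lambda>t. t", unfolded real_scaleR_def[symmetric]]
          integrable_imp_measurable integrable_continuous_interval continuous_intros compact_imp_bounded compact_continuous_image) auto
    then show ?thesis by (simp add: set_lebesgue_integral_eq_integral)
  qed
  have c\<Phi>: "continuous_on {a..b} \<Phi>"
    unfolding \<Phi>_def by (rule indefinite_integral_continuous_1[OF int])
  have d\<Phi>: "(\<Phi> has_real_derivative u * A u) (at u)" if u: "a < u" "u < b" for u
  proof -
    have "continuous_on {a<..<b} (\<lambda>t. t * A t)" by (intro continuous_intros A_cont)
    then have ct: "continuous (at u within {a..b}) (\<lambda>t. t * A t)"
      using u by (simp add: continuous_on_eq_continuous_at continuous_at_imp_continuous_at_within)
    have "(\<Phi> has_vector_derivative u * A u) (at u within {a..b})"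
      unfolding \<Phi>_def using integral_has_vector_derivative_continuous_at[OF int, of u "{}"] u ct by auto
    then show ?thesis
      using u by (simp add: has_real_derivative_iff_has_vector_derivative at_within_Icc_at)
  qed
  have "((\<lambda>s. pi * (1 - s\<^sup>2) * S s) has_integral \<Phi> (S 1) - \<Phi> (S (-1))) {-1..1}"
  proof (rule fundamental_theorem_of_calculus_interior)
    show "continuous_on {-1..1} (\<lambda>s. \<Phi> (S s))"
    proof (rule continuous_on_compose2[OF c\<Phi> S_cont])
      show "S ` {-1..1} \<subseteq> {a..b}"
        using S_mono[of "-1"] S_mono[of _ 1] S_ends by auto
    qed
    fix s :: real assume "s \<in> {-1<..<1}"
    then have s: "-1 < s" "s < 1" by auto
    have "((\<lambda>s. \<Phi> (S s)) has_real_derivative S s * A (S s) * S' s) (at s)"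
      using S_range[OF s] by (intro DERIV_chain2[OF d\<Phi> S_deriv[OF s]]) auto
    also have "S s * A (S s) * S' s = pi * (1 - s\<^sup>2) * S s"
      by (simp only: A_S'[OF s, symmetric] mult_ac)
    finally show "((\<lambda>s. \<Phi> (S s)) has_vector_derivative pi * (1 - s\<^sup>2) * S s) (at s)"
      by (simp add: has_real_derivative_iff_has_vector_derivative)
  qed auto
  then show ?thesis by (simp add: S_ends \<Phi>_def)
qed

text \<open>A wide body has small sections by \<open>A_upper\<close>, which forces
  \<open>S' s \<ge> (1 - s\<^sup>2) * (b - a) / 4\<close>. On the middle half of the interval the
  term \<open>2 * sqrt x\<close> of \<open>Psi\<close> then makes the energy large. The factor 3/16
  is lowered to 9/64 to have a rational square root.\<close>

lemma (in profile) width_le_energy: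
  assumes energy: "integral {-1/2..1/2} (\<lambda>s. (1 - s\<^sup>2) * Psi (S' s)) \<le> 4 * \<delta>"
  shows "sqrt (b - a) \<le> 8 * (1 + \<delta>)"
proof -
  have cP: "continuous_on {-1<..<1} (\<lambda>s. Psi (S' s))"
    unfolding Psi_def using S'_cont S'_pos by (intro continuous_intros) force+
  have "integral {-1/2..1/2::real} (\<lambda>s. 3 / 4 * (2 * (3 / 8 * sqrt (b - a))) - 3)
      \<le> integral {-1/2..1/2} (\<lambda>s. (1 - s\<^sup>2) * Psi (S' s))"
  proof (rule integral_le)
    show "(\<lambda>s. (1 - s\<^sup>2) * Psi (S' s)) integrable_on {-1/2..1/2}"
      by (intro integrable_continuous_interval continuous_intros continuous_on_subset[OF cP]) auto
    fix s :: real assume s: "s \<in> {-1/2..1/2}"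
    then have s': "-1 < s" "s < 1" by auto
    have "\<bar>s\<bar> \<le> 1 / 2" using s by auto
    then have "\<bar>s\<bar>\<^sup>2 \<le> (1 / 2)\<^sup>2" by (intro power_mono) auto
    then have w: "3 / 4 \<le> 1 - s\<^sup>2" by (simp add: power_divide)
    have w1: "1 - s\<^sup>2 \<le> 1" by simp
    have "(3 / 8)\<^sup>2 * (b - a) \<le> S' s"
    proof -
      have "pi * (1 - s\<^sup>2) * (b - a) = A (S s) * (b - a) * S' s" using A_S'[OF s'] by simp
      also have "A (S s) * (b - a) \<le> 4 * pi"
        using A_upper[of "S s"] S_range[OF s'] ab by (simp add: pos_le_divide_eq)
      then have "A (S s) * (b - a) * S' s \<le> 4 * pi * S' s"
        using S'_pos[OF s'] by (intro mult_right_mono) auto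
      finally have "pi * ((1 - s\<^sup>2) * (b - a)) \<le> pi * (4 * S' s)" by (simp add: mult_ac)
      then have "(1 - s\<^sup>2) * (b - a) \<le> 4 * S' s" by simp
      moreover have "3 / 4 * (b - a) \<le> (1 - s\<^sup>2) * (b - a)" using w ab by (intro mult_right_mono) auto
      ultimately have "3 / 16 * (b - a) \<le> S' s" by simp
      moreover have "(3 / 8)\<^sup>2 * (b - a) \<le> 3 / 16 * (b - a)" using ab by (intro mult_right_mono) (auto simp: power_divide)
      ultimately show ?thesis by linarith
    qed
    then have "sqrt ((3 / 8)\<^sup>2 * (b - a)) \<le> sqrt (S' s)" by (rule real_sqrt_le_mono)
    then have q: "3 / 8 * sqrt (b - a) \<le> sqrt (S' s)" by (simp add: real_sqrt_mult)
    have "3 / 4 * (2 * (3 / 8 * sqrt (b - a))) - 3 \<le> (1 - s\<^sup>2) * (2 * sqrt (S' s)) - (1 - s\<^sup>2) * 3"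
      using q w w1 ab by (intro diff_mono mult_mono) auto
    also have "\<dots> = (1 - s\<^sup>2) * (2 * sqrt (S' s) - 3)" by (simp add: right_diff_distrib)
    also have "\<dots> \<le> (1 - s\<^sup>2) * Psi (S' s)"
      using w S'_pos[OF s'] by (intro mult_left_mono) (auto simp: Psi_def)
    finally show "3 / 4 * (2 * (3 / 8 * sqrt (b - a))) - 3 \<le> (1 - s\<^sup>2) * Psi (S' s)" .
  qed auto
  with energy have "9 / 16 * sqrt (b - a) - 3 \<le> 4 * \<delta>" by simp
  moreover obtain q where "sqrt (b - a) = q" "q \<ge> 0" using ab by simp
  ultimately show ?thesis by simp
qed

context near_profile
begin

lemma near_reflect: "near_profile (\<lambda>t. A (- t)) (\<lambda>s. - S (- s)) (\<lambda>s. S' (- s)) (- b) (- a) \<delta>"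
proof (rule near_profile.intro[OF reflect], unfold_locales)
  show "0 < \<delta>" "25 * \<delta> < 1" by (rule \<delta>)+
  fix c d :: real assume cd: "-1 < c" "c \<le> d" "d < 1"
  have "integral {c..d} (\<lambda>s. (1 - s\<^sup>2) * Psi (S' (- s))) = integral {- d..- c} (\<lambda>s. (1 - s\<^sup>2) * Psi (S' s))"
    using Henstock_Kurzweil_Integration.integral_reflect_real[of "-c" "-d" "\<lambda>s. (1 - s\<^sup>2) * Psi (S' s)"] by simp
  also have "\<dots> \<le> 4 * \<delta>" using cd by (intro energy) auto
  finally show "integral {c..d} (\<lambda>s. (1 - s\<^sup>2) * Psi (S' (- s))) \<le> 4 * \<delta>" .
qed

lemma sqrt_\<delta>: "0 < sqrt \<delta>" "5 * sqrt \<delta> < 1" "\<delta> = sqrt \<delta> * sqrt \<delta>"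
proof -
  show "0 < sqrt \<delta>" using \<delta> by simp
  have "sqrt (25 * \<delta>) < sqrt 1" using \<delta> by (intro real_sqrt_less_mono) auto
  moreover have "sqrt (25 * \<delta>) = 5 * sqrt \<delta>"
    using real_sqrt_mult[of 25 \<delta>] real_sqrt_unique[of 5 25] by simp
  ultimately show "5 * sqrt \<delta> < 1" by simp
  show "\<delta> = sqrt \<delta> * sqrt \<delta>" using \<delta> by simp
qed

text \<open>At the cut point \<open>S'_upper\<close> applies, since 5 exceeds its threshold 4, and
  \<open>tip_length\<close> gives \<open>2 * 5 * 288\<close>.\<close>

lemma tip_bound: "0 \<le> b - S (1 - 5 * sqrt \<delta>)" "b - S (1 - 5 * sqrt \<delta>) \<le> 2880 * sqrt \<delta>"
proof -
  define s1 where "s1 = 1 - 5 * sqrt \<delta>"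
  have s1: "0 \<le> s1" "s1 < 1" "1 - s1 > 4 * sqrt \<delta>" using sqrt_\<delta> by (auto simp: s1_def)
  have "0 \<le> b - S s1" using S_mono[of s1 1] s1 S_ends by simp
  then show "0 \<le> b - S (1 - 5 * sqrt \<delta>)" by (simp add: s1_def)
  have "b - S s1 \<le> 2 * (1 - s1) * S' s1" by (rule tip_length) (use s1 in auto)
  also have "\<dots> \<le> 2 * (1 - s1) * 288" using S'_upper[OF s1(1,3)] s1 by (intro mult_left_mono) auto
  finally show "b - S (1 - 5 * sqrt \<delta>) \<le> 2880 * sqrt \<delta>" by (simp add: s1_def)
qed

text \<open>With \<open>\<theta> = 1 / sqrt \<delta>\<close> and the crude bound
  \<open>ln x \<le> x\<close>, the logarithm is traded for the factor \<open>1 / (1 - s)\<close>,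
  which the weight \<open>1 - s\<^sup>2\<close> later absorbs.\<close>

lemma displacement_bound_sqrt:
  assumes s: "0 \<le> s" "s \<le> 1 - 5 * sqrt \<delta>"
  shows "\<bar>S s - s - S 0\<bar> \<le> 3 * sqrt \<delta> + sqrt \<delta> / (2 * (1 - s)) + 92 * \<delta> / (1 - s)"
proof -
  have s1: "1 - s > 4 * sqrt \<delta>" "1 - s > 0" using s sqrt_\<delta> by linarith+
  have "\<bar>S s - s - S 0\<bar> \<le> 3 * (1 / sqrt \<delta>) * \<delta> + ln (2 / (1 - s)) / (4 * (1 / sqrt \<delta>)) + 92 * \<delta> / (1 - s)"
    using displacement_bound[OF s(1) s1(1), of "1 / sqrt \<delta>"] sqrt_\<delta> by simp
  moreover have "3 * (1 / sqrt \<delta>) * \<delta> = 3 * sqrt \<delta>"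
    using sqrt_\<delta> real_div_sqrt[of \<delta>] \<delta> by simp
  moreover have "ln (2 / (1 - s)) / (4 * (1 / sqrt \<delta>)) \<le> sqrt \<delta> / (2 * (1 - s))"
  proof -
    have "ln (2 / (1 - s)) \<le> 2 / (1 - s)" using less_imp_le[OF ln_less_self[of "2 / (1 - s)"]] s1 by simp
    then have "ln (2 / (1 - s)) * (sqrt \<delta> / 4) \<le> 2 / (1 - s) * (sqrt \<delta> / 4)"
      using sqrt_\<delta> by (intro mult_right_mono) auto
    then show ?thesis by (simp add: mult.commute)
  qed
  ultimately show ?thesis by linarith
qed

text \<open>Up to the cut point the weight cancels the factor \<open>1 / (1 - s)\<close>. Beyond it
  the displacement is merely bounded, but the weight is of order
  \<open>sqrt \<delta>\<close>.\<close>

lemma weighted_displacement: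
  assumes s: "0 \<le> s" "s \<le> 1"
  shows "(1 - s\<^sup>2) * \<bar>S s - s - S 0\<bar> \<le> 6000 * sqrt \<delta>"
proof -
  have w: "1 - s\<^sup>2 \<le> 2 * (1 - s)" "0 \<le> 1 - s\<^sup>2"
  proof -
    have "1 - s\<^sup>2 = (1 + s) * (1 - s)" by (simp add: power2_eq_square algebra_simps)
    also have "\<dots> \<le> 2 * (1 - s)" using s by (intro mult_right_mono) auto
    finally show "1 - s\<^sup>2 \<le> 2 * (1 - s)" .
    show "0 \<le> 1 - s\<^sup>2" using s by (simp add: abs_square_le_1)
  qed
  have \<delta>r: "\<delta> \<le> sqrt \<delta>" "92 * \<delta> \<le> 92 / 5 * sqrt \<delta>"
    using sqrt_\<delta> mult_right_mono[of "sqrt \<delta>" "1 / 5" "sqrt \<delta>"] by auto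
  show ?thesis
  proof (cases "s \<le> 1 - 5 * sqrt \<delta>")
    case True
    then have s1: "1 - s > 0" using sqrt_\<delta> by linarith
    have "(1 - s\<^sup>2) * \<bar>S s - s - S 0\<bar> \<le> 2 * (1 - s) * (3 * sqrt \<delta> + sqrt \<delta> / (2 * (1 - s)) + 92 * \<delta> / (1 - s))"
      using displacement_bound_sqrt[OF s(1) True] w s1 by (intro mult_mono) auto
    also have "\<dots> = (1 - s) * (6 * sqrt \<delta>) + sqrt \<delta> + 184 * \<delta>"
    proof -
      have "2 * t * (3 * r + r / (2 * t) + 92 * d / t) = t * (6 * r) + r + 184 * d" if "t > 0" for t r d :: real
        using that by (simp add: field_simps)
      from this[OF s1] show ?thesis .
    qed
    also have "\<dots> \<le> 1 * (6 * sqrt \<delta>) + sqrt \<delta> + 184 * sqrt \<delta>"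
      using s sqrt_\<delta> \<delta>r by (intro add_mono mult_right_mono) auto
    also have "\<dots> \<le> 6000 * sqrt \<delta>" using sqrt_\<delta> by simp
    finally show ?thesis .
  next
    case False
    define s1 where "s1 = 1 - 5 * sqrt \<delta>"
    have s1: "0 \<le> s1" "s1 \<le> s" "1 - s1 = 5 * sqrt \<delta>" using sqrt_\<delta> False by (auto simp: s1_def)
    have "\<bar>S s1 - s1 - S 0\<bar> \<le> 3 * sqrt \<delta> + sqrt \<delta> / (2 * (5 * sqrt \<delta>)) + 92 * \<delta> / (5 * sqrt \<delta>)"
      using displacement_bound_sqrt[of s1] s1 by (simp add: s1_def)
    also have "92 * \<delta> / (5 * sqrt \<delta>) = 92 / 5 * sqrt \<delta>"
      using real_div_sqrt[of \<delta>] \<delta> by simp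
    also have "sqrt \<delta> / (2 * (5 * sqrt \<delta>)) = 1 / 10" using sqrt_\<delta> by simp
    finally have 1: "\<bar>S s1 - s1 - S 0\<bar> \<le> 5" using sqrt_\<delta> by linarith
    \<comment> \<open>Monotonicity confines \<open>S s\<close> between \<open>S s1\<close> and
      \<open>b\<close>; the constant 582 is 5 for the displacement at \<open>s1\<close>, 576 for the
      tip and 1 for \<open>s - s1\<close>.\<close>
    have 2: "S s1 \<le> S s" "S s \<le> b" using S_mono[of s1 s] S_mono[of s 1] s s1 S_ends by auto
    have 3: "b - S s1 \<le> 576" using tip_bound(2) sqrt_\<delta> by (simp add: s1_def)
    have "\<bar>S s - s - S 0\<bar> \<le> 582" using 1 2 3 s s1 by linarith
    then have "(1 - s\<^sup>2) * \<bar>S s - s - S 0\<bar> \<le> (2 * (5 * sqrt \<delta>)) * 582"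
      using w s1 \<delta> by (intro mult_mono) auto
    also have "\<dots> \<le> 6000 * sqrt \<delta>" using sqrt_\<delta>(1) by simp
    finally show ?thesis .
  qed
qed

lemma end_bound_aux:
  "\<bar>b - 1\<bar> \<le> \<bar>S 0\<bar> + sqrt (3 / 2 * \<delta> * ln (1 / \<delta>)) + 3000 * sqrt \<delta>"
proof -
  define s1 where "s1 = 1 - 5 * sqrt \<delta>"
  have s1: "0 \<le> s1" "1 - s1 = 5 * sqrt \<delta>" "1 - s1 > 4 * sqrt \<delta>" using sqrt_\<delta> by (auto simp: s1_def)
  define L where "L = ln (1 / \<delta>)"
  have d1: "\<delta> < 1" using \<delta> by simp
  have L: "L > 0" unfolding L_def using \<delta> d1 by (intro ln_gt_zero) auto
  \<comment> \<open>The minimizer of \<open>3 * \<theta> * \<delta> + L / (8 * \<theta>)\<close>,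
    which bounds the leading terms: cutting at distance \<open>5 * sqrt \<delta>\<close> reduces the
    logarithm to \<open>L / 2\<close>.\<close>
  define \<theta> where "\<theta> = sqrt (L / (24 * \<delta>))"
  have \<theta>: "\<theta> > 0" using L \<delta> by (simp add: \<theta>_def)
  have "\<bar>S s1 - s1 - S 0\<bar> \<le> 3 * \<theta> * \<delta> + ln (2 / (5 * sqrt \<delta>)) / (4 * \<theta>) + 92 * \<delta> / (5 * sqrt \<delta>)"
    using displacement_bound[OF s1(1,3) \<theta>] s1 by simp
  also have "92 * \<delta> / (5 * sqrt \<delta>) = 92 / 5 * sqrt \<delta>"
    using real_div_sqrt[of \<delta>] \<delta> by simp
  also have "ln (2 / (5 * sqrt \<delta>)) \<le> L / 2"
  proof -
    have "ln (2 / (5 * sqrt \<delta>)) \<le> ln (1 / sqrt \<delta>)" using sqrt_\<delta> by (intro ln_mono) (auto simp: field_simps)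
    also have "\<dots> = L / 2" using \<delta> by (simp add: L_def ln_div ln_sqrt)
    finally show ?thesis .
  qed
  then have "ln (2 / (5 * sqrt \<delta>)) / (4 * \<theta>) \<le> L / 2 / (4 * \<theta>)" using \<theta> by (intro divide_right_mono) auto
  finally have "\<bar>S s1 - s1 - S 0\<bar> \<le> (3 * \<theta> * \<delta> + L / (8 * \<theta>)) + 92 / 5 * sqrt \<delta>" by simp
  moreover have "3 * \<theta> * \<delta> + L / (8 * \<theta>) = sqrt (3 / 2 * \<delta> * L)"
  proof -
    have t2: "\<theta> * \<theta> = L / (24 * \<delta>)" using L \<delta> by (simp add: \<theta>_def)
    have e: "L / (8 * \<theta>) = 3 * \<theta> * \<delta>"
    proof -
      have "3 * \<theta> * \<delta> * (8 * \<theta>) = L" using t2 \<delta> by (simp add: field_simps)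
      then show ?thesis using \<theta> by (simp add: divide_eq_eq)
    qed
    have "(6 * \<theta> * \<delta>)\<^sup>2 = 3 / 2 * \<delta> * L"
    proof -
      have "(6 * \<theta> * \<delta>)\<^sup>2 = 36 * \<delta> * \<delta> * (\<theta> * \<theta>)" by (simp add: power2_eq_square)
      then show ?thesis unfolding t2 using \<delta> by (simp add: field_simps)
    qed
    then have "sqrt (3 / 2 * \<delta> * L) = 6 * \<theta> * \<delta>" using \<theta> \<delta> by (intro real_sqrt_unique) auto
    then show ?thesis using e by simp
  qed
  moreover note tip_bound[folded s1_def]
  ultimately show ?thesis using s1 sqrt_\<delta> unfolding L_def by linarith
qed

end

text \<open>The centroid condition controls \<open>S 0\<close>. With weight
  \<open>1 - s\<^sup>2\<close> the integral of \<open>S s\<close> vanishes, that of \<open>s\<close>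
  vanishes by oddness, and the weight has mass 4/3, so \<open>S 0\<close> is minus the weighted mean
  of \<open>S s - s - S 0\<close>. Integrating \<open>weighted_displacement\<close> over length 2
  gives \<open>\<bar>S 0\<bar> \<le> 9000 * sqrt \<delta>\<close>.\<close>

lemma (in near_profile) end_bound:
  assumes centroid: "integral {a..b} (\<lambda>t. t * A t) = 0"
  shows "\<bar>b - 1\<bar> \<le> sqrt (3 / 2 * \<delta> * ln (1 / \<delta>)) + 12000 * sqrt \<delta>"
proof -
  interpret R: near_profile "\<lambda>t. A (- t)" "\<lambda>s. - S (- s)" "\<lambda>s. S' (- s)" "- b" "- a" \<delta> by (rule near_reflect)
  have wd: "(1 - s\<^sup>2) * \<bar>S s - s - S 0\<bar> \<le> 6000 * sqrt \<delta>" if "s \<in> {-1..1}" for s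
  proof (cases "s \<ge> 0")
    case True
    then show ?thesis using weighted_displacement[of s] that by auto
  next
    case False
    then have "(1 - (- s)\<^sup>2) * \<bar>- S (- (- s)) - (- s) - - S (- 0)\<bar> \<le> 6000 * sqrt \<delta>"
      using R.weighted_displacement[of "- s"] that by auto
    moreover have "\<bar>- S s + s + S 0\<bar> = \<bar>S s - s - S 0\<bar>" by linarith
    ultimately show ?thesis by simp
  qed
  have I0: "((\<lambda>s. (1 - s\<^sup>2) * S s) has_integral 0) {-1..1}"
  proof -
    have "((\<lambda>s. 1 / pi * (pi * (1 - s\<^sup>2) * S s)) has_integral 1 / pi * 0) {-1..1}"
      using has_integral_mult_right[OF S_moment, of "1 / pi"] by (simp add: centroid)
    then show ?thesis by simp
  qed
  have I1: "((\<lambda>s::real. (1 - s\<^sup>2) * s) has_integral 0) {-1..1}"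
  proof -
    have "((\<lambda>s::real. (1 - s\<^sup>2) * s) has_integral ((1\<^sup>2 / 2 - 1 ^ 4 / 4) - ((-1)\<^sup>2 / 2 - (-1) ^ 4 / 4))) {-1..1}"
    proof (rule fundamental_theorem_of_calculus)
      fix x :: real
      have "((\<lambda>s. s\<^sup>2 / 2 - s ^ 4 / 4) has_real_derivative (1 - x\<^sup>2) * x) (at x within {-1..1})"
        by (auto intro!: derivative_eq_intros simp: algebra_simps power2_eq_square power3_eq_cube)
      then show "((\<lambda>s. s\<^sup>2 / 2 - s ^ 4 / 4) has_vector_derivative (1 - x\<^sup>2) * x) (at x within {-1..1})"
        by (simp add: has_real_derivative_iff_has_vector_derivative)
    qed simp
    then show ?thesis by simp
  qed
  have I2: "((\<lambda>s. (1 - s\<^sup>2) * S 0) has_integral 4 / 3 * S 0) {-1..1}"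
  proof -
    have "((\<lambda>s. 1 / pi * (pi * (1 - s\<^sup>2)) * S 0) has_integral 1 / pi * (pi * (1 - 1 ^ 3 / 3 - (-1 - (-1) ^ 3 / 3))) * S 0) {-1..1}"
      by (intro has_integral_mult_left has_integral_mult_right has_integral_disc_area) simp
    then show ?thesis by simp
  qed
  have "((\<lambda>s. (1 - s\<^sup>2) * S s - (1 - s\<^sup>2) * s - (1 - s\<^sup>2) * S 0) has_integral 0 - 0 - 4 / 3 * S 0) {-1..1}"
    by (intro has_integral_diff I0 I1 I2)
  then have I: "((\<lambda>s. (1 - s\<^sup>2) * (S s - s - S 0)) has_integral - (4 / 3 * S 0)) {-1..1}"
    by (simp add: right_diff_distrib)
  have "norm (- (4 / 3 * S 0)) \<le> 6000 * sqrt \<delta> * measure lborel (cbox (-1) (1::real))"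
  proof (rule has_integral_bound[OF _ I[folded cbox_interval]])
    show "0 \<le> 6000 * sqrt \<delta>" using sqrt_\<delta> by simp
    show "norm ((1 - s\<^sup>2) * (S s - s - S 0)) \<le> 6000 * sqrt \<delta>" if "s \<in> cbox (-1) 1" for s
      using wd[of s] that by (auto simp: abs_mult abs_square_le_1)
  qed
  then have "\<bar>S 0\<bar> \<le> 9000 * sqrt \<delta>" by simp
  with end_bound_aux show ?thesis using sqrt_\<delta> by linarith
qed

section \<open>Reduction to one dimension\<close>

lemma lborel_distr_orthogonal:
  fixes T :: "real ^ 'n::{finite,wellorder} \<Rightarrow> real ^ 'n::_"
  assumes T: "orthogonal_transformation T"
  shows "distr lborel borel T = lborel"
proof (rule lborel_eqI[symmetric])
  have [measurable]: "T \<in> borel_measurable borel"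
    using T by (intro borel_measurable_continuous_onI linear_continuous_on)
      (simp add: linear_linear orthogonal_transformation_linear)
  show "sets (distr lborel borel T) = sets borel" by simp
  fix l u :: "real ^ 'n::_" assume lu: "\<And>b. b \<in> Basis \<Longrightarrow> l \<bullet> b \<le> u \<bullet> b"
  have bij: "bij T" by (rule orthogonal_transformation_bij[OF T])
  have inv: "orthogonal_transformation (inv T)" by (rule orthogonal_transformation_inv[OF T])
  have lm: "box l u \<in> lmeasurable" by simp
  have "emeasure (distr lborel borel T) (box l u) = emeasure lborel (T -` box l u)"
    by (subst emeasure_distr) auto
  also have "\<dots> = emeasure lebesgue (T -` box l u)"
    using measurable_sets[of T borel borel "box l u"] by simp
  also have "T -` box l u = inv T ` box l u" by (rule bij_vimage_eq_inv_image[OF bij])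
  also have "emeasure lebesgue (inv T ` box l u) = ennreal (measure lebesgue (inv T ` box l u))"
    using measurable_orthogonal_image[OF inv lm] by (simp add: emeasure_eq_measure2)
  also have "measure lebesgue (inv T ` box l u) = measure lborel (box l u)"
    using measure_orthogonal_image[OF inv lm] by simp
  also have "ennreal \<dots> = (\<Prod>b\<in>Basis. (u - l) \<bullet> b)"
    using lu by (simp add: measure_lborel_box_eq)
  finally show "emeasure (distr lborel borel T) (box l u) = (\<Prod>b\<in>Basis. (u - l) \<bullet> b)" .
qed

text \<open>Slices are defined on a product type, where Fubini's theorem applies directly; this
  isometry brings bodies of \<open>real ^ 3\<close> there.\<close>

definition coords :: "real ^ 3 \<Rightarrow> real \<times> (real \<times> real)" where
  "coords x = (x $ 1, x $ 2, x $ 3)"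

lemma Basis_triple: "(Basis :: (real \<times> (real \<times> real)) set) = {(1, 0, 0), (0, 1, 0), (0, 0, 1)}"
  by (auto simp: Basis_prod_def zero_prod_def)

lemma prod_Basis_triple: "(\<Prod>b\<in>Basis. z \<bullet> b) = fst z * (fst (snd z) * snd (snd z))" for z :: "real \<times> (real \<times> real)"
  unfolding Basis_triple by (cases z) (simp add: inner_prod_def)

lemma prod_Basis_cart: "(\<Prod>b\<in>Basis. z \<bullet> b) = (\<Prod>i\<in>UNIV. z $ i)" for z :: "real ^ 'n::finite"
proof -
  have B: "(Basis :: (real ^ 'n::finite) set) = (\<lambda>i. axis i 1) ` UNIV" by (auto simp: Basis_vec_def)
  have "inj (\<lambda>i. axis i (1::real) :: real ^ 'n::finite)" by (auto simp: inj_on_def axis_eq_axis)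
  then show ?thesis unfolding B by (simp add: prod.reindex inner_axis)
qed

lemma lborel_distr_coords: "distr lborel borel coords = lborel"
proof (rule lborel_eqI[symmetric])
  have [measurable]: "coords \<in> borel_measurable borel"
    unfolding coords_def[abs_def] by (intro borel_measurable_continuous_onI continuous_intros)
  show "sets (distr lborel borel coords) = sets borel" by simp
  fix l u :: "real \<times> (real \<times> real)" assume lu: "\<And>b. b \<in> Basis \<Longrightarrow> l \<bullet> b \<le> u \<bullet> b"
  have lu': "fst l \<le> fst u" "fst (snd l) \<le> fst (snd u)" "snd (snd l) \<le> snd (snd u)"
    using lu[of "(1, 0, 0)"] lu[of "(0, 1, 0)"] lu[of "(0, 0, 1)"] by (auto simp: Basis_prod_def inner_prod_def zero_prod_def)
  define V :: "real \<times> (real \<times> real) \<Rightarrow> real ^ 3" where "V z = vector [fst z, fst (snd z), snd (snd z)]" for z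
  have V: "V z $ 1 = fst z" "V z $ 2 = fst (snd z)" "V z $ 3 = snd (snd z)" for z
    by (simp_all add: V_def)
  have le: "V l \<bullet> b \<le> V u \<bullet> b" if "b \<in> Basis" for b
  proof -
    have "V l $ i \<le> V u $ i" for i
      using exhaust_3[of i]
    proof (elim disjE)
      assume "i = 1" then show ?thesis using lu'(1) by (simp only: V)
    next
      assume "i = 2" then show ?thesis using lu'(2) by (simp only: V)
    next
      assume "i = 3" then show ?thesis using lu'(3) by (simp only: V)
    qed
    then show ?thesis using that by (auto simp: Basis_vec_def inner_axis)
  qed
  have "coords -` box l u = box (V l) (V u)"
  proof -
    obtain l1 l2 l3 u1 u2 u3 where lu3: "l = (l1, l2, l3)" "u = (u1, u2, u3)" by (metis prod_cases3)
    show ?thesis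
      unfolding lu3 by (auto simp: coords_def mem_box_cart forall_3 V mem_box Basis_triple inner_prod_def)
  qed
  then have "emeasure (distr lborel borel coords) (box l u) = emeasure lborel (box (V l) (V u))"
    by (subst emeasure_distr) auto
  also have "\<dots> = (\<Prod>b\<in>Basis. (V u - V l) \<bullet> b)"
    using le by (subst emeasure_lborel_box) auto
  also have "(\<Prod>b\<in>Basis. (V u - V l) \<bullet> b) = (\<Prod>b\<in>Basis. (u - l) \<bullet> b)"
    unfolding prod_Basis_triple prod_Basis_cart UNIV_3 by (simp add: V mult.assoc)
  finally show "emeasure (distr lborel borel coords) (box l u) = (\<Prod>b\<in>Basis. (u - l) \<bullet> b)" .
qed

text \<open>A rotation takes \<open>e\<close> to the first axis after \<open>xc\<close> has been
  moved to the origin, so heights of slices are measured from \<open>xc\<close> along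
  \<open>e\<close>.\<close>

lemma coords_exists:
  fixes e xc :: "real ^ 3"
  assumes e: "norm e = 1"
  obtains G :: "real ^ 3 \<Rightarrow> real \<times> (real \<times> real)" where
    "distr lborel borel G = lborel" "\<And>x y. dist (G x) (G y) = dist x y" "bij G"
    "\<And>x. fst (G x) = (x - xc) \<bullet> e" "continuous_on UNIV G"
    "\<And>u v x y. u + v = 1 \<Longrightarrow> G (u *\<^sub>R x + v *\<^sub>R y) = u *\<^sub>R G x + v *\<^sub>R G y"
proof -
  obtain T :: "real ^ 3 \<Rightarrow> real ^ 3" where T: "orthogonal_transformation T" "T e = axis 1 1"
    using orthogonal_transformation_exists[of e "axis 1 1"] e by auto
  define G where "G x = coords (T (x - xc))" for x
  have lin: "linear T" using T by (simp add: orthogonal_transformation_linear)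
  have c_lin: "coords (u *\<^sub>R x + v *\<^sub>R y) = u *\<^sub>R coords x + v *\<^sub>R coords y" for u v x y
    by (simp add: coords_def)
  have c_bij: "bij coords"
  proof (rule o_bij)
    show "(\<lambda>z. vector [fst z, fst (snd z), snd (snd z)]) \<circ> coords = id"
      by (auto simp: coords_def fun_eq_iff vec_eq_iff forall_3)
    show "coords \<circ> (\<lambda>z. vector [fst z, fst (snd z), snd (snd z)]) = id"
      by (auto simp: coords_def fun_eq_iff)
  qed
  have c_dist: "dist (coords x) (coords y) = dist x y" for x y
  proof -
    have "norm (coords z) = norm z" for z
      by (simp add: coords_def norm_Pair norm_vec_def L2_set_def sum_3 add.assoc)
    moreover have "coords x - coords y = coords (x - y)" by (simp add: coords_def)
    ultimately show ?thesis by (simp add: dist_norm)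
  qed
  have cont_c: "continuous_on UNIV coords" unfolding coords_def[abs_def] by (intro continuous_intros)
  have cont_T: "continuous_on UNIV T" using lin by (intro linear_continuous_on) (simp add: linear_linear)
  have cont_G: "continuous_on UNIV G"
    unfolding G_def by (intro continuous_on_compose2[OF cont_c] continuous_on_compose2[OF cont_T] continuous_intros) auto
  have m: "coords \<in> borel_measurable borel" "T \<in> borel_measurable borel"
    using cont_c cont_T by (auto intro: borel_measurable_continuous_onI)
  show ?thesis
  proof
    have "distr lborel borel G = distr (distr (distr lborel borel ((+) (- xc))) borel T) borel coords"
      using m by (simp add: distr_distr o_def G_def[abs_def])
    then show "distr lborel borel G = lborel"
      by (simp add: lborel_distr_plus lborel_distr_orthogonal[OF T(1)] lborel_distr_coords)
    show "dist (G x) (G y) = dist x y" for x y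
    proof -
      have "dist (T (x - xc)) (T (y - xc)) = dist (x - xc) (y - xc)"
        using T(1) unfolding orthogonal_transformation_isometry by blast
      also have "\<dots> = dist x y" by (simp add: dist_norm)
      finally show ?thesis by (simp only: G_def c_dist)
    qed
    have "G = coords \<circ> T \<circ> (\<lambda>x. x - xc)" by (auto simp: G_def)
    moreover have "bij (\<lambda>x. x - xc)" by (rule o_bij[of "\<lambda>x. x + xc"]) auto
    ultimately show "bij G" using c_bij orthogonal_transformation_bij[OF T(1)] by (simp add: bij_comp)
    show "fst (G x) = (x - xc) \<bullet> e" for x
    proof -
      have "fst (G x) = T (x - xc) \<bullet> axis 1 1" by (simp add: G_def coords_def inner_axis)
      also have "\<dots> = (x - xc) \<bullet> e" using T by (metis orthogonal_transformation_def)
      finally show ?thesis .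
    qed
    show "continuous_on UNIV G" by fact
    fix u v :: real and x y assume uv: "u + v = 1"
    have "u *\<^sub>R x + v *\<^sub>R y - xc = u *\<^sub>R (x - xc) + v *\<^sub>R (y - xc)"
    proof -
      have "u *\<^sub>R xc + v *\<^sub>R xc = xc" using uv by (metis scaleR_add_left scaleR_one)
      then have "u *\<^sub>R x + v *\<^sub>R y - xc = u *\<^sub>R x + v *\<^sub>R y - (u *\<^sub>R xc + v *\<^sub>R xc)" by simp
      then show ?thesis by (simp only: scaleR_diff_right add_diff_add)
    qed
    then show "G (u *\<^sub>R x + v *\<^sub>R y) = u *\<^sub>R G x + v *\<^sub>R G y"
      by (simp only: G_def linear_add[OF lin] linear_scale[OF lin] c_lin)
  qed
qed

lemma slice_moment:
  fixes K :: "(real \<times> 'b::euclidean_space) set"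
  assumes K: "compact K" and ab: "fst ` K \<subseteq> {a..b}"
  shows "integral {a..b} (\<lambda>t. t * slice_area K t) = (LINT z|lborel. indicator K z * fst z)"
proof -
  have int: "integrable (lborel \<Otimes>\<^sub>M lborel) (\<lambda>z::real \<times> 'b. indicator K z * fst z)"
    unfolding lborel_prod using borel_integrable_compact[OF K, of fst] by (simp add: continuous_on_fst continuous_on_id)
  have "(LINT z|lborel. indicator K z * fst z) = (LINT z|(lborel \<Otimes>\<^sub>M lborel). indicator K z * fst (z::real \<times> 'b))"
    by (simp add: lborel_prod)
  also have "\<dots> = (LINT t|lborel. LINT y|lborel. indicator K (t, y) * fst (t, (y :: 'b)))"
    by (rule lborel_pair.integral_fst'[OF int, symmetric])
  also have "\<dots> = (LINT t|lborel. t * slice_area K t)"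
  proof (rule Bochner_Integration.integral_cong[OF refl])
    fix t :: real
    have "(LINT y|lborel. indicator K (t, y) * fst (t, (y :: 'b))) = (LINT y|lborel. indicator (slice K t) y * t)"
      by (intro Bochner_Integration.integral_cong) (auto simp: slice_def indicator_def)
    also have "\<dots> = t * slice_area K t" by (simp add: slice_area_def)
    finally show "(LINT y|lborel. indicator K (t, y) * fst (t, (y :: 'b))) = t * slice_area K t" .
  qed
  finally have eq: "(LINT z|lborel. indicator K z * fst z) = (LINT t|lborel. t * slice_area K t)" .
  have z: "slice_area K t = 0" if "t \<notin> {a..b}" for t
  proof -
    have "slice K t = {}" using that ab by (force simp: slice_def)
    then show ?thesis by (simp add: slice_area_def)
  qed
  have "integrable lborel (\<lambda>t. LINT y|lborel. indicator K (t, y) * fst (t, (y :: 'b)))"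
    by (rule lborel_pair.integrable_fst'[OF int])
  moreover have "(LINT y|lborel. indicator K (t, y) * fst (t, (y :: 'b))) = t * slice_area K t" for t
  proof -
    have "(LINT y|lborel. indicator K (t, y) * fst (t, (y :: 'b))) = (LINT y|lborel. indicator (slice K t) y * t)"
      by (intro Bochner_Integration.integral_cong) (auto simp: slice_def indicator_def)
    then show ?thesis by (simp add: slice_area_def)
  qed
  ultimately have "integrable lborel (\<lambda>t. t * slice_area K t)" by (simp only:)
  then have "((\<lambda>t. t * slice_area K t) has_integral (LINT t|lborel. t * slice_area K t)) UNIV"
    by (rule has_integral_integral_lborel)
  then have "((\<lambda>t. if t \<in> {a..b} then t * slice_area K t else 0) has_integral (LINT t|lborel. t * slice_area K t)) UNIV"
    by (rule has_integral_eq[rotated]) (use z in auto)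
  then have "((\<lambda>t. t * slice_area K t) has_integral (LINT t|lborel. t * slice_area K t)) {a..b}"
    using has_integral_restrict[OF subset_UNIV] by blast
  then show ?thesis using eq by (simp add: integral_unique)
qed

section \<open>Perimeter, diameter and Hausdorff asymmetry of a body\<close>

lemma convex_body_contains_cball:
  fixes F :: "'a::euclidean_space set"
  assumes "convex F" "measure lborel F > 0" "compact F"
  obtains x0 r where "cball x0 r \<subseteq> F" "r > 0"
proof -
  have "interior F \<noteq> {}"
  proof
    assume "interior F = {}"
    then have "negligible F" using negligible_convex_interior[OF assms(1)] by simp
    then have "measure lebesgue F = 0" by (simp add: negligible_imp_measure0)
    then show False using assms by (simp add: borel_compact)
  qed
  then obtain x0 where "x0 \<in> interior F" by blast
  then show ?thesis using that mem_interior_cball by metis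
qed

text \<open>The isometry preserves volumes and parallel sets, so the growth estimate for the image
  becomes one for \<open>F\<close> and bounds the perimeter through
  \<open>perimeter_ge_content\<close>. The moment identity prepares the choice of \<open>xc\<close>
  as centroid.\<close>

lemma perimeter_profile:
  fixes F :: "(real ^ 3) set"
  assumes F: "compact F" "convex F" and vol: "measure lborel F = 4 * pi / 3" and e: "norm e = 1"
  obtains A S S' a b where "profile A S S' a b"
    "(\<lambda>x. (x - xc) \<bullet> e) ` F = {a..b}"
    "\<And>c d. -1 < c \<Longrightarrow> c \<le> d \<Longrightarrow> d < 1 \<Longrightarrow>
       ereal (4 * pi + pi * integral {c..d} (\<lambda>s. (1 - s\<^sup>2) * Psi (S' s))) \<le> perimeter F"
    "integral {a..b} (\<lambda>t. t * A t) = (LINT x|lborel. indicator F x * ((x - xc) \<bullet> e))"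
proof -
  obtain G :: "real ^ 3 \<Rightarrow> real \<times> (real \<times> real)" where G: "distr lborel borel G = lborel"
    "\<And>x y. dist (G x) (G y) = dist x y" "bij G" "\<And>x. fst (G x) = (x - xc) \<bullet> e" "continuous_on UNIV G"
    "\<And>u v x y. u + v = 1 \<Longrightarrow> G (u *\<^sub>R x + v *\<^sub>R y) = u *\<^sub>R G x + v *\<^sub>R G y"
    by (rule coords_exists[OF e, of xc]) blast
  have Gm [measurable]: "G \<in> borel_measurable borel" using G(5) by (rule borel_measurable_continuous_onI)
  have cG: "compact (G ` S)" if "compact S" for S
    using that by (intro compact_continuous_image continuous_on_subset[OF G(5)]) auto
  have mG: "measure lborel (G ` S) = measure lborel S" if "compact S" for S
  proof -
    have "emeasure lborel (G ` S) = emeasure (distr lborel borel G) (G ` S)" by (simp add: G(1))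
    also have "\<dots> = emeasure lborel (G -` (G ` S))"
      using borel_compact[OF cG[OF that]] by (subst emeasure_distr) auto
    also have "G -` (G ` S) = S" using G(3) by (simp add: inj_vimage_image_eq bij_is_inj)
    finally show ?thesis by (simp add: measure_def)
  qed
  define K where "K = G ` F"
  have K: "compact K" unfolding K_def by (rule cG[OF F(1)])
  have Kc: "convex K"
  proof (rule convexI)
    fix x y and u v :: real assume "x \<in> K" "y \<in> K" "0 \<le> u" "0 \<le> v" "u + v = 1"
    then obtain x' y' where "x = G x'" "x' \<in> F" "y = G y'" "y' \<in> F" by (auto simp: K_def)
    then show "u *\<^sub>R x + v *\<^sub>R y \<in> K"
      using G(6)[OF \<open>u + v = 1\<close>, of x' y'] convexD[OF F(2), of x' y' u v] \<open>0 \<le> u\<close> \<open>0 \<le> v\<close> \<open>u + v = 1\<close>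
      unfolding K_def by (metis imageI)
  qed
  have Kv: "measure lborel K = 4 * pi / 3" using mG[OF F(1)] vol by (simp add: K_def)
  have Fne: "F \<noteq> {}" using vol by auto
  have infd: "infdist (G x) K = infdist x F" for x
  proof -
    have "K \<noteq> {}" using Fne by (simp add: K_def)
    then show ?thesis using Fne by (simp add: infdist_notempty K_def image_image G(2))
  qed
  have par: "parallel_set K r = G ` parallel_set F r" for r
  proof (intro equalityI subsetI)
    fix z assume "z \<in> parallel_set K r"
    moreover obtain x where "z = G x" using bij_is_surj[OF G(3)] by (metis surjD)
    ultimately show "z \<in> G ` parallel_set F r" using infd by auto
  qed (use infd in auto)
  obtain a b S S' where prof: "profile (slice_area K) S S' a b" and ab: "fst ` K = {a..b}"
    by (rule profile_exists[OF K Kc Kv]) blast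
  obtain x0 r where x0: "cball x0 r \<subseteq> F" "r > 0"
    using convex_body_contains_cball[OF F(2) _ F(1)] vol by (metis divide_pos_pos mult_pos_pos pi_gt_zero zero_less_numeral)
  show ?thesis
  proof
    show "profile (slice_area K) S S' a b" by fact
    show "(\<lambda>x. (x - xc) \<bullet> e) ` F = {a..b}"
      using ab by (simp add: K_def image_image G(4))
    fix c d :: real assume cd: "-1 < c" "c \<le> d" "d < 1"
    have eq: "integral {c..d} (\<lambda>s. pi * (1 - s\<^sup>2) * Psi (S' s)) = pi * integral {c..d} (\<lambda>s. (1 - s\<^sup>2) * Psi (S' s))"
      by (simp add: mult.assoc)
    show "ereal (4 * pi + pi * integral {c..d} (\<lambda>s. (1 - s\<^sup>2) * Psi (S' s))) \<le> perimeter F"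
    proof (rule perimeter_ge_content[OF F x0])
      fix \<epsilon> :: real assume "\<epsilon> > 0"
      from parallel_volume_ge_energy[OF K Kc Kv prof cd this]
      show "measure lborel F + \<epsilon> * (4 * pi + pi * integral {c..d} (\<lambda>s. (1 - s\<^sup>2) * Psi (S' s))) \<le> measure lborel (parallel_set F \<epsilon>)"
        unfolding eq par using mG[OF parallel_set_compact[OF F(1) Fne]] mG[OF F(1)] by (simp add: K_def)
    qed
  next
    have Kb: "K \<in> sets borel" using K by (rule borel_compact)
    have "integral {a..b} (\<lambda>t. t * slice_area K t) = (LINT z|lborel. indicator K z * fst z)"
      using ab by (intro slice_moment K) simp
    also have "\<dots> = (LINT z|distr lborel borel G. indicator K z * fst z)" by (simp add: G(1))
    also have "\<dots> = (LINT x|lborel. indicator K (G x) * fst (G x))"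
    proof (subst integral_distr)
      have [measurable]: "(fst :: real \<times> (real \<times> real) \<Rightarrow> real) \<in> borel_measurable borel"
        by (intro borel_measurable_continuous_onI continuous_on_fst continuous_on_id)
      show "(\<lambda>z. indicator K z * fst z) \<in> borel_measurable borel" using Kb by measurable
    qed simp_all
    also have "\<dots> = (LINT x|lborel. indicator F x * ((x - xc) \<bullet> e))"
    proof (rule Bochner_Integration.integral_cong[OF refl])
      fix x show "indicator K (G x) * fst (G x) = indicator F x * ((x - xc) \<bullet> e)"
        using bij_is_inj[OF G(3)] by (auto simp: K_def indicator_def G(4) inj_def)
    qed
    finally show "integral {a..b} (\<lambda>t. t * slice_area K t) = (LINT x|lborel. indicator F x * ((x - xc) \<bullet> e))" .
  qed
qed

text \<open>The isoperimetric inequality for the volume of the unit ball: the energy over the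
  degenerate interval from 0 to 0 vanishes.\<close>

lemma perimeter_ge_4pi:
  fixes F :: "(real ^ 3) set"
  assumes "compact F" "convex F" "measure lborel F = 4 * pi / 3"
  shows "ereal (4 * pi) \<le> perimeter F"
proof (rule perimeter_profile[OF assms, of "axis 1 1" 0])
  fix A S S' :: "real \<Rightarrow> real" and a b
  assume "\<And>c d. -1 < c \<Longrightarrow> c \<le> d \<Longrightarrow> d < 1 \<Longrightarrow>
       ereal (4 * pi + pi * integral {c..d} (\<lambda>s. (1 - s\<^sup>2) * Psi (S' s))) \<le> perimeter F"
  from this[of 0 0] show ?thesis by simp
qed simp

text \<open>The width bound is applied in the direction of \<open>x - y\<close>, where the width is
  at least \<open>norm (x - y)\<close>.\<close>

lemma diameter_le_perimeter:
  fixes F :: "(real ^ 3) set"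
  assumes F: "compact F" "convex F" "measure lborel F = 4 * pi / 3"
    and P: "perimeter F \<le> ereal (4 * pi * (1 + \<delta>))" and xy: "x \<in> F" "y \<in> F"
  shows "norm (x - y) \<le> 64 * (1 + \<delta>)\<^sup>2"
proof (cases "x = y")
  case False
  define e where "e = (x - y) /\<^sub>R norm (x - y)"
  have e: "norm e = 1" using False by (simp add: e_def)
  obtain A S S' a b where prof: "profile A S S' a b" and rng: "(\<lambda>x. (x - 0) \<bullet> e) ` F = {a..b}"
    and en: "\<And>c d. -1 < c \<Longrightarrow> c \<le> d \<Longrightarrow> d < 1 \<Longrightarrow>
       ereal (4 * pi + pi * integral {c..d} (\<lambda>s. (1 - s\<^sup>2) * Psi (S' s))) \<le> perimeter F"
    by (rule perimeter_profile[OF F e, of 0]) blast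
  interpret profile A S S' a b by fact
  have ab_less: "a < b" by (rule profile.ab[OF prof])
  have "ereal (4 * pi + pi * integral {-1/2..1/2} (\<lambda>s. (1 - s\<^sup>2) * Psi (S' s))) \<le> ereal (4 * pi * (1 + \<delta>))"
    using en[of "-1/2" "1/2"] P by (simp del: ereal_less_eq)
  then have "pi * integral {-1/2..1/2} (\<lambda>s. (1 - s\<^sup>2) * Psi (S' s)) \<le> pi * (4 * \<delta>)"
    by (simp add: algebra_simps)
  then have "sqrt (b - a) \<le> 8 * (1 + \<delta>)" by (intro width_le_energy) simp
  then have "(sqrt (b - a))\<^sup>2 \<le> (8 * (1 + \<delta>))\<^sup>2" using ab_less by (intro power_mono) auto
  then have "b - a \<le> 64 * (1 + \<delta>)\<^sup>2" using ab_less unfolding power_mult_distrib by simp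
  moreover have "x \<bullet> e \<in> {a..b}" "y \<bullet> e \<in> {a..b}" unfolding rng[symmetric] using xy by auto
  then have "(x - y) \<bullet> e \<le> b - a" by (simp add: inner_diff_left)
  moreover have "(x - y) \<bullet> e = norm (x - y)"
    using False by (simp add: e_def dot_square_norm power2_eq_square)
  ultimately show ?thesis by linarith
qed simp

lemma compact_infdist_le_hausdorff_dist:
  fixes A B :: "'a::euclidean_space set"
  assumes A: "compact A" and B: "compact B"
  shows "a \<in> A \<Longrightarrow> infdist a B \<le> hausdorff_dist A B"
    and "b \<in> B \<Longrightarrow> infdist b A \<le> hausdorff_dist A B"
proof -
  have bd: "bdd_above ((\<lambda>x. infdist x S) ` T)" if "compact T" for S T :: "'a set"
    using that by (intro bounded_imp_bdd_above compact_imp_bounded compact_continuous_image continuous_intros)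
  show "infdist a B \<le> hausdorff_dist A B" if "a \<in> A"
    unfolding hausdorff_dist_def using cSUP_upper[OF that bd[OF A, of B]] by simp
  show "infdist b A \<le> hausdorff_dist A B" if "b \<in> B"
    unfolding hausdorff_dist_def using cSUP_upper[OF that bd[OF B, of A]] by simp
qed

lemma hausdorff_dist_le:
  assumes "A \<noteq> {}" "B \<noteq> {}" "\<And>a. a \<in> A \<Longrightarrow> infdist a B \<le> c" "\<And>b. b \<in> B \<Longrightarrow> infdist b A \<le> c"
  shows "hausdorff_dist A B \<le> c"
  unfolding hausdorff_dist_def using assms by (auto intro!: cSUP_least)

abbreviation unit_ball_at :: "'a::real_normed_vector \<Rightarrow> 'a set" where
  "unit_ball_at x \<equiv> (+) x ` cball 0 1"

lemma unit_ball_at_eq: "unit_ball_at x = cball x 1"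
  by (simp add: cball_translation)

lemma hausdorff_dist_nonneg:
  fixes A B :: "'a::euclidean_space set"
  assumes "compact A" "compact B" "A \<noteq> {}"
  shows "0 \<le> hausdorff_dist A B"
proof -
  obtain a where "a \<in> A" using assms by blast
  then have "infdist a B \<le> hausdorff_dist A B" by (rule compact_infdist_le_hausdorff_dist[OF assms(1,2)])
  then show ?thesis using infdist_nonneg[of a B] by linarith
qed

lemma hausdorff_asymmetry_le:
  assumes "compact F" "F \<noteq> {}"
  shows "hausdorff_asymmetry F \<le> hausdorff_dist F (unit_ball_at x)"
  unfolding hausdorff_asymmetry_def
proof (rule cINF_lower)
  show "bdd_below (range (\<lambda>x. hausdorff_dist F (unit_ball_at x)))"
    using hausdorff_dist_nonneg[OF assms(1) _ assms(2)] unit_ball_at_eq by (intro bdd_belowI[of _ 0]) auto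
qed simp

lemma hausdorff_asymmetry_nonneg:
  assumes "compact F" "F \<noteq> {}"
  shows "0 \<le> hausdorff_asymmetry F"
  unfolding hausdorff_asymmetry_def
  using hausdorff_dist_nonneg[OF assms(1) _ assms(2)] unit_ball_at_eq by (intro cINF_greatest) auto

text \<open>A comparison of support functions. A point of \<open>F\<close> outside the ball is
  tested in its own direction seen from \<open>xc\<close>, a point of the ball outside
  \<open>F\<close> in the normal direction at its nearest point of \<open>F\<close>.\<close>

lemma hausdorff_dist_unit_ball_le:
  fixes F :: "'a::euclidean_space set"
  assumes F: "compact F" "convex F" "F \<noteq> {}" and \<omega>: "\<omega> \<ge> 0"
    and up: "\<And>e x. norm e = 1 \<Longrightarrow> x \<in> F \<Longrightarrow> (x - xc) \<bullet> e \<le> 1 + \<omega>"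
    and low: "\<And>e. norm e = 1 \<Longrightarrow> \<exists>x\<in>F. 1 - \<omega> \<le> (x - xc) \<bullet> e"
  shows "hausdorff_dist F (cball xc 1) \<le> \<omega>"
proof (rule hausdorff_dist_le)
  show "F \<noteq> {}" by fact
  show "cball xc 1 \<noteq> {}" by simp
  show "infdist x (cball xc 1) \<le> \<omega>" if x: "x \<in> F" for x
  proof (cases "x \<in> cball xc 1")
    case False
    then have n: "norm (x - xc) > 1" by (simp add: dist_norm norm_minus_commute)
    define e where "e = (x - xc) /\<^sub>R norm (x - xc)"
    have nz: "norm (x - xc) \<noteq> 0" using n by linarith
    have e: "norm e = 1" using nz by (simp add: e_def)
    have "(x - xc) \<bullet> e = norm (x - xc)"
      using nz by (simp add: e_def dot_square_norm power2_eq_square)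
    then have "norm (x - xc) \<le> 1 + \<omega>" using up[OF e x] by simp
    moreover have "infdist x (cball xc 1) \<le> dist x (xc + e)"
      using e by (intro infdist_le) (simp add: dist_norm)
    moreover have "x - (xc + e) = (norm (x - xc) - 1) *\<^sub>R e"
      using nz by (simp add: e_def algebra_simps)
    then have "dist x (xc + e) = norm (x - xc) - 1" using e n by (simp add: dist_norm)
    ultimately show ?thesis by linarith
  qed (use \<omega> in simp)
  show "infdist y F \<le> \<omega>" if y: "y \<in> cball xc 1" for y
  proof (cases "infdist y F > 0")
    case True
    obtain n where n: "norm n = 1" "\<And>z. infdist y F + n \<bullet> (z - y) \<le> infdist z F"
      using infdist_ge_normal[OF compact_imp_closed[OF F(1)] F(2,3) True] by blast
    obtain z where z: "z \<in> F" "1 - \<omega> \<le> (z - xc) \<bullet> n" using low[OF n(1)] by blast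
    have "infdist y F \<le> n \<bullet> (y - z)" using n(2)[of z] z(1) by (simp add: inner_diff_right)
    also have "\<dots> = (y - xc) \<bullet> n - (z - xc) \<bullet> n" by (simp add: inner_diff_right inner_diff_left inner_commute)
    also have "(y - xc) \<bullet> n \<le> 1"
      using norm_cauchy_schwarz[of "y - xc" n] n(1) y by (simp add: dist_norm norm_minus_commute)
    finally show ?thesis using z(2) by linarith
  qed (use \<omega> in linarith)
qed

text \<open>The constant \<open>3 / 2\<close> is not optimal, but small enough to exclude that minimizing sequences converge
  to the ball.\<close>

lemma hausdorff_asymmetry_le_deficit:
  fixes F :: "(real ^ 3) set"
  assumes F: "compact F" "convex F" "measure lborel F = 4 * pi / 3"
    and P: "perimeter F \<le> ereal (4 * pi * (1 + \<delta>))" and \<delta>: "\<delta> > 0" "25 * \<delta> < 1"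
  shows "hausdorff_asymmetry F \<le> sqrt (3 / 2 * \<delta> * ln (1 / \<delta>)) + 12000 * sqrt \<delta>"
proof -
  define \<omega> where "\<omega> = sqrt (3 / 2 * \<delta> * ln (1 / \<delta>)) + 12000 * sqrt \<delta>"
  have \<omega>: "\<omega> \<ge> 0" using \<delta> by (simp add: \<omega>_def)
  have Fne: "F \<noteq> {}" using F(3) by auto
  \<comment> \<open>The centroid: one centre whose first moments vanish in all directions
    simultaneously.\<close>
  define xc where "xc = (1 / (4 * pi / 3)) *\<^sub>R (LINT x|lborel. indicator F x *\<^sub>R x)"
  have int: "integrable lborel (\<lambda>x. indicator F x *\<^sub>R x)"
    by (intro borel_integrable_compact F continuous_on_id)
  have int1: "integrable lborel (indicator F :: real ^ 3 \<Rightarrow> real)"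
    using borel_integrable_compact[OF F(1), of "\<lambda>_. 1 :: real"] by simp
  have centroid: "(LINT x|lborel. indicator F x * ((x - xc) \<bullet> e)) = 0" for e
  proof -
    have "(LINT x|lborel. indicator F x * ((x - xc) \<bullet> e))
        = (LINT x|lborel. (indicator F x *\<^sub>R x) \<bullet> e - indicator F x * (xc \<bullet> e))"
      by (intro Bochner_Integration.integral_cong) (auto simp: inner_diff_left right_diff_distrib)
    also have "\<dots> = (LINT x|lborel. indicator F x *\<^sub>R x) \<bullet> e - measure lborel F * (xc \<bullet> e)"
    proof -
      have "integrable lborel (\<lambda>x. (indicator F x *\<^sub>R x) \<bullet> e)"
        by (rule integrable_inner_left) (use int in simp)
      moreover have "(LINT x|lborel. (indicator F x *\<^sub>R x) \<bullet> e) = (LINT x|lborel. indicator F x *\<^sub>R x) \<bullet> e"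
        by (rule integral_inner_left) (use int in simp)
      moreover have "integrable lborel (\<lambda>x. indicator F x * (xc \<bullet> e))"
        using int1 by (rule integrable_mult_left)
      moreover have "(LINT x|lborel. indicator F x * (xc \<bullet> e)) = measure lborel F * (xc \<bullet> e)"
        by simp
      ultimately show ?thesis by (simp only: Bochner_Integration.integral_diff)
    qed
    also have "\<dots> = 0" unfolding F(3) by (simp add: xc_def)
    finally show ?thesis .
  qed
  have main: "\<exists>a b. (\<lambda>x. (x - xc) \<bullet> e) ` F = {a..b} \<and> a \<le> b \<and> \<bar>b - 1\<bar> \<le> \<omega>" if e: "norm e = 1" for e
  proof -
    obtain A S S' a b where prof: "profile A S S' a b" and rng: "(\<lambda>x. (x - xc) \<bullet> e) ` F = {a..b}"
      and en: "\<And>c d. -1 < c \<Longrightarrow> c \<le> d \<Longrightarrow> d < 1 \<Longrightarrow>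
         ereal (4 * pi + pi * integral {c..d} (\<lambda>s. (1 - s\<^sup>2) * Psi (S' s))) \<le> perimeter F"
      and mom: "integral {a..b} (\<lambda>t. t * A t) = (LINT x|lborel. indicator F x * ((x - xc) \<bullet> e))"
      by (rule perimeter_profile[OF F e, of xc]) blast
    interpret profile A S S' a b by fact
    have ab_less: "a < b" by (rule profile.ab[OF prof])
    interpret near_profile A S S' a b \<delta>
    proof
      show "0 < \<delta>" "25 * \<delta> < 1" by fact+
      fix c d :: real assume cd: "-1 < c" "c \<le> d" "d < 1"
      have "ereal (4 * pi + pi * integral {c..d} (\<lambda>s. (1 - s\<^sup>2) * Psi (S' s))) \<le> ereal (4 * pi * (1 + \<delta>))"
        using en[OF cd] P by (rule order_trans)
      then have "pi * integral {c..d} (\<lambda>s. (1 - s\<^sup>2) * Psi (S' s)) \<le> pi * (4 * \<delta>)"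
        by (simp add: algebra_simps)
      then show "integral {c..d} (\<lambda>s. (1 - s\<^sup>2) * Psi (S' s)) \<le> 4 * \<delta>" by simp
    qed
    have "\<bar>b - 1\<bar> \<le> \<omega>" unfolding \<omega>_def using end_bound mom centroid by simp
    then show ?thesis using rng ab_less by (intro exI[of _ a] exI[of _ b]) simp
  qed
  have "hausdorff_dist F (cball xc 1) \<le> \<omega>"
  proof (rule hausdorff_dist_unit_ball_le[OF F(1,2) Fne \<omega>])
    fix e :: "real ^ 3" assume e: "norm e = 1"
    obtain a b where ab: "(\<lambda>x. (x - xc) \<bullet> e) ` F = {a..b}" "a \<le> b" "\<bar>b - 1\<bar> \<le> \<omega>" using main[OF e] by blast
    show "(x - xc) \<bullet> e \<le> 1 + \<omega>" if "x \<in> F" for x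
    proof -
      have "(x - xc) \<bullet> e \<in> {a..b}" unfolding ab(1)[symmetric] using that by blast
      then have "(x - xc) \<bullet> e \<le> b" by simp
      then show ?thesis using ab(3) by linarith
    qed
    have "b \<in> (\<lambda>x. (x - xc) \<bullet> e) ` F" using ab by simp
    then obtain x where "x \<in> F" "b = (x - xc) \<bullet> e" by blast
    moreover have "1 - \<omega> \<le> b" using ab(3) by linarith
    ultimately show "\<exists>x\<in>F. 1 - \<omega> \<le> (x - xc) \<bullet> e" by blast
  qed
  moreover have "hausdorff_asymmetry F \<le> hausdorff_dist F (cball xc 1)"
    using hausdorff_asymmetry_le[OF F(1) Fne, of xc] by (simp add: unit_ball_at_eq)
  ultimately show ?thesis by (simp add: \<omega>_def)
qed

section \<open>Upper bound for the perimeter\<close>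

lemma parallel_set_subset_dilation:
  fixes F :: "'a::euclidean_space set"
  assumes F: "compact F" "convex F" and \<rho>: "cball x0 \<rho> \<subseteq> F" "\<rho> > 0" and t: "t \<ge> 0"
    and q: "q \<in> F" and z: "dist z q \<le> t"
  shows "z \<in> (\<lambda>w. - (t / \<rho>) *\<^sub>R x0 + (1 + t / \<rho>) *\<^sub>R w) ` F"
proof (cases "t = 0")
  case True
  then show ?thesis using q z by simp
next
  case False
  then have t: "t > 0" using t by simp
  \<comment> \<open>The point of the inner ball in the direction of \<open>z - q\<close>. Then
    \<open>z\<close> is a dilated convex combination of \<open>q\<close> and \<open>u\<close>, of
    total weight \<open>1 + t / \<rho>\<close> about \<open>x0\<close>.\<close>
  define u where "u = x0 + (\<rho> / t) *\<^sub>R (z - q)"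
  have "dist x0 u = \<rho> / t * dist z q" using \<rho> t by (simp add: u_def dist_norm)
  also have "\<dots> \<le> \<rho> / t * t" using z \<rho> t by (intro mult_left_mono) auto
  finally have u: "u \<in> F" using \<rho> t by auto
  define k where "k = 1 + t / \<rho>"
  have k: "k > 0" using \<rho> t by (simp add: k_def add_pos_pos)
  define w where "w = (1 / k) *\<^sub>R q + (t / \<rho> / k) *\<^sub>R u"
  have "1 / k + t / \<rho> / k = k / k" unfolding k_def by (rule add_divide_distrib[symmetric])
  then have "1 / k + t / \<rho> / k = 1" using k by simp
  then have w: "w \<in> F"
    unfolding w_def using k \<rho> t by (intro convexD[OF F(2) q u]) auto
  have "k *\<^sub>R w = q + (t / \<rho>) *\<^sub>R u" using k by (simp add: w_def scaleR_add_right)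
  also have "\<dots> = z + (t / \<rho>) *\<^sub>R x0" using \<rho> t by (simp add: u_def scaleR_add_right)
  finally have "z = - (t / \<rho>) *\<^sub>R x0 + (1 + t / \<rho>) *\<^sub>R w" by (simp add: k_def)
  then show ?thesis using w by blast
qed

text \<open>The determinant is a cubic in \<open>t\<close> with linear coefficient the trace; the
  coefficients of order 2 and 3 are each a signed sum of six products of entries.\<close>

lemma det_identity_perturbation:
  fixes m :: "real ^ 3 ^ 3"
  assumes M: "\<And>i j. \<bar>m $ i $ j\<bar> \<le> M" and t: "0 \<le> t" "t \<le> 1"
  shows "1 + t * (\<Sum>i\<in>UNIV. m $ i $ i) - (6 * M\<^sup>2 + 6 * M ^ 3) * t\<^sup>2 \<le> det (mat 1 + t *\<^sub>R m)"
proof -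
  define q where "q = m$1$1 * m$2$2 + m$1$1 * m$3$3 + m$2$2 * m$3$3 - m$1$2 * m$2$1 - m$1$3 * m$3$1 - m$2$3 * m$3$2"
  define r where "r = m$1$1 * m$2$2 * m$3$3 + m$1$2 * m$2$3 * m$3$1 + m$1$3 * m$2$1 * m$3$2 - m$1$1 * m$2$3 * m$3$2
    - m$1$2 * m$2$1 * m$3$3 - m$1$3 * m$2$2 * m$3$1"
  have det: "det (mat 1 + t *\<^sub>R m) = 1 + t * (\<Sum>i\<in>UNIV. m $ i $ i) + t\<^sup>2 * q + t ^ 3 * r"
    unfolding det_3 sum_3 q_def r_def
    by (simp add: mat_def power2_eq_square power3_eq_cube algebra_simps)
  have M0: "M \<ge> 0" using M[of 1 1] by linarith
  have p2: "\<bar>m $ i $ j * m $ k $ l\<bar> \<le> M\<^sup>2" for i j k l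
    unfolding abs_mult power2_eq_square using M M0 by (intro mult_mono) auto
  have p3: "\<bar>m $ i $ j * m $ k $ l * m $ i' $ j'\<bar> \<le> M ^ 3" for i j k l i' j'
  proof -
    have "\<bar>m $ i $ j * m $ k $ l * m $ i' $ j'\<bar> \<le> M\<^sup>2 * M"
      unfolding abs_mult[of "m $ i $ j * m $ k $ l"] using M p2 M0 by (intro mult_mono) auto
    then show ?thesis by (simp add: power2_eq_square power3_eq_cube)
  qed
  have q: "- (6 * M\<^sup>2) \<le> q"
    using p2[of 1 1 2 2] p2[of 1 1 3 3] p2[of 2 2 3 3] p2[of 1 2 2 1] p2[of 1 3 3 1] p2[of 2 3 3 2]
    unfolding q_def by linarith
  have r: "- (6 * M ^ 3) \<le> r"
    using p3[of 1 1 2 2 3 3] p3[of 1 2 2 3 3 1] p3[of 1 3 2 1 3 2] p3[of 1 1 2 3 3 2] p3[of 1 2 2 1 3 3] p3[of 1 3 2 2 3 1]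
    unfolding r_def by linarith
  have "t\<^sup>2 * (- (6 * M\<^sup>2)) \<le> t\<^sup>2 * q" using q by (intro mult_left_mono) auto
  moreover have "t ^ 3 * (- (6 * M ^ 3)) \<le> t ^ 3 * r" using r t by (intro mult_left_mono) auto
  moreover have "t ^ 3 * (6 * M ^ 3) \<le> t\<^sup>2 * (6 * M ^ 3)"
    using t M0 by (intro mult_right_mono power_decreasing) auto
  ultimately show ?thesis unfolding det by (simp add: algebra_simps)
qed

text \<open>The derivative vanishes off the compact support, and on it each directional derivative
  is bounded by continuity. Summing over \<open>Basis\<close> makes the bound uniform in the
  direction.\<close>

lemma C1_derivative_bounded:
  fixes \<phi> :: "'a::euclidean_space \<Rightarrow> 'b::euclidean_space"
  assumes "C1_compact_support \<phi>"
  obtains M where "M \<ge> 0" "\<And>x v. norm (frechet_derivative \<phi> (at x) v) \<le> M * norm v"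
proof -
  have d: "\<phi> differentiable (at x)" for x using assms by (simp add: C1_compact_support_def)
  have c: "continuous_on UNIV (\<lambda>x. frechet_derivative \<phi> (at x) v)" for v
    using assms by (simp add: C1_compact_support_def)
  have blin: "bounded_linear (frechet_derivative \<phi> (at x))" for x
    using d frechet_derivative_works has_derivative_bounded_linear by blast
  define C where "C = closure {x. \<phi> x \<noteq> 0}"
  have C: "compact C" using assms by (simp add: C1_compact_support_def C_def)
  have zero: "frechet_derivative \<phi> (at x) = (\<lambda>_. 0)" if "x \<notin> C" for x
  proof -
    have "open (- C)" by (simp add: C_def open_Compl)
    moreover have "\<phi> y = 0" if "y \<in> - C" for y
      using that closure_subset[of "{x. \<phi> x \<noteq> 0}"] by (auto simp: C_def)
    ultimately have "(\<phi> has_derivative (\<lambda>_. 0)) (at x)"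
      using that by (intro has_derivative_transform_within_open[OF has_derivative_const[of 0], where s = "- C"]) auto
    then show ?thesis using frechet_derivative_at by metis
  qed
  have "\<exists>B. \<forall>x. norm (frechet_derivative \<phi> (at x) b) \<le> B" for b
  proof -
    have "bounded ((\<lambda>x. frechet_derivative \<phi> (at x) b) ` C)"
      by (intro compact_imp_bounded compact_continuous_image continuous_on_subset[OF c] C) auto
    then obtain B where B: "\<And>x. x \<in> C \<Longrightarrow> norm (frechet_derivative \<phi> (at x) b) \<le> B" "B > 0"
      by (auto simp: bounded_pos)
    have "norm (frechet_derivative \<phi> (at x) b) \<le> B" for x
      using B zero[of x] by (cases "x \<in> C") auto
    then show ?thesis by blast
  qed
  then obtain B where B: "\<And>b x. norm (frechet_derivative \<phi> (at x) b) \<le> B b" by metis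
  have B0: "B b \<ge> 0" for b using B[of undefined b] norm_ge_zero order_trans by blast
  have "norm (frechet_derivative \<phi> (at x) v) \<le> (\<Sum>b\<in>Basis. B b) * norm v" for x v
  proof -
    have "frechet_derivative \<phi> (at x) v = frechet_derivative \<phi> (at x) (\<Sum>b\<in>Basis. (v \<bullet> b) *\<^sub>R b)"
      by (simp add: euclidean_representation)
    also have "\<dots> = (\<Sum>b\<in>Basis. (v \<bullet> b) *\<^sub>R frechet_derivative \<phi> (at x) b)"
      using blin[of x] by (simp add: linear_sum linear_scale bounded_linear.linear)
    also have "norm \<dots> \<le> (\<Sum>b\<in>Basis. norm v * B b)"
      using B Basis_le_norm by (intro sum_norm_le) (auto intro!: mult_mono)
    finally show ?thesis by (simp add: sum_distrib_left mult.commute)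
  qed
  then show ?thesis using that[of "\<Sum>b\<in>Basis. B b"] B0 by (simp add: sum_nonneg)
qed

text \<open>The volume of the image of the body under \<open>x \<mapsto> x + t * \<phi> x\<close> is at most that of its parallel set, which is
  contained in a dilation of the body.\<close>

lemma perimeter_le_inradius:
  fixes F :: "(real ^ 3) set"
  assumes F: "compact F" "convex F" and \<rho>: "cball x0 \<rho> \<subseteq> F" "\<rho> > 0"
  shows "perimeter F \<le> ereal (3 * measure lborel F / \<rho>)"
  unfolding perimeter_def
proof (rule SUP_least)
  fix \<phi> :: "real ^ 3 \<Rightarrow> real ^ 3"
  assume "\<phi> \<in> {\<phi>. C1_compact_support \<phi> \<and> (\<forall>x. norm (\<phi> x) \<le> 1)}"
  then have C1: "C1_compact_support \<phi>" and n1: "\<And>x. norm (\<phi> x) \<le> 1" by auto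
  define V where "V = measure lborel F"
  have Fb: "F \<in> sets borel" using F(1) by (rule borel_compact)
  have V: "V = measure lebesgue F" using Fb by (simp add: V_def)
  have blin: "bounded_linear (frechet_derivative \<phi> (at x))" for x
    using C1 frechet_derivative_works has_derivative_bounded_linear unfolding C1_compact_support_def by blast
  have der: "(\<phi> has_derivative frechet_derivative \<phi> (at x)) (at x)" for x
    using C1 frechet_derivative_works unfolding C1_compact_support_def by blast
  obtain M where M: "M \<ge> 0" "\<And>x v. norm (frechet_derivative \<phi> (at x) v) \<le> M * norm v"
    by (rule C1_derivative_bounded[OF C1]) blast
  have lip: "norm (\<phi> x - \<phi> y) \<le> M * norm (x - y)" for x y
    using differentiable_bound[of UNIV \<phi> "\<lambda>x. frechet_derivative \<phi> (at x)" M x y] der M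
    by (auto intro!: onorm_le)
  define m where "m x = matrix (frechet_derivative \<phi> (at x))" for x
  have m_bd: "\<bar>m x $ i $ j\<bar> \<le> M" for x i j
    using M(2)[of x "axis j 1"] component_le_norm_cart[of "frechet_derivative \<phi> (at x) (axis j 1)" i]
    by (simp add: m_def matrix_def)
  have div_m: "divergence \<phi> x = (\<Sum>i\<in>UNIV. m x $ i $ i)" for x
  proof -
    have B: "(Basis :: (real ^ 3) set) = (\<lambda>i. axis i 1) ` UNIV" by (auto simp: Basis_vec_def)
    have "inj (\<lambda>i. axis i (1::real) :: real ^ 3)" by (auto simp: inj_on_def axis_eq_axis)
    then show ?thesis
      unfolding divergence_def m_def matrix_def B by (simp add: sum.reindex inner_axis)
  qed
  have m_cont: "continuous_on UNIV (\<lambda>x. m x $ i $ j)" for i j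
    using C1 unfolding C1_compact_support_def m_def matrix_def by (auto intro!: continuous_intros)
  have div_cont: "continuous_on UNIV (divergence \<phi>)" by (rule C1_divergence_continuous[OF C1])
  define I where "I = integral F (divergence \<phi>)"
  have compact_int: "f integrable_on F" "integral F f = (LINT x:F|lborel. f x)"
    if "continuous_on UNIV f" for f :: "real ^ 3 \<Rightarrow> real"
  proof -
    have "set_integrable lborel F f"
      unfolding set_integrable_def by (intro borel_integrable_compact F continuous_on_subset[OF that]) auto
    then show "f integrable_on F" "integral F f = (LINT x:F|lborel. f x)"
      by (auto simp: set_borel_integral_eq_integral)
  qed
  define C where "C = 6 * M\<^sup>2 + 6 * M ^ 3"
  have step: "I \<le> V * (((1 + t / \<rho>) ^ 3 - 1) / t) + C * V * t"
    if t: "0 < t" "t < 1" "t * M < 1" for t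
  proof -
    define \<Phi> where "\<Phi> x = x + t *\<^sub>R \<phi> x" for x
    define \<Phi>' where "\<Phi>' x v = v + t *\<^sub>R frechet_derivative \<phi> (at x) v" for x v
    have der\<Phi>: "(\<Phi> has_derivative \<Phi>' x) (at x within F)" for x
      unfolding \<Phi>_def[abs_def] \<Phi>'_def[abs_def]
      by (intro has_derivative_at_withinI[OF has_derivative_add[OF has_derivative_ident has_derivative_scaleR_right[OF der]]])
    \<comment> \<open>For \<open>t * M < 1\<close> the perturbation
      \<open>t *\<^sub>R \<phi> x\<close> is a strict contraction and cannot identify two points;
      injectivity makes the change of variables an equality.\<close>
    have inj: "inj_on \<Phi> F"
    proof (rule inj_onI)
      fix x y assume "\<Phi> x = \<Phi> y"
      then have "x - y = t *\<^sub>R (\<phi> y - \<phi> x)" by (simp add: \<Phi>_def algebra_simps)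
      then have "norm (x - y) \<le> t * (M * norm (x - y))"
        using lip[of y x] t by (simp add: norm_minus_commute mult_left_mono)
      then have "(1 - t * M) * norm (x - y) \<le> 0" by (simp add: algebra_simps)
      then show "x = y" using t by (simp add: mult_le_0_iff)
    qed
    have mat\<Phi>: "matrix (\<Phi>' x) = mat 1 + t *\<^sub>R m x" for x
      by (simp add: vec_eq_iff matrix_def \<Phi>'_def m_def mat_def axis_def)
    have det_cont: "continuous_on UNIV (\<lambda>x. \<bar>det (matrix (\<Phi>' x))\<bar>)"
    proof -
      have "continuous_on UNIV (\<lambda>x. (mat 1 + t *\<^sub>R m x) $ i $ j)" for i j
        unfolding vector_add_component vector_scaleR_component
        by (intro continuous_on_add continuous_on_const continuous_on_scaleR m_cont)
      then show ?thesis
        unfolding mat\<Phi> det_3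
        by (intro continuous_on_rabs continuous_on_diff continuous_on_add continuous_on_mult)
    qed
    have "measure lebesgue (\<Phi> ` F) = integral F (\<lambda>x. \<bar>det (matrix (\<Phi>' x))\<bar>)"
      using Fb by (intro measure_differentiable_image_eq der\<Phi> inj compact_int det_cont) auto
    also have "\<dots> \<ge> integral F (\<lambda>x. (1 - C * t\<^sup>2) + t * divergence \<phi> x)"
    proof (rule integral_le)
      show "(\<lambda>x. 1 - C * t\<^sup>2 + t * divergence \<phi> x) integrable_on F"
        by (intro compact_int continuous_intros div_cont)
      show "(\<lambda>x. \<bar>det (matrix (\<Phi>' x))\<bar>) integrable_on F" by (intro compact_int det_cont)
      fix x
      have "1 + t * (\<Sum>i\<in>UNIV. m x $ i $ i) - C * t\<^sup>2 \<le> det (mat 1 + t *\<^sub>R m x)"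
        unfolding C_def using t by (intro det_identity_perturbation m_bd) auto
      then show "1 - C * t\<^sup>2 + t * divergence \<phi> x \<le> \<bar>det (matrix (\<Phi>' x))\<bar>"
        unfolding mat\<Phi> div_m by linarith
    qed
    finally have low: "integral F (\<lambda>x. (1 - C * t\<^sup>2) + t * divergence \<phi> x) \<le> measure lebesgue (\<Phi> ` F)" .
    have "integral F (\<lambda>x. (1 - C * t\<^sup>2) + t * divergence \<phi> x) = (1 - C * t\<^sup>2) * V + t * I"
    proof -
      have "(\<lambda>x. 1 - C * t\<^sup>2) integrable_on F" "(\<lambda>x. t * divergence \<phi> x) integrable_on F"
        by (intro compact_int continuous_intros div_cont)+
      moreover have "integral F (\<lambda>x. 1 - C * t\<^sup>2) = (1 - C * t\<^sup>2) * V"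
        using compact_int(2)[OF continuous_on_const, of "1 - C * t\<^sup>2"] F
        by (simp add: V_def set_lebesgue_integral_def)
      ultimately show ?thesis by (simp add: Henstock_Kurzweil_Integration.integral_add I_def)
    qed
    with low have low2: "(1 - C * t\<^sup>2) * V + t * I \<le> measure lebesgue (\<Phi> ` F)" by simp
    define D where "D = (\<lambda>w. - (t / \<rho>) *\<^sub>R x0 + (1 + t / \<rho>) *\<^sub>R w) ` F"
    have k: "1 + t / \<rho> > 0" using t \<rho> by (simp add: add_pos_pos)
    have sub: "\<Phi> ` F \<subseteq> D"
    proof safe
      fix x assume x: "x \<in> F"
      have "dist (\<Phi> x) x \<le> t" using n1[of x] t mult_left_mono[OF n1[of x], of t] by (simp add: \<Phi>_def dist_norm)
      then show "\<Phi> x \<in> D" unfolding D_def using t by (intro parallel_set_subset_dilation[OF F \<rho> _ x]) auto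
    qed
    have cD: "compact D" unfolding D_def by (intro compact_continuous_image continuous_intros F)
    have c\<Phi>: "continuous_on F \<Phi>" using der\<Phi> has_derivative_continuous_on by blast
    have "measure lebesgue (\<Phi> ` F) \<le> measure lebesgue D"
      using cD compact_continuous_image[OF c\<Phi> F(1)]
      by (intro measure_mono_fmeasurable[OF sub] lmeasurable_compact) (auto simp: borel_compact)
    also have "\<dots> = (1 + t / \<rho>) ^ 3 * V"
      unfolding D_def V using measure_affine_image[OF k, of F "- (t / \<rho>) *\<^sub>R x0"] Fb by simp
    finally have "t * I \<le> V * ((1 + t / \<rho>) ^ 3 - 1) + C * V * t * t"
      using low2 by (simp add: algebra_simps power2_eq_square)
    then have "I \<le> (V * ((1 + t / \<rho>) ^ 3 - 1) + C * V * t * t) / t"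
      using t by (simp add: pos_le_divide_eq mult.commute)
    also have "\<dots> = V * (((1 + t / \<rho>) ^ 3 - 1) / t) + C * V * t" using t by (simp add: add_divide_distrib)
    finally show ?thesis .
  qed
  \<comment> \<open>As \<open>t\<close> tends to 0 only the linear coefficient
    \<open>3 / \<rho>\<close> of the dilated volume survives.\<close>
  have poly: "((1 + t / \<rho>) ^ 3 - 1) / t = 3 / \<rho> + 3 * t / \<rho>\<^sup>2 + t\<^sup>2 / \<rho> ^ 3" if "t > 0" for t
    using that \<rho> by (simp add: field_simps power2_eq_square power3_eq_cube)
  have "((\<lambda>t. V * (3 / \<rho> + 3 * t / \<rho>\<^sup>2 + t\<^sup>2 / \<rho> ^ 3) + C * V * t) \<longlongrightarrow>
      V * (3 / \<rho> + 3 * 0 / \<rho>\<^sup>2 + 0\<^sup>2 / \<rho> ^ 3) + C * V * 0) (at_right 0)"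
    using \<rho> by (intro tendsto_intros) auto
  moreover have "eventually (\<lambda>t. I \<le> V * (3 / \<rho> + 3 * t / \<rho>\<^sup>2 + t\<^sup>2 / \<rho> ^ 3) + C * V * t) (at_right 0)"
  proof -
    have "0 < 1 / (M + 1)" using M by simp
    then have "eventually (\<lambda>t. t \<in> {0<..<1 / (M + 1)}) (at_right 0)" by (rule eventually_at_right_real)
    then show ?thesis
    proof eventually_elim
      case (elim t)
      then have t: "t > 0" "t * (M + 1) < 1" using M by (auto simp: pos_less_divide_eq)
      moreover have "t * 1 \<le> t * (M + 1)" "t * M \<le> t * (M + 1)" using t M by (intro mult_left_mono; simp)+
      ultimately have "t < 1" "t * M < 1" by linarith+
      from step[OF t(1) this] show ?case by (simp only: poly[OF t(1)])
    qed
  qed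
  ultimately have "I \<le> V * (3 / \<rho> + 3 * 0 / \<rho>\<^sup>2 + 0\<^sup>2 / \<rho> ^ 3) + C * V * 0"
    by (rule tendsto_lowerbound) simp
  then have "I \<le> 3 * V / \<rho>" by (simp add: mult.commute)
  moreover have "set_lebesgue_integral lebesgue F (divergence \<phi>) = I"
    unfolding I_def set_lebesgue_integral_lborel[OF div_cont Fb] by (rule compact_int(2)[OF div_cont, symmetric])
  ultimately show "ereal (set_lebesgue_integral lebesgue F (divergence \<phi>)) \<le> ereal (3 * measure lborel F / \<rho>)"
    by (simp add: V_def)
qed

section \<open>The functional on the class of bodies\<close>

definition log_weight :: "real \<Rightarrow> real" where
  "log_weight d = d * ln (d + 1 / d)"

lemma log_weight_lower: "d > 0 \<Longrightarrow> d * ln 2 \<le> log_weight d"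
proof -
  assume d: "d > 0"
  have "0 \<le> (d - 1)\<^sup>2" by simp
  then have "2 \<le> d + 1 / d" using d by (simp add: field_simps power2_eq_square)
  then have "ln 2 \<le> ln (d + 1 / d)" by (intro ln_mono) auto
  then show ?thesis unfolding log_weight_def using d by (intro mult_left_mono) auto
qed

lemma log_weight_nonneg: "d \<ge> 0 \<Longrightarrow> 0 \<le> log_weight d"
proof (cases "d = 0")
  case False
  assume "d \<ge> 0"
  then have "d * ln 2 \<le> log_weight d" using False by (intro log_weight_lower) auto
  moreover have "0 \<le> d * ln (2 :: real)" using \<open>d \<ge> 0\<close> by simp
  ultimately show ?thesis by linarith
qed (simp add: log_weight_def)

lemma log_weight_has_derivative:
  assumes d: "d > 0"
  shows "(log_weight has_real_derivative ln (d + 1 / d) + (d\<^sup>2 - 1) / (d\<^sup>2 + 1)) (at d)"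
proof -
  have p: "d + 1 / d > 0" using d by (simp add: add_pos_pos)
  have p2: "d * d + 1 > 0" using d by (simp add: add_pos_pos)
  have i: "((\<lambda>d. 1 / d) has_real_derivative - (1 / (d * d))) (at d)"
    using d by (auto intro!: derivative_eq_intros)
  have 1: "((\<lambda>d. d + 1 / d) has_real_derivative 1 + - (1 / (d * d))) (at d)"
    by (intro DERIV_add DERIV_ident i)
  have 2: "((\<lambda>d. ln (d + 1 / d)) has_real_derivative 1 / (d + 1 / d) * (1 + - (1 / (d * d)))) (at d)"
    by (rule DERIV_chain2[OF DERIV_ln_divide[OF p] 1])
  have 3: "d * (1 / (d + 1 / d) * (1 + - (1 / (d * d)))) = (d\<^sup>2 - 1) / (d\<^sup>2 + 1)"
  proof -
    have "d + 1 / d = (d * d + 1) / d" "1 + - (1 / (d * d)) = (d * d - 1) / (d * d)"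
      using d by (simp_all add: field_simps)
    then show ?thesis using d p2 by (simp add: power2_eq_square)
  qed
  have "(log_weight has_real_derivative 1 * ln (d + 1 / d) + 1 / (d + 1 / d) * (1 + - (1 / (d * d))) * d) (at d)"
    unfolding log_weight_def[abs_def] by (rule DERIV_mult[OF DERIV_ident 2])
  then show ?thesis using 3 by (simp add: mult.commute)
qed

text \<open>\<open>X\<close> is the hyperbolic cosine and \<open>s\<close> the hyperbolic tangent of
  \<open>ln d\<close>, whence \<open>1 / X\<^sup>2 = 1 - s\<^sup>2\<close> and
  \<open>ln X \<ge> s\<^sup>2 / 2\<close>. The sum \<open>s\<^sup>2 / 2 + s\<close> is at least
  \<open>- 1 / 2\<close>, which \<open>ln 2 \<ge> 2 / 3\<close> compensates.\<close>

lemma log_weight_deriv_pos: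
  fixes d :: real
  assumes d: "d > 0"
  shows "ln (d + 1 / d) + (d\<^sup>2 - 1) / (d\<^sup>2 + 1) > 0"
proof -
  define X where "X = (d\<^sup>2 + 1) / (2 * d)"
  define s where "s = (d\<^sup>2 - 1) / (d\<^sup>2 + 1)"
  have X: "X > 0" using d by (simp add: X_def add_pos_pos)
  have p2: "d\<^sup>2 + 1 > 0" by (simp add: add_nonneg_pos)
  have "d + 1 / d = 2 * X" using d by (simp add: X_def field_simps power2_eq_square)
  then have l: "ln (d + 1 / d) = ln 2 + ln X" using X by (simp add: ln_mult)
  have "1 / X\<^sup>2 = 1 - s\<^sup>2"
  proof -
    have "1 - s\<^sup>2 = ((d\<^sup>2 + 1)\<^sup>2 - (d\<^sup>2 - 1)\<^sup>2) / (d\<^sup>2 + 1)\<^sup>2"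
    proof -
      have "1 - (m / p)\<^sup>2 = (p\<^sup>2 - m\<^sup>2) / p\<^sup>2" if "p > 0" for m p :: real
        using that by (simp add: field_simps)
      from this[OF p2] show ?thesis by (simp only: s_def)
    qed
    also have "(d\<^sup>2 + 1)\<^sup>2 - (d\<^sup>2 - 1)\<^sup>2 = (2 * d)\<^sup>2" by (simp add: power2_eq_square algebra_simps)
    finally show ?thesis by (simp add: X_def power_divide)
  qed
  moreover have "ln (1 / X\<^sup>2) \<le> 1 / X\<^sup>2 - 1" using X by (intro ln_le_minus_one) simp
  moreover have "ln (1 / X\<^sup>2) = - (2 * ln X)" using X by (simp add: ln_div ln_realpow)
  ultimately have "s\<^sup>2 / 2 \<le> ln X" by simp
  moreover have "0 \<le> (s + 1)\<^sup>2" by simp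
  then have "- (1 / 2) \<le> s\<^sup>2 / 2 + s" by (simp add: power2_eq_square algebra_simps)
  ultimately have "ln 2 - 1 / 2 \<le> ln (d + 1 / d) + s" unfolding l by linarith
  then show ?thesis using ln2_ge_two_thirds unfolding s_def by linarith
qed

lemma log_weight_mono: "0 \<le> c \<Longrightarrow> c \<le> d \<Longrightarrow> log_weight c \<le> log_weight d"
proof (cases "c = 0")
  case False
  assume "0 \<le> c" "c \<le> d"
  then show ?thesis
  proof (intro DERIV_nonneg_imp_nondecreasing[of c d log_weight])
    fix x assume "c \<le> x"
    then have x: "x > 0" using False \<open>0 \<le> c\<close> by simp
    show "\<exists>y. (log_weight has_real_derivative y) (at x) \<and> 0 \<le> y"
      using log_weight_has_derivative[OF x] less_imp_le[OF log_weight_deriv_pos[OF x]] by blast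
  qed
qed (simp add: log_weight_nonneg log_weight_def[of 0])

text \<open>The numerator of the functional divided by \<open>(4 * pi) ^ 3\<close>, as the surface
  area is \<open>4 * pi * (1 + d)\<close>. Written in \<open>d\<close> alone, it is monotone, so a
  drop of the perimeter in the limit can only lower it.\<close>

definition deficit_weight :: "real \<Rightarrow> real" where
  "deficit_weight d = log_weight d * (1 + d) ^ 3"

lemma deficit_weight_nonneg: "d \<ge> 0 \<Longrightarrow> 0 \<le> deficit_weight d"
  by (simp add: deficit_weight_def log_weight_nonneg)

lemma deficit_weight_mono: "0 \<le> c \<Longrightarrow> c \<le> d \<Longrightarrow> deficit_weight c \<le> deficit_weight d"
  unfolding deficit_weight_def
  by (intro mult_mono power_mono log_weight_mono) (auto simp: log_weight_nonneg)

lemma deficit_weight_pos: "d > 0 \<Longrightarrow> 0 < deficit_weight d"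
proof -
  assume d: "d > 0"
  then have "0 < d * ln (2 :: real)" by simp
  then have "0 < log_weight d" using log_weight_lower[OF d] by linarith
  then show ?thesis using d by (simp add: deficit_weight_def)
qed

section \<open>The class of bodies and the value at a spheroid\<close>

lemma volume_classD:
  assumes "F \<in> volume_class"
  shows "compact F" "convex F" "measure lborel F = 4 * pi / 3" "F \<noteq> {}"
proof -
  show c: "compact F" "convex F" and "F \<noteq> {}"
    using assms by (auto simp: volume_class_def convex_body_def)
  have "measure lebesgue F = 4 * pi / 3" using assms by (simp add: volume_class_def measure_def)
  then show "measure lborel F = 4 * pi / 3" using c by (simp add: borel_compact)
qed

lemma volume_classI:
  assumes "compact F" "convex F" "measure lborel F = 4 * pi / 3"
  shows "F \<in> volume_class"
proof -
  obtain x0 r where x0: "cball x0 r \<subseteq> F" "r > 0"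
    using convex_body_contains_cball[OF assms(2) _ assms(1)] assms(3)
    by (metis divide_pos_pos mult_pos_pos pi_gt_zero zero_less_numeral)
  then have "ball x0 r \<subseteq> interior F" by (meson ball_subset_cball interior_maximal open_ball subset_trans)
  then have "interior F \<noteq> {}" using x0(2) by auto
  moreover have "emeasure lebesgue F = ennreal (4 * pi / 3)"
    using assms emeasure_eq_measure2[OF lmeasurable_compact[OF assms(1)]] by (simp add: borel_compact)
  ultimately show ?thesis using assms by (simp add: volume_class_def convex_body_def)
qed

lemma unit_ball_volume: "measure lborel (cball (x :: real ^ 3) 1) = 4 * pi / 3"
  by (simp add: content_cball unit_ball_vol_3)

lemma perimeter_finite:
  assumes "F \<in> volume_class"
  shows "perimeter F = ereal (surface_area F)" "4 * pi \<le> surface_area F"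
proof -
  note F = volume_classD[OF assms]
  obtain x0 r where x0: "cball x0 r \<subseteq> F" "r > 0"
    using convex_body_contains_cball[OF F(2) _ F(1)] F(3)
    by (metis divide_pos_pos mult_pos_pos pi_gt_zero zero_less_numeral)
  have "perimeter F \<le> ereal (3 * measure lborel F / r)" by (rule perimeter_le_inradius[OF F(1,2) x0])
  moreover have ge: "ereal (4 * pi) \<le> perimeter F" by (rule perimeter_ge_4pi[OF F(1-3)])
  ultimately show eq: "perimeter F = ereal (surface_area F)"
    unfolding surface_area_def by (cases "perimeter F") auto
  show "4 * pi \<le> surface_area F" using ge unfolding eq by simp
qed

text \<open>The inradius bound is sharp for the ball and meets the isoperimetric inequality there;
  no surface integral is computed.\<close>

lemma surface_area_unit_ball: "surface_area (cball (0 :: real ^ 3) 1) = 4 * pi"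
proof -
  have B: "cball (0 :: real ^ 3) 1 \<in> volume_class" by (intro volume_classI) (auto simp: unit_ball_volume)
  have "perimeter (cball (0 :: real ^ 3) 1) \<le> ereal (3 * measure lborel (cball (0 :: real ^ 3) 1) / 1)"
    by (rule perimeter_le_inradius[of _ 0 1]) auto
  then show ?thesis using perimeter_finite[OF B] by (simp add: unit_ball_volume)
qed

lemma deficit:
  assumes "F \<in> volume_class"
  shows "0 \<le> isoperimetric_deficit F" "surface_area F = 4 * pi * (1 + isoperimetric_deficit F)"
    "perimeter F = ereal (4 * pi * (1 + isoperimetric_deficit F))"
proof -
  show "0 \<le> isoperimetric_deficit F" using perimeter_finite[OF assms]
    by (simp add: isoperimetric_deficit_def surface_area_unit_ball)
  show "surface_area F = 4 * pi * (1 + isoperimetric_deficit F)"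
    by (simp add: isoperimetric_deficit_def surface_area_unit_ball field_simps)
  then show "perimeter F = ereal (4 * pi * (1 + isoperimetric_deficit F))" using perimeter_finite[OF assms] by simp
qed

lemma Q_star_formula:
  assumes "F \<in> volume_class" "\<nexists>x r. r > 0 \<and> F = cball x r"
  shows "Q_star F = ereal ((4 * pi) ^ 3 * deficit_weight (isoperimetric_deficit F) / (hausdorff_asymmetry F)\<^sup>2)"
  using assms(2) unfolding Q_star_def deficit(2)[OF assms(1)] power_mult_distrib[of "4 * pi"]
  by (simp add: deficit_weight_def log_weight_def mult_ac)

lemma Q_star_nonneg: "F \<in> volume_class \<Longrightarrow> 0 \<le> Q_star F"
proof (cases "\<exists>x r. r > 0 \<and> F = cball x r")
  case False
  assume F: "F \<in> volume_class"
  show ?thesis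
    unfolding Q_star_formula[OF F False]
    using deficit_weight_nonneg[OF deficit(1)[OF F]] by simp
qed (simp add: Q_star_def)

text \<open>The semi-axes have product 1, which keeps the volume. The inradius 1/2 bounds the
  perimeter by \<open>8 * pi\<close>, so the deficit is at most 1 and the weight at most
  \<open>8 * ln 2\<close>; the long axis makes the asymmetry at least 3. This yields the value
  \<open>8 / 9 * ln 2\<close> without computing the surface area.\<close>

definition spheroid :: "(real ^ 3) set" where
  "spheroid = (\<lambda>x. \<chi> k. (if k = 3 then 4 else 1 / 2) * x $ k) ` cball 0 1"

lemma spheroid_volume_class: "spheroid \<in> volume_class"
proof (rule volume_classI)
  define f :: "real ^ 3 \<Rightarrow> real ^ 3" where "f x = (\<chi> k. (if k = 3 then 4 else 1 / 2) * x $ k)" for x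
  have lin: "linear f" by (rule linearI) (auto simp: f_def vec_eq_iff algebra_simps)
  have E: "spheroid = f ` cball 0 1" by (simp add: spheroid_def f_def[abs_def])
  show c: "compact spheroid" unfolding E
    using lin by (intro compact_continuous_image linear_continuous_on compact_cball) (simp add: linear_linear)
  show "convex spheroid" unfolding E by (rule convex_linear_image[OF lin convex_cball])
  have "measure lebesgue spheroid = \<bar>\<Prod>k\<in>UNIV. (if k = (3::3) then 4 else 1 / 2)\<bar> * measure lebesgue (cball (0 :: real ^ 3) 1)"
    unfolding spheroid_def by (rule measure_stretch) simp
  also have "(\<Prod>k\<in>UNIV. (if k = (3::3) then 4 else 1 / 2 :: real)) = 1"
  proof -
    have "(\<Prod>k\<in>UNIV. (if k = (3::3) then 4 else 1 / 2 :: real)) = 4 * (\<Prod>k\<in>UNIV - {3::3}. (if k = 3 then 4 else 1 / 2))"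
      by (subst prod.remove[of UNIV 3]) auto
    also have "(\<Prod>k\<in>UNIV - {3::3}. (if k = 3 then 4 else 1 / 2)) = (\<Prod>k\<in>UNIV - {3::3}. 1 / 2 :: real)"
      by (intro prod.cong) auto
    also have "\<dots> = (1 / 2) ^ 2" by (simp add: card_Diff_singleton)
    finally show ?thesis by (simp add: power2_eq_square)
  qed
  finally show "measure lborel spheroid = 4 * pi / 3"
    using c unit_ball_volume[of 0] by (simp add: borel_compact)
qed

lemma norm_axis_real: "norm (axis k t :: real ^ 'n) = \<bar>t\<bar>"
  by (simp add: norm_eq_sqrt_inner inner_axis_axis)

lemma spheroid_contains: "cball 0 (1 / 2) \<subseteq> spheroid" "axis 3 4 \<in> spheroid" "axis 3 (- 4) \<in> spheroid"
proof -
  show "cball 0 (1 / 2) \<subseteq> spheroid"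
  proof
    fix y :: "real ^ 3" assume y: "y \<in> cball 0 (1 / 2)"
    define x :: "real ^ 3" where "x = (\<chi> k. y $ k / (if k = 3 then 4 else 1 / 2))"
    have "norm x \<le> norm (2 *\<^sub>R y)"
      by (rule norm_le_componentwise_cart) (auto simp: x_def)
    then have "x \<in> cball 0 1" using y by simp
    moreover have "y = (\<chi> k. (if k = 3 then 4 else 1 / 2) * x $ k)" by (simp add: x_def vec_eq_iff)
    ultimately show "y \<in> spheroid" unfolding spheroid_def by blast
  qed
  have "axis 3 (4 * t) \<in> spheroid" if "\<bar>t\<bar> \<le> 1" for t :: real
    unfolding spheroid_def
    by (rule image_eqI[of _ _ "axis 3 t"]) (use that in \<open>simp_all add: norm_axis_real, simp add: axis_def vec_eq_iff\<close>)
  from this[of 1] this[of "-1"] show "axis 3 4 \<in> spheroid" "axis 3 (- 4) \<in> spheroid" by simp_all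
qed

lemma infdist_cball_ge: "dist p x - r \<le> infdist p (cball x r)" if "r \<ge> 0" for p :: "'a::real_normed_vector"
proof -
  have "dist p x - r \<le> dist p q" if "q \<in> cball x r" for q
    using that dist_triangle[of p x q] by (simp add: dist_commute)
  then show ?thesis using that by (auto simp: infdist_notempty intro!: cINF_greatest)
qed

text \<open>The two tips are 8 apart, so any centre is at distance at least 4 from one of them,
  which is then at least 3 away from the ball.\<close>

lemma spheroid_asymmetry: "3 \<le> hausdorff_asymmetry spheroid"
  unfolding hausdorff_asymmetry_def
proof (rule cINF_greatest)
  fix x :: "real ^ 3"
  have c: "compact spheroid" "compact (unit_ball_at x)"
    using volume_classD[OF spheroid_volume_class] by (auto simp: unit_ball_at_eq)
  have d8: "dist (axis 3 4) (axis 3 (- 4) :: real ^ 3) = 8"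
  proof -
    have "axis 3 4 - axis 3 (- 4) = (axis 3 8 :: real ^ 3)" by (simp add: axis_def vec_eq_iff)
    then show ?thesis by (simp add: dist_norm norm_axis_real)
  qed
  have "4 \<le> dist (axis 3 4) x \<or> 4 \<le> dist (axis 3 (- 4)) x"
    using d8 dist_triangle2[of "axis 3 4" "axis 3 (- 4)" x] by linarith
  then obtain p where p: "p \<in> spheroid" "4 \<le> dist p x"
    using spheroid_contains(2,3) by blast
  have "3 \<le> infdist p (cball x 1)" using infdist_cball_ge[of 1 p x] p by simp
  also have "\<dots> \<le> hausdorff_dist spheroid (unit_ball_at x)"
    using compact_infdist_le_hausdorff_dist(1)[OF c p(1)] by (simp add: unit_ball_at_eq)
  finally show "3 \<le> hausdorff_dist spheroid (unit_ball_at x)" .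
qed simp

lemma volume_class_ball_radius:
  assumes "cball x r \<in> volume_class" "r > 0"
  shows "r = 1"
proof -
  have "4 / 3 * pi * r ^ 3 = 4 * pi / 3"
    using volume_classD(3)[OF assms(1)] assms(2) by (simp add: content_cball unit_ball_vol_3)
  then have "r ^ 3 = 1 ^ 3" by simp
  then show ?thesis using assms(2) by (intro power_eq_imp_eq_base[of r 3 1]) auto
qed

lemma hausdorff_asymmetry_ball: "hausdorff_asymmetry (cball x 1) = 0"
proof -
  have "hausdorff_asymmetry (cball x 1) \<le> hausdorff_dist (cball x 1) (unit_ball_at x)"
    by (rule hausdorff_asymmetry_le) auto
  also have "\<dots> \<le> 0" unfolding unit_ball_at_eq by (rule hausdorff_dist_le) auto
  finally show ?thesis using hausdorff_asymmetry_nonneg[of "cball x 1"] by simp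
qed

lemma not_ball_if_asymmetry_pos:
  assumes "F \<in> volume_class" "0 < hausdorff_asymmetry F"
  shows "\<nexists>x r. r > 0 \<and> F = cball x r"
  using assms volume_class_ball_radius hausdorff_asymmetry_ball by force

lemma Q_star_spheroid: "Q_star spheroid \<le> ereal ((4 * pi) ^ 3 * (8 / 9 * ln 2))"
proof -
  define \<delta> lam where "\<delta> = isoperimetric_deficit spheroid" and "lam = hausdorff_asymmetry spheroid"
  note E = spheroid_volume_class
  have lam: "3 \<le> lam" unfolding lam_def by (rule spheroid_asymmetry)
  have nb: "\<nexists>x r. r > 0 \<and> spheroid = cball x r"
    using lam by (intro not_ball_if_asymmetry_pos[OF E]) (simp add: lam_def)
  have "perimeter spheroid \<le> ereal (3 * measure lborel spheroid / (1 / 2))"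
    using volume_classD[OF E] by (intro perimeter_le_inradius[OF _ _ spheroid_contains(1)]) auto
  then have "\<delta> \<le> 1" using deficit(3)[OF E] volume_classD(3)[OF E] by (simp add: \<delta>_def)
  then have "deficit_weight \<delta> \<le> deficit_weight 1" using deficit(1)[OF E] by (intro deficit_weight_mono) (auto simp: \<delta>_def)
  also have "deficit_weight 1 = 8 * ln 2" by (simp add: deficit_weight_def log_weight_def)
  finally have w: "deficit_weight \<delta> \<le> 8 * ln 2" .
  have "deficit_weight \<delta> / lam\<^sup>2 \<le> 8 * ln 2 / 3\<^sup>2"
    using w lam deficit_weight_nonneg[OF deficit(1)[OF E]]
    by (intro frac_le power_mono) (auto simp: \<delta>_def)
  then have "(4 * pi) ^ 3 * (deficit_weight \<delta> / lam\<^sup>2) \<le> (4 * pi) ^ 3 * (8 / 9 * ln 2)"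
    by (intro mult_left_mono) auto
  then show ?thesis unfolding Q_star_formula[OF E nb] by (simp add: \<delta>_def lam_def)
qed

text \<open>The upper bound for the asymmetry is inserted into the denominator. A factor
  \<open>d\<close> cancels, and the remaining quotient \<open>k d\<close> tends to the reciprocal of
  3/2; the bound \<open>25 / 36\<close> for \<open>ln 2\<close> places the value at the spheroid
  below 2/3.\<close>

lemma Q_star_large_near_ball:
  obtains \<delta>0 where "\<delta>0 > 0" "\<And>F. F \<in> volume_class \<Longrightarrow> 0 < isoperimetric_deficit F \<Longrightarrow> isoperimetric_deficit F < \<delta>0 \<Longrightarrow>
    0 < hausdorff_asymmetry F \<Longrightarrow> ereal ((4 * pi) ^ 3 * (8 / 9 * ln 2)) < Q_star F"
proof -
  define k where "k d = ln (1 / d) / (sqrt (3 / 2 * ln (1 / d)) + 12000)\<^sup>2" for d :: real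
  have "(k \<longlongrightarrow> inverse (((3 / 2) powr (1 / 2))\<^sup>2)) (at_right 0)" unfolding k_def[abs_def] by real_asymp
  then have "(k \<longlongrightarrow> 2 / 3) (at_right 0)" by (simp add: powr_half_sqrt)
  moreover have "8 / 9 * ln 2 < (2 / 3 :: real)" using ln2_le_25_over_36 by simp
  ultimately have "eventually (\<lambda>d. 8 / 9 * ln 2 < k d) (at_right 0)" by (rule order_tendstoD)
  then obtain b where b: "b > 0" "\<And>d. 0 < d \<Longrightarrow> d < b \<Longrightarrow> 8 / 9 * ln 2 < k d"
    by (auto simp: eventually_at_right_field)
  show ?thesis
  proof
    show "min b (1 / 25) > 0" using b by simp
    fix F assume F: "F \<in> volume_class" and d: "0 < isoperimetric_deficit F" "isoperimetric_deficit F < min b (1 / 25)"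
      and l: "0 < hausdorff_asymmetry F"
    define d lam L where "d = isoperimetric_deficit F" and "lam = hausdorff_asymmetry F" and "L = ln (1 / d)"
    have d0: "0 < d" "d < b" "25 * d < 1" "d < 1" using d by (auto simp: d_def)
    have L: "L > 0" unfolding L_def using d0 by (intro ln_gt_zero) auto
    have "lam \<le> sqrt (3 / 2 * d * ln (1 / d)) + 12000 * sqrt d"
      unfolding lam_def using volume_classD[OF F] d0 deficit(3)[OF F]
      by (intro hausdorff_asymmetry_le_deficit) (auto simp: d_def)
    also have "3 / 2 * d * ln (1 / d) = d * (3 / 2 * L)" by (simp add: L_def)
    also have "sqrt (d * (3 / 2 * L)) + 12000 * sqrt d = sqrt d * (sqrt (3 / 2 * L) + 12000)"
      unfolding real_sqrt_mult[of d] by (simp add: algebra_simps)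
    finally have "lam\<^sup>2 \<le> (sqrt d * (sqrt (3 / 2 * L) + 12000))\<^sup>2"
      using l by (intro power_mono) (auto simp: lam_def)
    also have "\<dots> = d * (sqrt (3 / 2 * L) + 12000)\<^sup>2" using d0 by (simp add: power_mult_distrib)
    finally have lam2: "lam\<^sup>2 \<le> d * (sqrt (3 / 2 * L) + 12000)\<^sup>2" .
    have "8 / 9 * ln 2 < k d" using b d0 by simp
    also have "k d = d * L / (d * (sqrt (3 / 2 * L) + 12000)\<^sup>2)" using d0 by (simp add: k_def L_def)
    also have "\<dots> \<le> d * L / lam\<^sup>2"
      using lam2 l L d0 by (intro frac_le) (auto simp: lam_def)
    also have "\<dots> \<le> deficit_weight d / lam\<^sup>2"
    proof (rule divide_right_mono)
      have "L \<le> ln (d + 1 / d)" unfolding L_def using d0 by (intro ln_mono) auto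
      then have "d * L \<le> log_weight d" unfolding log_weight_def using d0 by (intro mult_left_mono) auto
      also have "\<dots> * 1 \<le> log_weight d * (1 + d) ^ 3"
        using d0 log_weight_nonneg[of d] by (intro mult_left_mono one_le_power) auto
      finally show "d * L \<le> deficit_weight d" by (simp add: deficit_weight_def)
    qed simp
    finally have "(4 * pi) ^ 3 * (8 / 9 * ln 2) < (4 * pi) ^ 3 * (deficit_weight d / lam\<^sup>2)"
      by (intro mult_strict_left_mono) auto
    then show "ereal ((4 * pi) ^ 3 * (8 / 9 * ln 2)) < Q_star F"
      unfolding Q_star_formula[OF F not_ball_if_asymmetry_pos[OF F l]] by (simp add: d_def lam_def)
  qed
qed

text \<open>Any point of \<open>F\<close> serves as centre; the distances are then bounded by the
  diameter on one side and by the radius 1 on the other.\<close>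

lemma asymmetry_le_deficit_crude:
  assumes F: "F \<in> volume_class"
  shows "hausdorff_asymmetry F \<le> 65 * (1 + isoperimetric_deficit F)\<^sup>2"
proof -
  define d where "d = isoperimetric_deficit F"
  have d: "d \<ge> 0" unfolding d_def by (rule deficit(1)[OF F])
  have d1: "1 \<le> (1 + d)\<^sup>2" using d by (intro one_le_power) simp
  note F' = volume_classD[OF F]
  obtain x0 where x0: "x0 \<in> F" using F'(4) by blast
  have "hausdorff_asymmetry F \<le> hausdorff_dist F (unit_ball_at x0)" by (rule hausdorff_asymmetry_le[OF F'(1,4)])
  also have "\<dots> \<le> 65 * (1 + d)\<^sup>2"
    unfolding unit_ball_at_eq
  proof (rule hausdorff_dist_le)
    show "infdist a (cball x0 1) \<le> 65 * (1 + d)\<^sup>2" if a: "a \<in> F" for a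
    proof -
      have "infdist a (cball x0 1) \<le> dist a x0" by (intro infdist_le) simp
      also have "\<dots> \<le> 64 * (1 + d)\<^sup>2" unfolding dist_norm
        using deficit(3)[OF F] by (intro diameter_le_perimeter[OF F'(1-3) _ a x0]) (simp add: d_def)
      finally show ?thesis using d1 by linarith
    qed
    show "infdist b F \<le> 65 * (1 + d)\<^sup>2" if b: "b \<in> cball x0 1" for b
    proof -
      have "infdist b F \<le> dist b x0" by (intro infdist_le x0)
      also have "\<dots> \<le> 1" using b by (simp add: dist_commute)
      finally show ?thesis using d1 by linarith
    qed
  qed (use F' in auto)
  finally show ?thesis by (simp add: d_def)
qed

text \<open>The powers in numerator and denominator of \<open>k\<close> are both of order four, so
  divergence is due to the factor \<open>ln (d + 1 / d)\<close> alone.\<close>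

lemma Q_star_large_deficit:
  obtains \<Delta> where "\<And>F. F \<in> volume_class \<Longrightarrow> \<Delta> < isoperimetric_deficit F \<Longrightarrow>
    0 < hausdorff_asymmetry F \<Longrightarrow> ereal ((4 * pi) ^ 3 * (8 / 9 * ln 2)) < Q_star F"
proof -
  define k where "k d = d * ln (d + 1 / d) * (1 + d) ^ 3 / (65 * (1 + d)\<^sup>2)\<^sup>2" for d :: real
  have "filterlim k at_top at_top" unfolding k_def[abs_def] by real_asymp
  then have "eventually (\<lambda>d. 8 / 9 * ln 2 < k d) at_top" unfolding filterlim_at_top_dense by blast
  then obtain b where b: "\<And>d. b \<le> d \<Longrightarrow> 8 / 9 * ln 2 < k d"
    by (auto simp: eventually_at_top_linorder)
  show ?thesis
  proof
    fix F assume F: "F \<in> volume_class" and d: "b < isoperimetric_deficit F" and l: "0 < hausdorff_asymmetry F"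
    define d lam where "d = isoperimetric_deficit F" and "lam = hausdorff_asymmetry F"
    have d0: "d \<ge> 0" unfolding d_def by (rule deficit(1)[OF F])
    have "lam\<^sup>2 \<le> (65 * (1 + d)\<^sup>2)\<^sup>2"
      using asymmetry_le_deficit_crude[OF F] l by (intro power_mono) (auto simp: d_def lam_def)
    then have "deficit_weight d / (65 * (1 + d)\<^sup>2)\<^sup>2 \<le> deficit_weight d / lam\<^sup>2"
      using l d0 deficit_weight_nonneg[OF d0] by (intro divide_left_mono) (auto simp: lam_def)
    moreover have "8 / 9 * ln 2 < deficit_weight d / (65 * (1 + d)\<^sup>2)\<^sup>2"
      using b[of d] d by (simp add: k_def d_def deficit_weight_def log_weight_def)
    ultimately have "8 / 9 * ln 2 < deficit_weight d / lam\<^sup>2" by linarith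
    then have "(4 * pi) ^ 3 * (8 / 9 * ln 2) < (4 * pi) ^ 3 * (deficit_weight d / lam\<^sup>2)"
      by (intro mult_strict_left_mono) auto
    then show "ereal ((4 * pi) ^ 3 * (8 / 9 * ln 2)) < Q_star F"
      unfolding Q_star_formula[OF F not_ball_if_asymmetry_pos[OF F l]] by (simp add: d_def lam_def)
  qed
qed

section \<open>Compactness\<close>

lemma C1_compact_support_translate:
  fixes \<phi> :: "'a::euclidean_space \<Rightarrow> 'b::euclidean_space"
  assumes C1: "C1_compact_support \<phi>"
  shows "C1_compact_support (\<lambda>x. \<phi> (v + x))"
    and "frechet_derivative (\<lambda>x. \<phi> (v + x)) (at x) = frechet_derivative \<phi> (at (v + x))"
proof -
  have der: "((\<lambda>x. \<phi> (v + x)) has_derivative frechet_derivative \<phi> (at (v + x))) (at x)" for x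
  proof -
    have 1: "((\<lambda>x. v + x) has_derivative (\<lambda>h. h)) (at x)" by (auto intro!: derivative_eq_intros)
    have 2: "(\<phi> has_derivative frechet_derivative \<phi> (at (v + x))) (at (v + x))"
      using C1 frechet_derivative_works unfolding C1_compact_support_def by blast
    show ?thesis using diff_chain_at[OF 1 2] by (simp add: o_def)
  qed
  show fr: "frechet_derivative (\<lambda>x. \<phi> (v + x)) (at x) = frechet_derivative \<phi> (at (v + x))" for x
    using frechet_derivative_at[OF der] by simp
  have "{x. \<phi> (v + x) \<noteq> 0} = (+) (- v) ` {x. \<phi> x \<noteq> 0}"
    by (auto simp: image_iff intro!: exI[of _ "v + _"])
  then have "closure {x. \<phi> (v + x) \<noteq> 0} = (+) (- v) ` closure {x. \<phi> x \<noteq> 0}"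
    by (simp only: closure_translation)
  moreover have "compact (closure {x. \<phi> x \<noteq> 0})" using C1 by (simp add: C1_compact_support_def)
  ultimately have "compact (closure {x. \<phi> (v + x) \<noteq> 0})" by (simp only: compact_translation)
  moreover have "continuous_on UNIV (\<lambda>x. frechet_derivative \<phi> (at (v + x)) w)" for w
    using C1 unfolding C1_compact_support_def
    by (intro continuous_on_compose2[of UNIV "\<lambda>x. frechet_derivative \<phi> (at x) w" UNIV "\<lambda>x. v + x"] continuous_intros) auto
  ultimately show "C1_compact_support (\<lambda>x. \<phi> (v + x))"
    using der unfolding C1_compact_support_def fr by (auto simp: differentiable_def)
qed

lemma perimeter_translation_le:
  fixes F :: "'a::euclidean_space set"
  assumes F: "compact F"
  shows "perimeter ((+) v ` F) \<le> perimeter F"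
  unfolding perimeter_def[of "(+) v ` F"]
proof (rule SUP_least)
  fix \<phi> :: "'a \<Rightarrow> 'a" assume "\<phi> \<in> {\<phi>. C1_compact_support \<phi> \<and> (\<forall>x. norm (\<phi> x) \<le> 1)}"
  then have C1: "C1_compact_support \<phi>" and n1: "\<And>x. norm (\<phi> x) \<le> 1" by auto
  have Fb: "F \<in> sets borel" "(+) v ` F \<in> sets borel"
    using F by (auto intro: borel_compact compact_translation)
  have div: "divergence (\<lambda>x. \<phi> (v + x)) x = divergence \<phi> (v + x)" for x
    by (simp add: divergence_def C1_compact_support_translate(2)[OF C1])
  have cont: "continuous_on UNIV (divergence \<phi>)" by (rule C1_divergence_continuous[OF C1])
  have "set_lebesgue_integral lebesgue ((+) v ` F) (divergence \<phi>) = (LINT x:(+) v ` F|lborel. divergence \<phi> x)"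
    by (rule set_lebesgue_integral_lborel[OF cont Fb(2)])
  also have "\<dots> = (LINT x|distr lborel borel ((+) v). indicator ((+) v ` F) x *\<^sub>R divergence \<phi> x)"
    by (simp add: lborel_distr_plus set_lebesgue_integral_def)
  also have "\<dots> = (LINT x|lborel. indicator ((+) v ` F) (v + x) *\<^sub>R divergence \<phi> (v + x))"
    using Fb borel_measurable_continuous_onI[OF cont] by (subst integral_distr) auto
  also have "\<dots> = (LINT x:F|lborel. divergence (\<lambda>x. \<phi> (v + x)) x)"
    unfolding set_lebesgue_integral_def div
    by (intro Bochner_Integration.integral_cong) (auto simp: indicator_def)
  finally have "ereal (set_lebesgue_integral lebesgue ((+) v ` F) (divergence \<phi>))
      = ereal (LINT x:F|lborel. divergence (\<lambda>x. \<phi> (v + x)) x)" by simp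
  also have "\<dots> \<le> perimeter F"
    using C1_compact_support_translate(1)[OF C1] n1 Fb(1) by (intro perimeter_ge) auto
  finally show "ereal (set_lebesgue_integral lebesgue ((+) v ` F) (divergence \<phi>)) \<le> perimeter F" .
qed

lemma translation_inverse: "(+) (- v) ` (+) v ` F = (F :: 'a::ab_group_add set)"
  by (simp add: image_image)

lemma perimeter_translation:
  "compact F \<Longrightarrow> perimeter ((+) v ` F) = perimeter (F :: 'a::euclidean_space set)"
  using perimeter_translation_le[of F v] perimeter_translation_le[of "(+) v ` F" "- v"]
  unfolding translation_inverse by (simp add: compact_translation)

lemma infdist_translation: "infdist (v + x) ((+) v ` S) = infdist x S" for S :: "'a::real_normed_vector set"
  by (cases "S = {}") (simp_all add: infdist_def image_image)

lemma hausdorff_dist_translation: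
  fixes S T :: "'a::real_normed_vector set"
  shows "hausdorff_dist ((+) v ` S) ((+) v ` T) = hausdorff_dist S T"
  unfolding hausdorff_dist_def by (simp add: image_image infdist_translation)

lemma hausdorff_asymmetry_translation: "hausdorff_asymmetry ((+) v ` F) = hausdorff_asymmetry F"
proof -
  have eq: "hausdorff_dist ((+) v ` F) (unit_ball_at x) = hausdorff_dist F (unit_ball_at (x - v))" for x
  proof -
    have "unit_ball_at x = (+) v ` unit_ball_at (x - v)"
      unfolding image_image by (rule image_cong) simp_all
    then show ?thesis by (simp only: hausdorff_dist_translation)
  qed
  have "range (\<lambda>x. hausdorff_dist ((+) v ` F) (unit_ball_at x)) = range (\<lambda>x. hausdorff_dist F (unit_ball_at x))"
    unfolding eq by (intro equalityI subsetI) (auto intro: range_eqI[of _ _ "_ + v"])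
  then show ?thesis by (simp add: hausdorff_asymmetry_def)
qed

lemma volume_class_translation:
  assumes "F \<in> volume_class"
  shows "(+) v ` F \<in> volume_class"
    "isoperimetric_deficit ((+) v ` F) = isoperimetric_deficit F"
proof -
  note F = volume_classD[OF assms]
  have c: "compact ((+) v ` F)" using F by (simp add: compact_translation)
  have "measure lebesgue ((+) v ` F) = measure lebesgue F" by (rule measure_translation)
  then show "(+) v ` F \<in> volume_class"
    using F c by (intro volume_classI) (auto simp: convex_translation borel_compact)
  show "isoperimetric_deficit ((+) v ` F) = isoperimetric_deficit F"
    using F by (simp add: isoperimetric_deficit_def surface_area_def perimeter_translation)
qed

section \<open>Hausdorff limits of convex bodies\<close>

lemma blaschke_selection:
  fixes F :: "nat \<Rightarrow> 'a::euclidean_space set"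
  assumes F: "\<And>n. compact (F n)" "\<And>n. convex (F n)" "\<And>n. 0 \<in> F n" "\<And>n. F n \<subseteq> cball 0 D"
  obtains K and r :: "nat \<Rightarrow> nat" where "strict_mono r" "compact K" "convex K" "K \<noteq> {}"
    "\<And>e. e > 0 \<Longrightarrow> \<exists>N. \<forall>n\<ge>N. (\<forall>x\<in>F (r n). infdist x K \<le> e) \<and> (\<forall>x\<in>K. infdist x (F (r n)) \<le> e)"
proof -
  let ?S = "cball (0 :: 'a) D"
  have D: "D \<ge> 0" using F(3,4)[of 0] by (metis mem_cball_0 norm_zero subsetD)
  have "\<exists>d>0. \<forall>n y. y \<in> ?S \<and> norm (x - y) < d \<longrightarrow> norm (infdist x (F n) - infdist y (F n)) < e" if "e > 0" for x e
    using that infdist_triangle_abs[of x _ y for y]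
    by (intro exI[of _ e]) (auto simp: dist_norm intro: le_less_trans)
  moreover have "norm (infdist x (F n)) \<le> D" if "x \<in> ?S" for n x
    using infdist_le[OF F(3)[of n], of x] that infdist_nonneg[of x "F n"] by (simp add: dist_norm)
  \<comment> \<open>Sets are encoded by their distance functions, which are 1-Lipschitz and bounded
    on the ball, so the Arzela-Ascoli theorem yields a uniform limit \<open>g\<close>. The limit set
    \<open>K\<close> is the zero set of \<open>g\<close>.\<close>
  ultimately obtain g r where g: "continuous_on ?S g" "strict_mono (r :: nat \<Rightarrow> nat)"
    "\<And>e. 0 < e \<Longrightarrow> \<exists>N. \<forall>n x. n \<ge> N \<and> x \<in> ?S \<longrightarrow> norm (infdist x (F (r n)) - g x) < e"
    using Arzela_Ascoli[of ?S "\<lambda>n x. infdist x (F n)" D] by (metis compact_cball)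
  define K where "K = {x \<in> ?S. g x = 0}"
  have g0: "0 \<le> g x" if "x \<in> ?S" for x
  proof (rule ccontr)
    assume "\<not> 0 \<le> g x"
    then have "0 < - g x" by simp
    then obtain N where "\<forall>n y. n \<ge> N \<and> y \<in> ?S \<longrightarrow> norm (infdist y (F (r n)) - g y) < - g x"
      using g(3) by blast
    from this[rule_format, of N x] that infdist_nonneg[of x "F (r N)"] show False by auto
  qed
  have Kmem: "x \<in> K" if x: "x \<in> ?S" and conv: "\<forall>e>0. \<exists>N. \<forall>n\<ge>N. infdist x (F (r n)) \<le> e" for x
  proof -
    have "g x \<le> 0 + e" if e: "e > 0" for e
    proof -
      have e2: "e / 2 > 0" using e by simp
      obtain N1 where N1: "\<forall>n\<ge>N1. infdist x (F (r n)) \<le> e / 2" using conv e2 by blast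
      obtain N2 where N2: "\<forall>n y. n \<ge> N2 \<and> y \<in> ?S \<longrightarrow> norm (infdist y (F (r n)) - g y) < e / 2"
        using g(3)[OF e2] by blast
      have "infdist x (F (r (max N1 N2))) \<le> e / 2" using N1 by simp
      moreover have "\<bar>infdist x (F (r (max N1 N2))) - g x\<bar> < e / 2"
        using N2[rule_format, of "max N1 N2" x] x by simp
      ultimately show ?thesis by linarith
    qed
    then have "g x \<le> 0" by (rule field_le_epsilon)
    then show ?thesis using g0[OF x] x by (simp add: K_def)
  qed
  have KF: "\<exists>N. \<forall>n\<ge>N. \<forall>x\<in>K. infdist x (F (r n)) \<le> e" if e: "e > 0" for e
  proof -
    obtain N where N: "\<forall>n x. n \<ge> N \<and> x \<in> ?S \<longrightarrow> norm (infdist x (F (r n)) - g x) < e"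
      using g(3)[OF e] by blast
    have "infdist x (F (r n)) \<le> e" if "n \<ge> N" "x \<in> K" for n x
      using N[rule_format, of n x] that by (auto simp: K_def)
    then show ?thesis by blast
  qed
  have cK: "compact K"
  proof -
    have "closed K" unfolding K_def by (rule continuous_closed_preimage_constant[OF g(1) closed_cball])
    moreover have "bounded K" by (rule bounded_subset[of ?S]) (auto simp: K_def)
    ultimately show ?thesis by (simp add: compact_eq_bounded_closed)
  qed
  have "0 \<in> K"
  proof (rule Kmem)
    show "\<forall>e>0. \<exists>N. \<forall>n\<ge>N. infdist 0 (F (r n)) \<le> e" using F(3) by auto
  qed (use D in simp)
  then have neK: "K \<noteq> {}" by blast
  have nearest: "\<exists>p\<in>F n. dist x p = infdist x (F n)" for n x
    using infdist_attains_inf[OF compact_imp_closed[OF F(1)[of n]], of x] F(3)[of n] by (metis empty_iff)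
  have vK: "convex K"
  proof (rule convexI)
    fix x y and u v :: real assume xy: "x \<in> K" "y \<in> K" and uv: "0 \<le> u" "0 \<le> v" "u + v = 1"
    show "u *\<^sub>R x + v *\<^sub>R y \<in> K"
    proof (rule Kmem)
      show "u *\<^sub>R x + v *\<^sub>R y \<in> ?S" using xy uv convexD[OF convex_cball, of x 0 D y u v] by (auto simp: K_def)
      show "\<forall>e>0. \<exists>N. \<forall>n\<ge>N. infdist (u *\<^sub>R x + v *\<^sub>R y) (F (r n)) \<le> e"
      proof (intro allI impI)
        fix e :: real assume "e > 0"
        then obtain N where N: "\<forall>n\<ge>N. \<forall>x\<in>K. infdist x (F (r n)) \<le> e" using KF by blast
        have "infdist (u *\<^sub>R x + v *\<^sub>R y) (F (r n)) \<le> e" if n: "n \<ge> N" for n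
        proof -
          obtain p q where p: "p \<in> F (r n)" "dist x p \<le> e" and q: "q \<in> F (r n)" "dist y q \<le> e"
            using N n xy nearest[of "r n" x] nearest[of "r n" y] by metis
          have pq: "u *\<^sub>R p + v *\<^sub>R q \<in> F (r n)" by (rule convexD[OF F(2) p(1) q(1) uv])
          have "infdist (u *\<^sub>R x + v *\<^sub>R y) (F (r n)) \<le> norm ((u *\<^sub>R x + v *\<^sub>R y) - (u *\<^sub>R p + v *\<^sub>R q))"
            using infdist_le[OF pq] by (simp add: dist_norm)
          also have "(u *\<^sub>R x + v *\<^sub>R y) - (u *\<^sub>R p + v *\<^sub>R q) = u *\<^sub>R (x - p) + v *\<^sub>R (y - q)"
            by (simp add: scaleR_diff_right)
          also have "norm \<dots> \<le> u * norm (x - p) + v * norm (y - q)"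
            using norm_triangle_ineq[of "u *\<^sub>R (x - p)" "v *\<^sub>R (y - q)"] uv by simp
          also have "\<dots> \<le> u * e + v * e"
            using p(2) q(2) uv by (intro add_mono mult_left_mono) (auto simp: dist_norm)
          also have "\<dots> = e" using uv(3) by (simp flip: distrib_right)
          finally show ?thesis .
        qed
        then show "\<exists>N. \<forall>n\<ge>N. infdist (u *\<^sub>R x + v *\<^sub>R y) (F (r n)) \<le> e" by blast
      qed
    qed
  qed
  have FK: "\<exists>N. \<forall>n\<ge>N. \<forall>x\<in>F (r n). infdist x K \<le> e" if "e > 0" for e
  proof -
    \<comment> \<open>On this compact set, which avoids \<open>K\<close>, the function
      \<open>g\<close> has a positive minimum; by uniform convergence the bodies eventually miss
      \<open>T\<close>.\<close>
    define T where "T = {x \<in> ?S. e \<le> infdist x K}"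
    have "closed {x. e \<le> infdist x K}" by (intro closed_Collect_le continuous_intros)
    then have "compact (?S \<inter> {x. e \<le> infdist x K})" by (intro compact_Int_closed compact_cball)
    moreover have "T = ?S \<inter> {x. e \<le> infdist x K}" by (auto simp: T_def)
    ultimately have cT: "compact T" by simp
    show ?thesis
    proof (cases "T = {}")
      case True
      have "infdist x K \<le> e" if "x \<in> F n" for x n
      proof (rule ccontr)
        assume "\<not> infdist x K \<le> e"
        then have "x \<in> T" using that F(4)[of n] by (auto simp: T_def)
        with True show False by simp
      qed
      then show ?thesis by blast
    next
      case False
      have "continuous_on T g" by (rule continuous_on_subset[OF g(1)]) (auto simp: T_def)
      then obtain z where z: "z \<in> T" "\<And>x. x \<in> T \<Longrightarrow> g z \<le> g x"
        using continuous_attains_inf[OF cT False] by blast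
      have "g z \<noteq> 0" using z(1) \<open>e > 0\<close> by (auto simp: T_def K_def)
      then have gz: "g z > 0" using g0[of z] z(1) by (auto simp: T_def)
      obtain N where N: "\<forall>n x. n \<ge> N \<and> x \<in> ?S \<longrightarrow> norm (infdist x (F (r n)) - g x) < g z"
        using g(3)[OF gz] by blast
      have "infdist x K \<le> e" if n: "n \<ge> N" and x: "x \<in> F (r n)" for n x
      proof (rule ccontr)
        assume "\<not> infdist x K \<le> e"
        then have "x \<in> T" using F(4)[of "r n"] x by (auto simp: T_def)
        then have "g z \<le> g x" "x \<in> ?S" using z by (auto simp: T_def)
        then show False using N[rule_format, of n x] n x by auto
      qed
      then show ?thesis by blast
    qed
  qed
  have "\<exists>N. \<forall>n\<ge>N. (\<forall>x\<in>F (r n). infdist x K \<le> e) \<and> (\<forall>x\<in>K. infdist x (F (r n)) \<le> e)" if e: "e > 0" for e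
  proof -
    obtain N1 N2 where "\<forall>n\<ge>N1. \<forall>x\<in>F (r n). infdist x K \<le> e" "\<forall>n\<ge>N2. \<forall>x\<in>K. infdist x (F (r n)) \<le> e"
      using FK[OF e] KF[OF e] by blast
    then show ?thesis by (intro exI[of _ "max N1 N2"]) auto
  qed
  then show ?thesis using that[OF g(2) cK vK neK] by blast
qed

text \<open>The boundary of a convex set is negligible. Away from it, points outside
  \<open>K\<close> are eventually outside the bodies by closeness to \<open>K\<close>; for interior
  points the convexity of the bodies is essential.\<close>

lemma hausdorff_limit_indicator:
  fixes F :: "nat \<Rightarrow> 'a::euclidean_space set"
  assumes F: "\<And>n. compact (F n)" "\<And>n. convex (F n)" "\<And>n. F n \<noteq> {}" and K: "compact K" "convex K" "K \<noteq> {}"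
    and lim: "\<And>e. e > 0 \<Longrightarrow> \<exists>N. \<forall>n\<ge>N. (\<forall>x\<in>F n. infdist x K \<le> e) \<and> (\<forall>x\<in>K. infdist x (F n) \<le> e)"
  shows "AE x in lborel. (\<lambda>n. indicator (F n) x :: real) \<longlonglongrightarrow> indicator K x"
proof -
  have "negligible (frontier K)" by (rule negligible_convex_frontier[OF K(2)])
  then have "frontier K \<in> null_sets lborel"
    by (simp add: negligible_iff_null_sets null_sets_completion_iff)
  then have "AE x in lborel. x \<notin> frontier K" by (rule AE_not_in)
  then show ?thesis
  proof eventually_elim
    fix x assume x: "x \<notin> frontier K"
    show "(\<lambda>n. indicator (F n) x :: real) \<longlonglongrightarrow> indicator K x"
    proof (cases "x \<in> K")
      case True
      then have "x \<in> interior K" using x compact_imp_closed[OF K(1)] by (simp add: frontier_def)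
      then obtain \<rho> where \<rho>: "\<rho> > 0" "cball x \<rho> \<subseteq> K" by (meson mem_interior_cball)
      obtain N where N: "\<forall>n\<ge>N. \<forall>x\<in>K. infdist x (F n) \<le> \<rho>" using lim[OF \<rho>(1)] by blast
      have "x \<in> F n" if "n \<ge> N" for n
      proof (rule ccontr)
        assume "x \<notin> F n"
        then have pos: "infdist x (F n) > 0"
          using in_closed_iff_infdist_zero[OF compact_imp_closed[OF F(1)] F(3)] infdist_nonneg[of x "F n"] by (metis less_eq_real_def)
        obtain u where u: "norm u = 1" "\<And>y. infdist x (F n) + u \<bullet> (y - x) \<le> infdist y (F n)"
          using infdist_ge_normal[OF compact_imp_closed[OF F(1)] F(2,3) pos] by blast
        \<comment> \<open>Moving from \<open>x\<close> by \<open>\<rho>\<close> along the outer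
          normal of \<open>F n\<close> stays in \<open>K\<close> but leads to a distance larger than
          \<open>\<rho>\<close> from \<open>F n\<close>.\<close>
        have "x + \<rho> *\<^sub>R u \<in> K" using \<rho> u(1) by (intro subsetD[OF \<rho>(2)]) (simp add: dist_norm)
        then have "infdist (x + \<rho> *\<^sub>R u) (F n) \<le> \<rho>" using N that by blast
        moreover have "u \<bullet> ((x + \<rho> *\<^sub>R u) - x) = \<rho>" using u(1) by (simp add: dot_square_norm)
        ultimately show False using u(2)[of "x + \<rho> *\<^sub>R u"] pos by linarith
      qed
      then have "eventually (\<lambda>n. indicator (F n) x = (1::real)) sequentially"
        by (auto simp: eventually_sequentially intro!: exI[of _ N])
      then show ?thesis using True by (simp add: tendsto_eventually)
    next
      case False
      then have pos: "infdist x K > 0"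
        using in_closed_iff_infdist_zero[OF compact_imp_closed[OF K(1)] K(3)] infdist_nonneg[of x K] by (metis less_eq_real_def)
      obtain N where N: "\<forall>n\<ge>N. \<forall>y\<in>F n. infdist y K \<le> infdist x K / 2" using lim[of "infdist x K / 2"] pos by auto
      have "x \<notin> F n" if "n \<ge> N" for n using N that pos by force
      then have "eventually (\<lambda>n. indicator (F n) x = (0::real)) sequentially"
        by (auto simp: eventually_sequentially intro!: exI[of _ N])
      then show ?thesis using False by (simp add: tendsto_eventually)
    qed
  qed
qed

text \<open>A continuous weight covers both uses: the constant 1 gives the volume of the limit, the
  divergence of a fixed field the lower semicontinuity of the perimeter. The common ball supplies
  the dominating function.\<close>

lemma integral_hausdorff_limit:
  fixes F :: "nat \<Rightarrow> 'a::euclidean_space set" and f :: "'a \<Rightarrow> real"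
  assumes F: "\<And>n. compact (F n)" "\<And>n. convex (F n)" "\<And>n. F n \<noteq> {}" "\<And>n. F n \<subseteq> cball 0 D"
    and K: "compact K" "convex K" "K \<noteq> {}"
    and lim: "\<And>e. e > 0 \<Longrightarrow> \<exists>N. \<forall>n\<ge>N. (\<forall>x\<in>F n. infdist x K \<le> e) \<and> (\<forall>x\<in>K. infdist x (F n) \<le> e)"
    and f: "continuous_on UNIV f"
  shows "(\<lambda>n. LINT x:F n|lborel. f x) \<longlonglongrightarrow> (LINT x:K|lborel. f x)"
  unfolding set_lebesgue_integral_def
proof (rule integral_dominated_convergence)
  have fm: "f \<in> borel_measurable borel" using f by (rule borel_measurable_continuous_onI)
  show "(\<lambda>x. indicator K x *\<^sub>R f x) \<in> borel_measurable lborel"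
    using fm borel_compact[OF K(1)] by measurable
  show "(\<lambda>x. indicator (F n) x *\<^sub>R f x) \<in> borel_measurable lborel" for n
    using fm borel_compact[OF F(1)[of n]] by measurable
  show "integrable lborel (\<lambda>x. indicator (cball 0 D) x *\<^sub>R \<bar>f x\<bar>)"
    by (intro borel_integrable_compact compact_cball continuous_intros continuous_on_subset[OF f]) auto
  show "AE x in lborel. (\<lambda>n. indicator (F n) x *\<^sub>R f x) \<longlonglongrightarrow> indicator K x *\<^sub>R f x"
  proof -
    have "AE x in lborel. (\<lambda>n. indicator (F n) x :: real) \<longlonglongrightarrow> indicator K x"
      by (rule hausdorff_limit_indicator[OF F(1-3) K]) (rule lim)
    then show ?thesis by eventually_elim (intro tendsto_intros)
  qed
  show "AE x in lborel. norm (indicator (F n) x *\<^sub>R f x) \<le> indicator (cball 0 D) x *\<^sub>R \<bar>f x\<bar>" for n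
    using F(4)[of n] by (intro AE_I2) (auto simp: indicator_def)
qed

lemma hausdorff_asymmetry_perturbation:
  assumes F: "compact F" "F \<noteq> {}" and K: "compact K" "K \<noteq> {}"
    and FK: "\<And>x. x \<in> F \<Longrightarrow> infdist x K \<le> e" and KF: "\<And>x. x \<in> K \<Longrightarrow> infdist x F \<le> e"
  shows "hausdorff_asymmetry F \<le> hausdorff_asymmetry K + e"
proof -
  have nearest: "\<exists>p\<in>S. dist x p = infdist x S" if "compact S" "S \<noteq> {}" for S and x :: "real ^ 3"
    using infdist_attains_inf[OF compact_imp_closed[OF that(1)] that(2), of x] by metis
  have "hausdorff_asymmetry F - e \<le> hausdorff_dist K (unit_ball_at x)" for x
  proof -
    let ?B = "cball x 1"
    have "hausdorff_dist F ?B \<le> hausdorff_dist K ?B + e"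
    proof (rule hausdorff_dist_le)
      show "infdist a ?B \<le> hausdorff_dist K ?B + e" if a: "a \<in> F" for a
      proof -
        obtain p where p: "p \<in> K" "dist a p = infdist a K" using nearest[OF K] by blast
        have "infdist a ?B \<le> infdist p ?B + dist a p" by (rule infdist_triangle)
        also have "infdist p ?B \<le> hausdorff_dist K ?B"
          by (rule compact_infdist_le_hausdorff_dist(1)[OF K(1) compact_cball p(1)])
        finally show ?thesis using FK[OF a] p(2) by simp
      qed
      show "infdist b F \<le> hausdorff_dist K ?B + e" if b: "b \<in> ?B" for b
      proof -
        obtain p where p: "p \<in> K" "dist b p = infdist b K" using nearest[OF K] by blast
        have "infdist b F \<le> infdist p F + dist b p" by (rule infdist_triangle)
        also have "dist b p \<le> hausdorff_dist K ?B"
          using compact_infdist_le_hausdorff_dist(2)[OF K(1) compact_cball b] p(2) by simp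
        finally show ?thesis using KF[OF p(1)] by simp
      qed
    qed (use F in auto)
    moreover have "hausdorff_asymmetry F \<le> hausdorff_dist F (unit_ball_at x)"
      by (rule hausdorff_asymmetry_le[OF F])
    ultimately show ?thesis unfolding unit_ball_at_eq by linarith
  qed
  then have "hausdorff_asymmetry F - e \<le> hausdorff_asymmetry K"
    unfolding hausdorff_asymmetry_def[of K] by (intro cINF_greatest) auto
  then show ?thesis by simp
qed

text \<open>A bounded deficit bounds the diameters. Translating a chosen point of each body to the
  origin places them all in one ball without changing deficit or asymmetry, and a selection theorem
  applies after a first extraction that makes the deficits converge.\<close>

lemma volume_class_compactness:
  fixes F :: "nat \<Rightarrow> (real ^ 3) set"
  assumes F: "\<And>n. F n \<in> volume_class" and bd: "\<And>n. isoperimetric_deficit (F n) \<le> \<Delta>"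
  obtains K and r :: "nat \<Rightarrow> nat" and \<delta> where "strict_mono r" "K \<in> volume_class"
    "(\<lambda>n. isoperimetric_deficit (F (r n))) \<longlonglongrightarrow> \<delta>" "isoperimetric_deficit K \<le> \<delta>"
    "\<And>e. e > 0 \<Longrightarrow> \<exists>N. \<forall>n\<ge>N. hausdorff_asymmetry (F (r n)) \<le> hausdorff_asymmetry K + e"
proof -
  define d where "d n = isoperimetric_deficit (F n)" for n
  have d: "0 \<le> d n" "d n \<le> \<Delta>" for n using deficit(1)[OF F] bd by (auto simp: d_def)
  have "bounded (range d)" unfolding bounded_iff using d by (intro exI[of _ \<Delta>]) auto
  then obtain \<delta> r1 where r1: "strict_mono (r1 :: nat \<Rightarrow> nat)" "(d \<circ> r1) \<longlonglongrightarrow> \<delta>"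
    using bounded_imp_convergent_subsequence by blast
  define x0 where "x0 n = (SOME x. x \<in> F n)" for n
  have x0: "x0 n \<in> F n" for n unfolding x0_def using volume_classD(4)[OF F] some_in_eq by blast
  define G where "G n = (+) (- x0 (r1 n)) ` F (r1 n)" for n
  have G: "G n \<in> volume_class" "isoperimetric_deficit (G n) = d (r1 n)"
    "hausdorff_asymmetry (G n) = hausdorff_asymmetry (F (r1 n))" for n
    unfolding G_def d_def by (rule volume_class_translation[OF F] hausdorff_asymmetry_translation)+
  note Gc = volume_classD[OF G(1)]
  define D where "D = 64 * (1 + \<Delta>)\<^sup>2"
  have GD: "G n \<subseteq> cball 0 D" for n
  proof
    fix y assume "y \<in> G n"
    then obtain x where x: "x \<in> F (r1 n)" "y = x - x0 (r1 n)" by (auto simp: G_def)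
    have "norm y \<le> 64 * (1 + d (r1 n))\<^sup>2" unfolding x(2)
      using volume_classD[OF F] deficit(3)[OF F, of "r1 n"] x x0
      by (intro diameter_le_perimeter[of "F (r1 n)"]) (auto simp: d_def)
    also have "\<dots> \<le> D" unfolding D_def using d by (intro mult_left_mono power_mono) auto
    finally show "y \<in> cball 0 D" by simp
  qed
  have G0: "0 \<in> G n" for n using x0[of "r1 n"] by (auto simp: G_def image_iff intro!: bexI[of _ "x0 (r1 n)"])
  obtain K r2 where r2: "strict_mono (r2 :: nat \<Rightarrow> nat)" and K: "compact K" "convex K" "K \<noteq> {}"
    and lim: "\<And>e. e > 0 \<Longrightarrow> \<exists>N. \<forall>n\<ge>N. (\<forall>x\<in>G (r2 n). infdist x K \<le> e) \<and> (\<forall>x\<in>K. infdist x (G (r2 n)) \<le> e)"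
    by (rule blaschke_selection[of G, OF Gc(1,2) G0 GD]) blast
  have conv: "(\<lambda>n. LINT x:G (r2 n)|lborel. f x) \<longlonglongrightarrow> (LINT x:K|lborel. f x)"
    if "continuous_on UNIV f" for f :: "real ^ 3 \<Rightarrow> real"
    by (rule integral_hausdorff_limit[OF Gc(1) Gc(2) Gc(4) GD K _ that]) (rule lim)
  have "(\<lambda>n. LINT x:G (r2 n)|lborel. 1::real) \<longlonglongrightarrow> (LINT x:K|lborel. 1)" by (rule conv) (rule continuous_on_const)
  then have "(\<lambda>n::nat. 4 * pi / 3) \<longlonglongrightarrow> measure lborel K"
    using Gc(1,3) K by (simp add: set_lebesgue_integral_def borel_compact)
  then have "measure lborel K = 4 * pi / 3" using LIMSEQ_unique tendsto_const by blast
  then have KV: "K \<in> volume_class" using K by (intro volume_classI)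
  have lim\<delta>: "(\<lambda>n. d (r1 (r2 n))) \<longlonglongrightarrow> \<delta>"
    using LIMSEQ_subseq_LIMSEQ[OF r1(2) r2] by (simp add: o_def)
  \<comment> \<open>Lower semicontinuity: for each fixed field the integral over the bodies
    converges, and it is bounded by their perimeters.\<close>
  have "perimeter K \<le> ereal (4 * pi * (1 + \<delta>))"
    unfolding perimeter_def
  proof (rule SUP_least)
    fix \<phi> :: "real ^ 3 \<Rightarrow> real ^ 3" assume "\<phi> \<in> {\<phi>. C1_compact_support \<phi> \<and> (\<forall>x. norm (\<phi> x) \<le> 1)}"
    then have C1: "C1_compact_support \<phi>" and n1: "\<And>x. norm (\<phi> x) \<le> 1" by auto
    have cont: "continuous_on UNIV (divergence \<phi>)" by (rule C1_divergence_continuous[OF C1])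
    have le: "(LINT x:G (r2 n)|lborel. divergence \<phi> x) \<le> 4 * pi * (1 + d (r1 (r2 n)))" for n
      using perimeter_ge[OF C1 n1 borel_compact[OF Gc(1)[of "r2 n"]]] deficit(3)[OF G(1), of "r2 n"] G(2)[of "r2 n"] by simp
    have "(\<lambda>n. 4 * pi * (1 + d (r1 (r2 n)))) \<longlonglongrightarrow> 4 * pi * (1 + \<delta>)"
      by (intro tendsto_intros lim\<delta>)
    then have "(LINT x:K|lborel. divergence \<phi> x) \<le> 4 * pi * (1 + \<delta>)"
      by (rule LIMSEQ_le[OF conv[OF cont]]) (use le in blast)
    then show "ereal (set_lebesgue_integral lebesgue K (divergence \<phi>)) \<le> ereal (4 * pi * (1 + \<delta>))"
      using set_lebesgue_integral_lborel[OF cont borel_compact[OF K(1)]] by simp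
  qed
  then have dK: "isoperimetric_deficit K \<le> \<delta>" unfolding deficit(3)[OF KV] by simp
  show ?thesis
  proof
    show "strict_mono (r1 \<circ> r2)" using r1(1) r2 by (rule strict_mono_o)
    show "K \<in> volume_class" by (rule KV)
    show "(\<lambda>n. isoperimetric_deficit (F ((r1 \<circ> r2) n))) \<longlonglongrightarrow> \<delta>" using lim\<delta> by (simp add: d_def)
    show "isoperimetric_deficit K \<le> \<delta>" by (rule dK)
    fix e :: real assume "e > 0"
    then obtain N where N: "\<forall>n\<ge>N. (\<forall>x\<in>G (r2 n). infdist x K \<le> e) \<and> (\<forall>x\<in>K. infdist x (G (r2 n)) \<le> e)"
      using lim by blast
    have "hausdorff_asymmetry (F ((r1 \<circ> r2) n)) \<le> hausdorff_asymmetry K + e" if "n \<ge> N" for n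
    proof -
      have "hausdorff_asymmetry (G (r2 n)) \<le> hausdorff_asymmetry K + e"
        using N that by (intro hausdorff_asymmetry_perturbation Gc K) auto
      then show ?thesis by (simp add: G(3))
    qed
    then show "\<exists>N. \<forall>n\<ge>N. hausdorff_asymmetry (F ((r1 \<circ> r2) n)) \<le> hausdorff_asymmetry K + e" by blast
  qed
qed

section \<open>Existence of a minimizer\<close>

lemma deficit_weight_isCont: "d > 0 \<Longrightarrow> isCont deficit_weight d"
  unfolding deficit_weight_def[abs_def]
  by (intro continuous_intros) (auto intro: DERIV_isCont[OF log_weight_has_derivative])

theorem theorem2:
  shows "\<exists>F\<in>volume_class. Q_star F = (INF E\<in>volume_class. Q_star E)"
proof (rule ccontr)
  assume neg: "\<not> ?thesis"
  define I where "I = (INF E\<in>volume_class. Q_star E)"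
  have I_le: "I \<le> Q_star E" if "E \<in> volume_class" for E unfolding I_def using that by (rule INF_lower)
  have I_ne: "Q_star E \<noteq> I" if "E \<in> volume_class" for E using neg that by (auto simp: I_def)
  have I0: "0 \<le> I" unfolding I_def by (intro INF_greatest Q_star_nonneg)
  text \<open>A non-ball with vanishing asymmetry or deficit would have \<open>Q_star = 0\<close> (division by zero, or \<open>ln 0 = 0\<close>)
    and be minimal.\<close>
  have pos: "Q_star E \<noteq> 0" if "E \<in> volume_class" for E
    using I_le[OF that] I0 I_ne[OF that] by auto
  have nonball: "(\<nexists>x r. r > 0 \<and> E = cball x r) \<and> 0 < isoperimetric_deficit E \<and> 0 < hausdorff_asymmetry E"
    if E: "E \<in> volume_class" and fin: "Q_star E \<noteq> \<infinity>" for E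
  proof -
    have nb: "\<nexists>x r. r > 0 \<and> E = cball x r"
    proof
      assume "\<exists>x r. r > 0 \<and> E = cball x r"
      then have "Q_star E = \<infinity>" unfolding Q_star_def by (rule if_P)
      with fin show False by simp
    qed
    have "isoperimetric_deficit E \<noteq> 0" "hausdorff_asymmetry E \<noteq> 0"
      using pos[OF E] unfolding Q_star_formula[OF E nb] by (auto simp: deficit_weight_def log_weight_def zero_ereal_def)
    then show ?thesis
      using nb deficit(1)[OF E] hausdorff_asymmetry_nonneg[OF volume_classD(1,4)[OF E]] by auto
  qed
  define q where "q = (4 * pi) ^ 3 * (8 / 9 * ln 2)"
  \<comment> \<open>The inequality is strict because, by assumption, the spheroid does not attain
    the infimum.\<close>
  have Iq: "I < ereal q"
    using I_le[OF spheroid_volume_class] I_ne[OF spheroid_volume_class] Q_star_spheroid by (auto simp: q_def)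
  then obtain i where i: "I = ereal i" using I0 by (cases I) auto
  have iq: "i < q" using Iq i by simp
  obtain \<delta>0 where \<delta>0: "\<delta>0 > 0" "\<And>F. F \<in> volume_class \<Longrightarrow> 0 < isoperimetric_deficit F \<Longrightarrow> isoperimetric_deficit F < \<delta>0 \<Longrightarrow>
    0 < hausdorff_asymmetry F \<Longrightarrow> ereal q < Q_star F"
    unfolding q_def by (rule Q_star_large_near_ball) blast
  obtain \<Delta> where \<Delta>: "\<And>F. F \<in> volume_class \<Longrightarrow> \<Delta> < isoperimetric_deficit F \<Longrightarrow>
    0 < hausdorff_asymmetry F \<Longrightarrow> ereal q < Q_star F"
    unfolding q_def by (rule Q_star_large_deficit) blast
  \<comment> \<open>The error equals \<open>q - i\<close> at \<open>n = 0\<close>, so every member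
    of the sequence lies below \<open>q\<close> and no tail has to be taken.\<close>
  have "\<exists>E\<in>volume_class. Q_star E < ereal (i + (q - i) / (real n + 1))" for n
  proof -
    have "I < ereal (i + (q - i) / (real n + 1))" using iq i by simp
    then show ?thesis unfolding I_def by (simp only: INF_less_iff)
  qed
  then obtain F where F: "\<And>n. F n \<in> volume_class" "\<And>n. Q_star (F n) < ereal (i + (q - i) / (real n + 1))"
    by metis
  have Fq: "Q_star (F n) < ereal q" for n
  proof -
    have "(q - i) / (real n + 1) \<le> (q - i) / 1" using iq by (intro divide_left_mono) auto
    then have "ereal (i + (q - i) / (real n + 1)) \<le> ereal q" by simp
    with F(2)[of n] show ?thesis by (rule less_le_trans)
  qed
  have nb: "(\<nexists>x r. r > 0 \<and> F n = cball x r) \<and> 0 < isoperimetric_deficit (F n) \<and> 0 < hausdorff_asymmetry (F n)" for n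
    using Fq[of n] by (intro nonball F) auto
  \<comment> \<open>Values below \<open>q\<close> confine the deficits to the compact interval from
    \<open>\<delta>0 > 0\<close> to \<open>\<Delta>\<close>.\<close>
  have lo: "\<delta>0 \<le> isoperimetric_deficit (F n)" for n
    using \<delta>0(2)[OF F(1)[of n]] nb[of n] Fq[of n] by (meson not_le order_less_asym)
  have hi: "isoperimetric_deficit (F n) \<le> \<Delta>" for n
    using \<Delta>[OF F(1)[of n]] nb[of n] Fq[of n] by (meson not_le order_less_asym)
  obtain K r \<delta> where r: "strict_mono (r :: nat \<Rightarrow> nat)" and K: "K \<in> volume_class"
    and d\<delta>: "(\<lambda>n. isoperimetric_deficit (F (r n))) \<longlonglongrightarrow> \<delta>" and K\<delta>: "isoperimetric_deficit K \<le> \<delta>"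
    and asym: "\<And>e. e > 0 \<Longrightarrow> \<exists>N. \<forall>n\<ge>N. hausdorff_asymmetry (F (r n)) \<le> hausdorff_asymmetry K + e"
    by (rule volume_class_compactness[of F, OF F(1) hi]) blast
  have \<delta>pos: "0 < \<delta>"
    using LIMSEQ_le_const[OF d\<delta>, of \<delta>0] lo \<delta>0(1) by force
  define W where "W n = (4 * pi) ^ 3 * deficit_weight (isoperimetric_deficit (F (r n)))" for n
  have Wlim: "W \<longlonglongrightarrow> (4 * pi) ^ 3 * deficit_weight \<delta>"
    unfolding W_def by (intro tendsto_intros isCont_tendsto_compose[OF deficit_weight_isCont[OF \<delta>pos] d\<delta>])
  have ilim: "(\<lambda>n. i + (q - i) / (real (r n) + 1)) \<longlonglongrightarrow> i"
  proof -
    have "(\<lambda>n. i + (q - i) / (real n + 1)) \<longlonglongrightarrow> i" by real_asymp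
    from LIMSEQ_subseq_LIMSEQ[OF this r] show ?thesis by (simp add: o_def)
  qed
  \<comment> \<open>Kept in product form, since the asymmetry of \<open>K\<close> might still vanish
    at this point.\<close>
  have limit: "(4 * pi) ^ 3 * deficit_weight \<delta> \<le> i * (hausdorff_asymmetry K + e)\<^sup>2" if e: "e > 0" for e
  proof -
    obtain N where N: "\<forall>n\<ge>N. hausdorff_asymmetry (F (r n)) \<le> hausdorff_asymmetry K + e" using asym[OF e] by blast
    have "W n \<le> (i + (q - i) / (real (r n) + 1)) * (hausdorff_asymmetry K + e)\<^sup>2" if n: "n \<ge> N" for n
    proof -
      define l where "l = hausdorff_asymmetry (F (r n))"
      have l: "0 < l" "l \<le> hausdorff_asymmetry K + e" using nb N n by (auto simp: l_def)
      have "ereal (W n / l\<^sup>2) < ereal (i + (q - i) / (real (r n) + 1))"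
        using F(2)[of "r n"] Q_star_formula[OF F(1)] nb[of "r n"] by (simp add: W_def l_def)
      then have "W n / l\<^sup>2 \<le> i + (q - i) / (real (r n) + 1)" by simp
      then have "W n \<le> (i + (q - i) / (real (r n) + 1)) * l\<^sup>2" using l by (simp add: pos_divide_le_eq)
      also have "\<dots> \<le> (i + (q - i) / (real (r n) + 1)) * (hausdorff_asymmetry K + e)\<^sup>2"
        using l iq I0 i by (intro mult_left_mono power_mono add_nonneg_nonneg) auto
      finally show ?thesis .
    qed
    then show ?thesis
      by (intro LIMSEQ_le[OF Wlim tendsto_mult_right[OF ilim]]) blast
  qed
  have "((\<lambda>e. i * (hausdorff_asymmetry K + e)\<^sup>2) \<longlongrightarrow> i * (hausdorff_asymmetry K + 0)\<^sup>2) (at_right 0)"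
    by (intro tendsto_intros)
  moreover have "eventually (\<lambda>e. (4 * pi) ^ 3 * deficit_weight \<delta> \<le> i * (hausdorff_asymmetry K + e)\<^sup>2) (at_right 0)"
    using eventually_at_right_less[of 0] by (rule eventually_mono) (rule limit)
  ultimately have fin: "(4 * pi) ^ 3 * deficit_weight \<delta> \<le> i * (hausdorff_asymmetry K + 0)\<^sup>2"
    by (rule tendsto_lowerbound) simp
  \<comment> \<open>The weight of the positive limit \<open>\<delta>\<close> is positive, so the
    right-hand side of \<open>fin\<close> cannot vanish; in particular the limit body is not a
    ball.\<close>
  have Kpos: "0 < hausdorff_asymmetry K"
  proof -
    have "0 < (4 * pi) ^ 3 * deficit_weight \<delta>" using deficit_weight_pos[OF \<delta>pos] by simp
    then have "hausdorff_asymmetry K \<noteq> 0" using fin by auto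
    then show ?thesis using hausdorff_asymmetry_nonneg[OF volume_classD(1,4)[OF K]] by simp
  qed
  \<comment> \<open>The deficit may drop in the limit, but by monotonicity of the weight this only
    decreases the functional.\<close>
  have "deficit_weight (isoperimetric_deficit K) \<le> deficit_weight \<delta>"
    by (rule deficit_weight_mono[OF deficit(1)[OF K] K\<delta>])
  then have "(4 * pi) ^ 3 * deficit_weight (isoperimetric_deficit K) \<le> (4 * pi) ^ 3 * deficit_weight \<delta>"
    by (intro mult_left_mono) simp_all
  then have "(4 * pi) ^ 3 * deficit_weight (isoperimetric_deficit K) \<le> i * (hausdorff_asymmetry K)\<^sup>2"
    using fin unfolding add_0_right by (rule order_trans)
  then have "(4 * pi) ^ 3 * deficit_weight (isoperimetric_deficit K) / (hausdorff_asymmetry K)\<^sup>2 \<le> i"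
    using Kpos by (simp add: pos_divide_le_eq)
  then have "Q_star K \<le> I"
    unfolding Q_star_formula[OF K not_ball_if_asymmetry_pos[OF K Kpos]] i by simp
  then show False using I_le[OF K] I_ne[OF K] by simp
qed

end
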